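(* I. Up to equivalence, all regular normal extensions to a Lagrangean contact geometry from $(O(p+2,q),O(p,q))$ (with $c=1$), and from $(O(p+1,q+1),O(p,q))$ in the case $b_1^2>b_2^2$ (with $c=-1$), are given by the following one-parameter classes for $t\ge0$: $$\alpha\left(\begin{array}{ccc}0&a&-X^TI \\ -ca&0&-cY^TI \\ X&Y&A\end{array}\right)=\left(\begin{array}{ccc}\frac{n}{2(n+1)}ta&-\left(\frac{n+2}{2(n+1)}ct^2+1\right)X^TI+\frac{n}{2(n+1)}tY^TI&-\frac{(3n+2)(n+2)}{4(n+1)^2}t^2a-ca \\ X&A-\frac{1}{n+1}taE&-\frac{n+2}{2(n+1)}tX-cY \\ a&ctX^TI+Y^TI&\frac{n}{2(n+1)}ta\end{array}\right)$$ with curvature $$\kappa_\alpha\left(\left(\begin{array}{ccc}0&a&-X^TI \\ -ca&0&-cY^TI \\ X&Y&0\end{array}\right),\left(\begin{array}{ccc}0&b&-Z^TI \\ -cb&0&-cU^TI \\ Z&U&0\end{array}\right)\right)$$ $$=\left(\begin{array}{ccc}0&\frac{(n+2)t}{n+1}(1+ct^2)(bX^TI-aZ^TI)&0 \\ 0&\frac{t}{n+1}\big((n+1)R_1-R_2+(n+2)ctR_3\big)-\frac{tr_1}{n+1}E&-\frac{(n+2)t}{n+1}V_1 \\ 0&0&0\end{array}\right),$$ where $R_1=UX^TI-YZ^TI$, $R_2=XU^TI-ZY^TI$, $R_3=ZX^TI-XZ^TI$, $r_1=U^TIX-Y^TIZ$, $V_1=t(bX-aZ)+c(bY-aU)$.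 II. For $(O(p+1,q+1),O(p,q))$ (so $c=-1$) and $b_1^2=b_2^2$: a) for $b_3^2<b_4^2$, $$\alpha\left(\begin{array}{ccc}0&a&-X^TI \\ a&0&Y^TI \\ X&Y&A\end{array}\right)=\left(\begin{array}{ccc}\frac{n}{2(n+1)}a&-\frac{n+2}{2(n+1)}Y^TI-X^TI&-\frac{(3n+2)(n+2)}{4(n+1)^2}a+a \\ X+Y&A-\frac1{n+1}aE&\frac{n}{2(n+1)}(X+Y) \\ a&Y^TI&\frac{n}{2(n+1)}a\end{array}\right)$$ with curvature (same two arguments as in I, with $c=-1$) $$\kappa_\alpha=\left(\begin{array}{ccc}0&\frac{n+2}{n+1}(bY^TI-aZ^TI)+\frac{n+2}{n+1}(bX^TI-aU^TI)&0 \\ 0&\frac1{n+1}\big((n+1)R_1-R_2-(n+2)R_3\big)-\frac{r_1}{n+1}E&0 \\ 0&0&0\end{array}\right),$$ where $R_1=UX^TI-YZ^TI$, $R_2=XU^TI-ZY^TI$, $R_3=YU^TI-UY^TI$, $r_1=U^TIX-Y^TIZ$; b) for $b_3^2=b_4^2$, $$\alpha\left(\begin{array}{ccc}0&a&-X^TI \\ a&0&Y^TI \\ X&Y&A\end{array}\right)=\left(\begin{array}{ccc}\frac{n}{2(n+1)}a&-\frac{n}{4(n+1)}X^TI+\frac{n}{4(n+1)}Y^TI&\frac{n^2}{8(n+1)^2}a \\ X+Y&A-\frac1{n+1}aE&\frac{n}{4(n+1)}(X+Y) \\ 2a&-X^TI+Y^TI&\frac{n}{2(n+1)}a\end{array}\right)$$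 with curvature (same two arguments as in I, with $c=-1$) $$\kappa_\alpha=\left(\begin{array}{ccc}0&0&0 \\ 0&\frac{1}{2(n+1)}\big(nR_1+nR_2+(n+2)R_3-(n+2)R_4\big)-\frac{r_1}{n+1}E&0 \\ 0&0&0\end{array}\right),$$ where $R_1=XU^TI-ZY^TI$, $R_2=UX^TI-YZ^TI$, $R_3=XZ^TI-ZX^TI$, $R_4=YU^TI-UY^TI$, $r_1=U^TIX-Y^TIZ$.
   Context: $n=p+q$; $E$ is the identity matrix; $I$ is the diagonal $n\times n$ matrix with $p$ entries $1$ and $q$ entries $-1$; $X,Y,Z,U\in\mathbb R^n$ are columns, $a,b\in\mathbb R$, $A\in\mathfrak{so}(p,q)$. The Lie algebra $\mathfrak g$ of $G=O(p+2,q)$ ($c=1$) resp. $G=O(p+1,q+1)$ ($c=-1$) consists of the matrices $\left(\begin{array}{ccc}0&a&-X^TI \\ -ca&0&-cY^TI \\ X&Y&A\end{array}\right)$. The underlying symmetric space is $G/H$ with $H=O(p,q)\times O(2)$ resp. $O(p,q)\times O(1,1)$, symmetry $h=\mathrm{diag}(E,-E)$ (block sizes $(2,n)$), and $K=\{\mathrm{diag}(E,A):A\in O(p,q)\}\cong O(p,q)$. Lagrangean contact geometries are parabolic contact geometries of type $(L,P)$, here $L=PGl(n+2,\mathbb R)$, $\mathfrak l=\mathfrak{sl}(n+2,\mathbb R)$, graded by block sizes $(1,n,1)$ with block $(i,j)$ of degree $j-i$; $\mathfrak p=\mathfrak l_0+\mathfrak l_1+\mathfrak l_2$. A Cartan geometry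 of type $(L,P)$ is a $P$-principal bundle with a $P$-equivariant $\mathfrak l$-valued 1-form $\omega$ reproducing generators of fundamental vector fields and isomorphic on each tangent space. Extension: a homomorphism $i:K\to P$, here fixed as $i(\mathrm{diag}(E,A))=\mathrm{diag}(1,A,1)$, and a linear map $\alpha:\mathfrak g\to\mathfrak l$ with $\alpha\circ\mathrm{Ad}(k)=\mathrm{Ad}(i(k))\circ\alpha$ ($k\in K$), $\alpha|_{\mathfrak k}=i'$, $\alpha:\mathfrak g/\mathfrak k\to\mathfrak l/\mathfrak p$ an isomorphism. It yields the Cartan geometry $(G\times_iP\to G/K,\omega_\alpha)$ of type $(L,P)$, $\omega_\alpha$ extending $\alpha\circ\omega_G$ ($\omega_G$ the Maurer–Cartan form), with curvature $\kappa_\alpha(X,Y)=[\alpha(X),\alpha(Y)]-\alpha([X,Y])$ on $\mathfrak g$. Regular: $\kappa$, viewed on $\mathfrak l/\mathfrak p$, satisfies $\kappa(\mathfrak l_i,\mathfrak l_j)\subset\bigoplus_{l\ge i+j+1}\mathfrak l_l$ for $i,j<0$. Normal: $\sum_i\kappa([Z_i,X],X_i)=2\sum_i[Z_i,\kappa(X,X_i)]$ for all $X\in\mathfrak l/\mathfrak p$ ($X_i$ a basis of $\mathfrak l/\mathfrak p$, $Z_i$ the dual basis of $\mathfrak l_1+\mathfrak l_2$), the standard Kostant-codifferential condition. Two extensions are equivalent if there is a principal bundle morphism $\Phi$ of $G\times_iP$ with $\Phi^*\omega_{\alpha'}=\omega_\alpha$. Every regular extension has, for real $b_1,\dots,b_4$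 with $b_1b_4-b_2b_3\ne0$, the $\mathfrak l_{-1}$-part given by blocks $(2,1)$: $b_1X+b_2Y$ and $(3,2)$: $b_3X^TI+b_4Y^TI$, and the $\mathfrak l_{-2}$-part $(b_1b_4-b_2b_3)a$. For $c=-1$ representatives are chosen (using an equivalence exchanging $(b_1,b_3)$ with $(b_2,b_4)$) so that $b_1^2\ge b_2^2$ and, if $b_1^2=b_2^2$, also $b_3^2\le b_4^2$; the case distinction refers to such representatives. *)

theory Defs
  imports "HOL-Analysis.Analysis"
begin

section \<open>Block matrices\<close>

text \<open>
  The type \<open>'n\<close> indexes \<open>\<real>\<^sup>n\<close>. Matrices of size \<open>n + 2\<close> are indexed by \<open>'n gidx\<close> when they are
  cut into blocks of sizes \<open>(1, 1, n)\<close> and by \<open>'n lidx\<close> when they are cut into blocks of sizes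
  \<open>(1, n, 1)\<close>. A row vector is stored as an element of \<open>real ^ 'n\<close>, like a column.
\<close>

datatype 'n gidx = G1 | G2 | GV 'n
datatype 'n lidx = L1 | LV 'n | L2

instance gidx :: (finite) finite
proof
  have *: "(UNIV :: 'a gidx set) = {G1, G2} \<union> range GV"
    by (auto intro: gidx.exhaust)
  show "finite (UNIV :: 'a gidx set)" unfolding * by simp
qed

instance lidx :: (finite) finite
proof
  have *: "(UNIV :: 'a lidx set) = {L1, L2} \<union> range LV"
    by (auto intro: lidx.exhaust)
  show "finite (UNIV :: 'a lidx set)" unfolding * by simp
qed

type_synonym 'n gmatrix = "real ^ 'n gidx ^ 'n gidx"
type_synonym 'n lmatrix = "real ^ 'n lidx ^ 'n lidx"

definition gblock ::
  "real \<Rightarrow> real \<Rightarrow> real ^ 'n \<Rightarrow> real \<Rightarrow> real \<Rightarrow> real ^ 'n \<Rightarrow>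
   real ^ 'n \<Rightarrow> real ^ 'n \<Rightarrow> real ^ 'n ^ 'n \<Rightarrow> ('n::finite) gmatrix" where
  "gblock x11 x12 r13 x21 x22 r23 c31 c32 m33 = (\<chi> i j.
     (case i of
        G1 \<Rightarrow> (case j of G1 \<Rightarrow> x11 | G2 \<Rightarrow> x12 | GV l \<Rightarrow> r13 $ l)
      | G2 \<Rightarrow> (case j of G1 \<Rightarrow> x21 | G2 \<Rightarrow> x22 | GV l \<Rightarrow> r23 $ l)
      | GV k \<Rightarrow> (case j of G1 \<Rightarrow> c31 $ k | G2 \<Rightarrow> c32 $ k | GV l \<Rightarrow> m33 $ k $ l)))"

definition lblock ::
  "real \<Rightarrow> real ^ 'n \<Rightarrow> real \<Rightarrow> real ^ 'n \<Rightarrow> real ^ 'n ^ 'n \<Rightarrow> real ^ 'n \<Rightarrow>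
   real \<Rightarrow> real ^ 'n \<Rightarrow> real \<Rightarrow> ('n::finite) lmatrix" where
  "lblock x11 r12 x13 c21 m22 c23 x31 r32 x33 = (\<chi> i j.
     (case i of
        L1 \<Rightarrow> (case j of L1 \<Rightarrow> x11 | LV l \<Rightarrow> r12 $ l | L2 \<Rightarrow> x13)
      | LV k \<Rightarrow> (case j of L1 \<Rightarrow> c21 $ k | LV l \<Rightarrow> m22 $ k $ l | L2 \<Rightarrow> c23 $ k)
      | L2 \<Rightarrow> (case j of L1 \<Rightarrow> x31 | LV l \<Rightarrow> r32 $ l | L2 \<Rightarrow> x33)))"

definition bracket :: "real ^ 'm ^ 'm \<Rightarrow> real ^ 'm ^ 'm \<Rightarrow> real ^ 'm ^ 'm" where
  "bracket M N = M ** N - N ** M"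

definition Ad :: "real ^ 'm ^ 'm \<Rightarrow> real ^ 'm ^ 'm \<Rightarrow> real ^ 'm ^ 'm" where
  "Ad g M = g ** M ** matrix_inv g"

section \<open>The groups \<open>G\<close> and \<open>K\<close> and their Lie algebras\<close>

text \<open>The order of the entries \<open>1\<close> and \<open>-1\<close> on the diagonal is left arbitrary.\<close>

definition signature_matrix :: "nat \<Rightarrow> nat \<Rightarrow> real ^ 'n ^ 'n \<Rightarrow> bool" where
  "signature_matrix p q I \<longleftrightarrow>
     (\<forall>i j. i \<noteq> j \<longrightarrow> I $ i $ j = 0) \<and> (\<forall>i. I $ i $ i \<in> {1, - 1}) \<and>
     card {i. I $ i $ i = 1} = p \<and> card {i. I $ i $ i = - 1} = q"

text \<open>
  \<open>G\<close> preserves \<open>diag(1, c, I)\<close>; it is \<open>O(p + 2, q)\<close> for \<open>c = 1\<close> and \<open>O(p + 1, q + 1)\<close> for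
  \<open>c = - 1\<close>.
\<close>

definition gram :: "real \<Rightarrow> real ^ 'n ^ 'n \<Rightarrow> ('n::finite) gmatrix" where
  "gram c I = gblock 1 0 0 0 c 0 0 0 I"

definition grpG :: "real \<Rightarrow> real ^ 'n ^ 'n \<Rightarrow> ('n::finite) gmatrix set" where
  "grpG c I = {g. transpose g ** gram c I ** g = gram c I}"

definition grpK :: "real ^ 'n ^ 'n \<Rightarrow> ('n::finite) gmatrix set" where
  "grpK I = {gblock 1 0 0 0 1 0 0 0 A | A. transpose A ** I ** A = I}"

definition so_alg :: "real ^ 'n ^ 'n \<Rightarrow> (real ^ 'n ^ 'n) set" where
  "so_alg I = {A. transpose A ** I + I ** A = 0}"

definition gmat ::
  "real \<Rightarrow> real ^ 'n ^ 'n \<Rightarrow> real \<Rightarrow> real ^ 'n \<Rightarrow> real ^ 'n \<Rightarrow> real ^ 'n ^ 'n \<Rightarrow> ('n::finite) gmatrix"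
where
  "gmat c I a X Y A =
     gblock 0         a  (- (X v* I))
            (- c * a) 0  (- c *\<^sub>R (Y v* I))
            X         Y  A"

definition algG :: "real \<Rightarrow> real ^ 'n ^ 'n \<Rightarrow> ('n::finite) gmatrix set" where
  "algG c I = {gmat c I a X Y A | a X Y A. A \<in> so_alg I}"

definition algK :: "real ^ 'n ^ 'n \<Rightarrow> ('n::finite) gmatrix set" where
  "algK I = {gblock 0 0 0 0 0 0 0 0 A | A. A \<in> so_alg I}"

section \<open>The graded Lie algebra \<open>sl(n + 2)\<close> and the parabolic subgroup\<close>

definition alg_l :: "('n::finite) lmatrix set" where
  "alg_l = {M. trace M = 0}"

fun level :: "'n lidx \<Rightarrow> int" where
  "level L1 = 0" | "level (LV k) = 1" | "level L2 = 2"

definition grade :: "int \<Rightarrow> ('n::finite) lmatrix set" where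
  "grade k = {M \<in> alg_l. \<forall>i j. M $ i $ j \<noteq> 0 \<longrightarrow> level j - level i = k}"

text \<open>The sum of all \<open>grade l\<close> with \<open>l \<ge> k\<close>.\<close>

definition filtr :: "int \<Rightarrow> ('n::finite) lmatrix set" where
  "filtr k = {M \<in> alg_l. \<forall>i j. M $ i $ j \<noteq> 0 \<longrightarrow> level j - level i \<ge> k}"

definition alg_p :: "('n::finite) lmatrix set" where
  "alg_p = filtr 0"

text \<open>
  Elements of \<open>PGl(n + 2)\<close> are represented by invertible matrices up to a nonzero factor:
  \<open>grpP\<close> is the preimage of \<open>P\<close> in \<open>Gl(n + 2)\<close>, and the factor is divided out in \<open>bundle_rel\<close>
  below. The Lie algebra of \<open>PGl(n + 2)\<close>, all matrices modulo multiples of the identity, is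
  identified with the trace-free matrices by \<open>tracefree\<close>.
\<close>

definition upper_block :: "('n::finite) lmatrix set" where
  "upper_block = {M. \<forall>i j. M $ i $ j \<noteq> 0 \<longrightarrow> level j \<ge> level i}"

definition grpP :: "('n::finite) lmatrix set" where
  "grpP = {M. invertible M} \<inter> upper_block"

definition tracefree :: "real ^ 'm ^ 'm \<Rightarrow> real ^ 'm ^ 'm" where
  "tracefree M = M - (trace M / real CARD('m)) *\<^sub>R mat 1"

section \<open>Extensions, curvature, regularity and normality\<close>

text \<open>The homomorphism \<open>i\<close> sending \<open>diag(E, A)\<close> to \<open>diag(1, A, 1)\<close>, and its derivative.\<close>

definition hom_i :: "('n::finite) gmatrix \<Rightarrow> 'n lmatrix" where
  "hom_i g = lblock 1 0 0 0 (\<chi> k l. g $ GV k $ GV l) 0 0 0 1"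

definition hom_i' :: "('n::finite) gmatrix \<Rightarrow> 'n lmatrix" where
  "hom_i' x = lblock 0 0 0 0 (\<chi> k l. x $ GV k $ GV l) 0 0 0 0"

text \<open>
  A linear map on \<open>\<gg>\<close> is given by a function on all matrices of which only the values on
  \<open>algG c I\<close> matter.
\<close>

definition extension ::
  "real \<Rightarrow> real ^ 'n ^ 'n \<Rightarrow> (('n::finite) gmatrix \<Rightarrow> 'n lmatrix) \<Rightarrow> bool" where
  "extension c I \<alpha> \<longleftrightarrow>
     \<alpha> ` algG c I \<subseteq> alg_l \<and>
     (\<forall>x\<in>algG c I. \<forall>y\<in>algG c I. \<alpha> (x + y) = \<alpha> x + \<alpha> y) \<and>
     (\<forall>r. \<forall>x\<in>algG c I. \<alpha> (r *\<^sub>R x) = r *\<^sub>R \<alpha> x) \<and>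
     (\<forall>k\<in>grpK I. \<forall>x\<in>algG c I. \<alpha> (Ad k x) = Ad (hom_i k) (\<alpha> x)) \<and>
     (\<forall>x\<in>algK I. \<alpha> x = hom_i' x) \<and>
     \<comment> \<open>the induced map from \<open>\<gg>/\<kk>\<close> to \<open>\<ll>/\<pp>\<close> is injective and surjective\<close>
     (\<forall>x\<in>algG c I. \<alpha> x \<in> alg_p \<longrightarrow> x \<in> algK I) \<and>
     (\<forall>u\<in>alg_l. \<exists>x\<in>algG c I. u - \<alpha> x \<in> alg_p)"

definition curvature ::
  "(('n::finite) gmatrix \<Rightarrow> 'n lmatrix) \<Rightarrow> 'n gmatrix \<Rightarrow> 'n gmatrix \<Rightarrow> 'n lmatrix" where
  "curvature \<alpha> x y = bracket (\<alpha> x) (\<alpha> y) - \<alpha> (bracket x y)"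

text \<open>
  The curvature viewed on \<open>\<ll>/\<pp>\<close>: a class is given by any representative in \<open>\<ll>\<close> and is pulled back
  to \<open>\<gg>\<close> along \<open>\<alpha>\<close>. The choice of the preimage is immaterial for an extension, since it is unique
  modulo \<open>\<kk>\<close> and the curvature vanishes on \<open>\<kk>\<close>.
\<close>

definition preimage_mod ::
  "real \<Rightarrow> real ^ 'n ^ 'n \<Rightarrow> (('n::finite) gmatrix \<Rightarrow> 'n lmatrix) \<Rightarrow> 'n lmatrix \<Rightarrow> 'n gmatrix" where
  "preimage_mod c I \<alpha> u = (SOME x. x \<in> algG c I \<and> u - \<alpha> x \<in> alg_p)"

definition kappa ::
  "real \<Rightarrow> real ^ 'n ^ 'n \<Rightarrow> (('n::finite) gmatrix \<Rightarrow> 'n lmatrix) \<Rightarrow>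
   'n lmatrix \<Rightarrow> 'n lmatrix \<Rightarrow> 'n lmatrix" where
  "kappa c I \<alpha> u v = curvature \<alpha> (preimage_mod c I \<alpha> u) (preimage_mod c I \<alpha> v)"

definition regular ::
  "real \<Rightarrow> real ^ 'n ^ 'n \<Rightarrow> (('n::finite) gmatrix \<Rightarrow> 'n lmatrix) \<Rightarrow> bool" where
  "regular c I \<alpha> \<longleftrightarrow>
     (\<forall>i j u v. i < 0 \<longrightarrow> j < 0 \<longrightarrow> u \<in> grade i \<longrightarrow> v \<in> grade j \<longrightarrow>
        kappa c I \<alpha> u v \<in> filtr (i + j + 1))"

definition matrix_unit :: "'m \<Rightarrow> 'm \<Rightarrow> real ^ 'm ^ 'm" where
  "matrix_unit i j = (\<chi> k l. if k = i \<and> l = j then 1 else 0)"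

text \<open>
  The basis of \<open>\<ll>/\<pp>\<close> consists of the matrix units \<open>E\<^sub>i\<^sub>j\<close> below the block diagonal. Its dual basis of
  \<open>\<ll>\<^sub>1 + \<ll>\<^sub>2\<close> with respect to the trace form consists of the transposed units \<open>E\<^sub>j\<^sub>i\<close>. The Killing
  form is a multiple of the trace form, so it would rescale both sides of the equation by the
  same factor. Both sums are independent of the chosen basis.
\<close>

definition normal ::
  "real \<Rightarrow> real ^ 'n ^ 'n \<Rightarrow> (('n::finite) gmatrix \<Rightarrow> 'n lmatrix) \<Rightarrow> bool" where
  "normal c I \<alpha> \<longleftrightarrow>
     (\<forall>X\<in>alg_l.
        (\<Sum>(i, j)\<in>{(i, j). level j < level i}.
           kappa c I \<alpha> (bracket (matrix_unit j i) X) (matrix_unit i j)) =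
        2 *\<^sub>R (\<Sum>(i, j)\<in>{(i, j). level j < level i}.
           bracket (matrix_unit j i) (kappa c I \<alpha> X (matrix_unit i j))))"

definition regular_normal_extension ::
  "real \<Rightarrow> real ^ 'n ^ 'n \<Rightarrow> (('n::finite) gmatrix \<Rightarrow> 'n lmatrix) \<Rightarrow> bool" where
  "regular_normal_extension c I \<alpha> \<longleftrightarrow> extension c I \<alpha> \<and> regular c I \<alpha> \<and> normal c I \<alpha>"

definition ext_params ::
  "real \<Rightarrow> real ^ 'n ^ 'n \<Rightarrow> (('n::finite) gmatrix \<Rightarrow> 'n lmatrix) \<Rightarrow>
   real \<Rightarrow> real \<Rightarrow> real \<Rightarrow> real \<Rightarrow> bool" where
  "ext_params c I \<alpha> b1 b2 b3 b4 \<longleftrightarrow>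
     b1 * b4 - b2 * b3 \<noteq> 0 \<and>
     (\<forall>a X Y. \<forall>A\<in>so_alg I.
        (\<forall>k. \<alpha> (gmat c I a X Y A) $ LV k $ L1 = (b1 *\<^sub>R X + b2 *\<^sub>R Y) $ k) \<and>
        (\<forall>k. \<alpha> (gmat c I a X Y A) $ L2 $ LV k = (b3 *\<^sub>R (X v* I) + b4 *\<^sub>R (Y v* I)) $ k) \<and>
        \<alpha> (gmat c I a X Y A) $ L2 $ L1 = (b1 * b4 - b2 * b3) * a)"

section \<open>Equivalence of extensions\<close>

primrec Ck_on ::
  "nat \<Rightarrow> 'a::real_normed_vector set \<Rightarrow> ('a \<Rightarrow> 'b::real_normed_vector) \<Rightarrow> bool" where
  "Ck_on 0 S f \<longleftrightarrow> continuous_on S f"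
| "Ck_on (Suc k) S f \<longleftrightarrow>
     (\<forall>x\<in>S. f differentiable (at x)) \<and> (\<forall>v. Ck_on k S (\<lambda>x. frechet_derivative f (at x) v))"

definition smooth_on ::
  "'a::real_normed_vector set \<Rightarrow> ('a \<Rightarrow> 'b::real_normed_vector) \<Rightarrow> bool" where
  "smooth_on S f \<longleftrightarrow> (\<forall>k. Ck_on k S f)"

text \<open>
  \<open>G \<times>\<^sub>i P\<close> is the quotient of the submanifold \<open>grpG c I \<times> grpP\<close> of a space of pairs of matrices by
  \<open>(g, p) \<sim> (g k, i(k)\<^sup>-\<^sup>1 p)\<close> and by the scalars dividing \<open>grpP\<close> down to \<open>P\<close>.
\<close>

definition prodGP ::
  "real \<Rightarrow> real ^ 'n ^ 'n \<Rightarrow> (('n::finite) gmatrix \<times> 'n lmatrix) set" where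
  "prodGP c I = grpG c I \<times> grpP"

definition bundle_rel ::
  "real \<Rightarrow> real ^ 'n ^ 'n \<Rightarrow>
   ((('n::finite) gmatrix \<times> 'n lmatrix) \<times> ('n gmatrix \<times> 'n lmatrix)) set" where
  "bundle_rel c I = {((g, p), (g', p')). (g, p) \<in> prodGP c I \<and>
     (\<exists>k\<in>grpK I. \<exists>s. s \<noteq> 0 \<and> g' = g ** k \<and> p' = s *\<^sub>R (matrix_inv (hom_i k) ** p))}"

definition assoc_bundle ::
  "real \<Rightarrow> real ^ 'n ^ 'n \<Rightarrow> (('n::finite) gmatrix \<times> 'n lmatrix) set set" where
  "assoc_bundle c I = prodGP c I // bundle_rel c I"

definition proj ::
  "real \<Rightarrow> real ^ 'n ^ 'n \<Rightarrow> ('n::finite) gmatrix \<times> 'n lmatrix \<Rightarrow> ('n gmatrix \<times> 'n lmatrix) set" where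
  "proj c I z = bundle_rel c I `` {z}"

definition right_act ::
  "(('n::finite) gmatrix \<times> 'n lmatrix) set \<Rightarrow> 'n lmatrix \<Rightarrow> ('n gmatrix \<times> 'n lmatrix) set" where
  "right_act e r = (\<lambda>(g, p). (g, p ** r)) ` e"

text \<open>
  A map of \<open>G \<times>\<^sub>i P\<close> is smooth iff around every point it lifts along the submersion \<open>proj\<close> to a smooth
  map of \<open>grpG c I \<times> grpP\<close>; the latter are the restrictions of smooth maps on open sets of pairs of
  matrices.
\<close>

definition local_lift ::
  "real \<Rightarrow> real ^ 'n ^ 'n \<Rightarrow>
   ((('n::finite) gmatrix \<times> 'n lmatrix) set \<Rightarrow> ('n gmatrix \<times> 'n lmatrix) set) \<Rightarrow>
   ('n gmatrix \<times> 'n lmatrix) set \<Rightarrow>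
   ('n gmatrix \<times> 'n lmatrix \<Rightarrow> 'n gmatrix \<times> 'n lmatrix) \<Rightarrow> bool" where
  "local_lift c I \<Phi> V F \<longleftrightarrow>
     open V \<and> smooth_on V F \<and>
     (\<forall>z\<in>V \<inter> prodGP c I. F z \<in> prodGP c I \<and> \<Phi> (proj c I z) = proj c I (F z))"

definition bundle_morphism ::
  "real \<Rightarrow> real ^ 'n ^ 'n \<Rightarrow>
   ((('n::finite) gmatrix \<times> 'n lmatrix) set \<Rightarrow> ('n gmatrix \<times> 'n lmatrix) set) \<Rightarrow> bool" where
  "bundle_morphism c I \<Phi> \<longleftrightarrow>
     \<Phi> ` assoc_bundle c I \<subseteq> assoc_bundle c I \<and>
     (\<forall>e\<in>assoc_bundle c I. \<forall>r\<in>grpP. \<Phi> (right_act e r) = right_act (\<Phi> e) r) \<and>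
     (\<forall>z\<in>prodGP c I. \<exists>V F. z \<in> V \<and> local_lift c I \<Phi> V F)"

definition tangent ::
  "real \<Rightarrow> real ^ 'n ^ 'n \<Rightarrow> ('n::finite) gmatrix \<times> 'n lmatrix \<Rightarrow> ('n gmatrix \<times> 'n lmatrix) set" where
  "tangent c I = (\<lambda>(g, p). {(g ** \<xi>, p ** \<eta>) | \<xi> \<eta>. \<xi> \<in> algG c I \<and> \<eta> \<in> upper_block})"

text \<open>
  The pullback of \<open>\<omega>\<^sub>\<alpha>\<close> along \<open>proj\<close>: at \<open>(g, p)\<close> it is \<open>Ad(p\<^sup>-\<^sup>1) \<circ> \<alpha>\<close> of the Maurer-Cartan form of \<open>G\<close>
  plus the Maurer-Cartan form of \<open>P\<close>.
\<close>

definition omega ::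
  "(('n::finite) gmatrix \<Rightarrow> 'n lmatrix) \<Rightarrow> 'n gmatrix \<times> 'n lmatrix \<Rightarrow>
   'n gmatrix \<times> 'n lmatrix \<Rightarrow> 'n lmatrix" where
  "omega \<alpha> = (\<lambda>(g, p) (v, w).
     Ad (matrix_inv p) (\<alpha> (matrix_inv g ** v)) + tracefree (matrix_inv p ** w))"

text \<open>
  \<open>pulls_back c I \<Phi> \<alpha>' \<alpha>\<close> says \<open>\<Phi>\<^sup>* \<omega>\<^bsub>\<alpha>'\<^esub> = \<omega>\<^bsub>\<alpha>\<^esub>\<close>. The identity is checked on \<open>grpG c I \<times> grpP\<close> through local
  lifts of \<open>\<Phi>\<close>; this does not depend on the lift, because \<open>omega\<close> comes from the quotient.
\<close>

definition pulls_back ::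
  "real \<Rightarrow> real ^ 'n ^ 'n \<Rightarrow>
   ((('n::finite) gmatrix \<times> 'n lmatrix) set \<Rightarrow> ('n gmatrix \<times> 'n lmatrix) set) \<Rightarrow>
   ('n gmatrix \<Rightarrow> 'n lmatrix) \<Rightarrow> ('n gmatrix \<Rightarrow> 'n lmatrix) \<Rightarrow> bool" where
  "pulls_back c I \<Phi> \<alpha>' \<alpha> \<longleftrightarrow>
     (\<forall>z\<in>prodGP c I. \<exists>V F. z \<in> V \<and> local_lift c I \<Phi> V F \<and>
        (\<forall>w\<in>tangent c I z. omega \<alpha>' (F z) (frechet_derivative F (at z) w) = omega \<alpha> z w))"

definition equivalent ::
  "real \<Rightarrow> real ^ 'n ^ 'n \<Rightarrow>
   (('n::finite) gmatrix \<Rightarrow> 'n lmatrix) \<Rightarrow> ('n gmatrix \<Rightarrow> 'n lmatrix) \<Rightarrow> bool" where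
  "equivalent c I \<alpha> \<alpha>' \<longleftrightarrow> (\<exists>\<Phi>. bundle_morphism c I \<Phi> \<and> pulls_back c I \<Phi> \<alpha>' \<alpha>)"

section \<open>The normal forms\<close>

definition of_blocks ::
  "(real \<Rightarrow> real ^ 'n \<Rightarrow> real ^ 'n \<Rightarrow> real ^ 'n ^ 'n \<Rightarrow> 'b) \<Rightarrow> ('n::finite) gmatrix \<Rightarrow> 'b" where
  "of_blocks f M =
     f (M $ G1 $ G2) (\<chi> k. M $ GV k $ G1) (\<chi> k. M $ GV k $ G2) (\<chi> k l. M $ GV k $ GV l)"

lemma of_blocks_gmat: "of_blocks f (gmat c I a X Y A) = f a X Y A"
  by (simp add: of_blocks_def gmat_def gblock_def vec_lambda_eta)

text \<open>The square matrix \<open>U X\<^sup>T I\<close>.\<close>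

definition outer :: "real ^ 'n ^ 'n \<Rightarrow> real ^ 'n \<Rightarrow> real ^ 'n \<Rightarrow> real ^ 'n ^ 'n" where
  "outer I U X = (\<chi> k l. U $ k * (X v* I) $ l)"

definition alpha_I :: "real \<Rightarrow> real ^ 'n ^ 'n \<Rightarrow> real \<Rightarrow> ('n::finite) gmatrix \<Rightarrow> 'n lmatrix" where
  "alpha_I c I t = of_blocks (\<lambda>a X Y A. let n = real CARD('n) in
     lblock
       (n / (2 * (n + 1)) * t * a)
       (- ((n + 2) / (2 * (n + 1)) * c * t\<^sup>2 + 1) *\<^sub>R (X v* I) + (n / (2 * (n + 1)) * t) *\<^sub>R (Y v* I))
       (- ((3 * n + 2) * (n + 2) / (4 * (n + 1)\<^sup>2)) * t\<^sup>2 * a - c * a)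

       X
       (A - (1 / (n + 1) * t * a) *\<^sub>R mat 1)
       (- ((n + 2) / (2 * (n + 1)) * t) *\<^sub>R X - c *\<^sub>R Y)

       a
       ((c * t) *\<^sub>R (X v* I) + Y v* I)
       (n / (2 * (n + 1)) * t * a))"

definition curv_I ::
  "real \<Rightarrow> real ^ 'n ^ 'n \<Rightarrow> real \<Rightarrow> real \<Rightarrow> real ^ 'n \<Rightarrow> real ^ 'n \<Rightarrow>
   real \<Rightarrow> real ^ 'n \<Rightarrow> real ^ 'n \<Rightarrow> ('n::finite) lmatrix" where
  "curv_I c I t a X Y b Z U =
    (let n = real CARD('n);
         R1 = outer I U X - outer I Y Z;
         R2 = outer I X U - outer I Z Y;
         R3 = outer I Z X - outer I X Z;
         r1 = (U v* I) \<bullet> X - (Y v* I) \<bullet> Z;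
         V1 = t *\<^sub>R (b *\<^sub>R X - a *\<^sub>R Z) + c *\<^sub>R (b *\<^sub>R Y - a *\<^sub>R U)
     in lblock
       0
       (((n + 2) * t / (n + 1) * (1 + c * t\<^sup>2)) *\<^sub>R (b *\<^sub>R (X v* I) - a *\<^sub>R (Z v* I)))
       0

       0
       ((t / (n + 1)) *\<^sub>R ((n + 1) *\<^sub>R R1 - R2 + ((n + 2) * c * t) *\<^sub>R R3)
          - (t * r1 / (n + 1)) *\<^sub>R mat 1)
       (- ((n + 2) * t / (n + 1)) *\<^sub>R V1)

       0
       0
       0)"

definition alpha_IIa :: "real ^ 'n ^ 'n \<Rightarrow> ('n::finite) gmatrix \<Rightarrow> 'n lmatrix" where
  "alpha_IIa I = of_blocks (\<lambda>a X Y A. let n = real CARD('n) in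
     lblock
       (n / (2 * (n + 1)) * a)
       (- ((n + 2) / (2 * (n + 1))) *\<^sub>R (Y v* I) - X v* I)
       (- ((3 * n + 2) * (n + 2) / (4 * (n + 1)\<^sup>2)) * a + a)

       (X + Y)
       (A - (1 / (n + 1) * a) *\<^sub>R mat 1)
       ((n / (2 * (n + 1))) *\<^sub>R (X + Y))

       a
       (Y v* I)
       (n / (2 * (n + 1)) * a))"

definition curv_IIa ::
  "real ^ 'n ^ 'n \<Rightarrow> real \<Rightarrow> real ^ 'n \<Rightarrow> real ^ 'n \<Rightarrow>
   real \<Rightarrow> real ^ 'n \<Rightarrow> real ^ 'n \<Rightarrow> ('n::finite) lmatrix" where
  "curv_IIa I a X Y b Z U =
    (let n = real CARD('n);
         R1 = outer I U X - outer I Y Z;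
         R2 = outer I X U - outer I Z Y;
         R3 = outer I Y U - outer I U Y;
         r1 = (U v* I) \<bullet> X - (Y v* I) \<bullet> Z
     in lblock
       0
       (((n + 2) / (n + 1)) *\<^sub>R (b *\<^sub>R (Y v* I) - a *\<^sub>R (Z v* I))
          + ((n + 2) / (n + 1)) *\<^sub>R (b *\<^sub>R (X v* I) - a *\<^sub>R (U v* I)))
       0

       0
       ((1 / (n + 1)) *\<^sub>R ((n + 1) *\<^sub>R R1 - R2 - (n + 2) *\<^sub>R R3) - (r1 / (n + 1)) *\<^sub>R mat 1)
       0

       0
       0
       0)"

definition alpha_IIb :: "real ^ 'n ^ 'n \<Rightarrow> ('n::finite) gmatrix \<Rightarrow> 'n lmatrix" where
  "alpha_IIb I = of_blocks (\<lambda>a X Y A. let n = real CARD('n) in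
     lblock
       (n / (2 * (n + 1)) * a)
       (- (n / (4 * (n + 1))) *\<^sub>R (X v* I) + (n / (4 * (n + 1))) *\<^sub>R (Y v* I))
       (n\<^sup>2 / (8 * (n + 1)\<^sup>2) * a)

       (X + Y)
       (A - (1 / (n + 1) * a) *\<^sub>R mat 1)
       ((n / (4 * (n + 1))) *\<^sub>R (X + Y))

       (2 * a)
       (- (X v* I) + Y v* I)
       (n / (2 * (n + 1)) * a))"

definition curv_IIb ::
  "real ^ 'n ^ 'n \<Rightarrow> real \<Rightarrow> real ^ 'n \<Rightarrow> real ^ 'n \<Rightarrow>
   real \<Rightarrow> real ^ 'n \<Rightarrow> real ^ 'n \<Rightarrow> ('n::finite) lmatrix" where
  "curv_IIb I a X Y b Z U =
    (let n = real CARD('n);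
         R1 = outer I X U - outer I Z Y;
         R2 = outer I U X - outer I Y Z;
         R3 = outer I X Z - outer I Z X;
         R4 = outer I Y U - outer I U Y;
         r1 = (U v* I) \<bullet> X - (Y v* I) \<bullet> Z
     in lblock
       0
       0
       0

       0
       ((1 / (2 * (n + 1))) *\<^sub>R (n *\<^sub>R R1 + n *\<^sub>R R2 + (n + 2) *\<^sub>R R3 - (n + 2) *\<^sub>R R4)
          - (r1 / (n + 1)) *\<^sub>R mat 1)
       0

       0
       0
       0)"

end

theory Submission
  imports Defs
begin

text \<open>
  The group \<open>K = O(p, q)\<close> is so large that an extension is a finite list of numbers. A \<open>K\<close>-equivariant
  linear map of \<open>\<real>\<^sup>n\<close> to itself commutes with all reflections, so it maps every non-isotropic vector to
  a multiple of itself and is a scalar (\<open>commuting_scalar\<close>). The element \<open>-E\<close> of \<open>K\<close> separates the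
  blocks fed by \<open>a\<close> from those fed by \<open>X\<close> and \<open>Y\<close>. Hence \<open>\<alpha>\<close> is given by thirteen numbers
  (\<open>extension_has_coeffs\<close>), and its curvature is an equivariant 2-form given by seventeen numbers that
  are quadratic in the first thirteen (\<open>curvature_coeffs\<close>).

  Write \<open>D = b\<^sub>1b\<^sub>4 - b\<^sub>2b\<^sub>3\<close>. Such a map is an extension iff its values are trace-free and both \<open>D\<close> and
  the entry in the lower left corner are nonzero, and it is regular iff that entry is \<open>D\<close>. The Kostant
  codifferential of an equivariant 2-form is again equivariant, so normality amounts to eight scalar
  equations (\<open>normal_equation_blocks\<close>). Contracting them with \<open>(b\<^sub>1, b\<^sub>2)\<close> and \<open>(b\<^sub>3, b\<^sub>4)\<close> decouples
  them: the corner blocks of the curvature vanish, and three further equations express the middle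
  diagonal coefficient and one combination each of the remaining coefficients in the blocks \<open>(1, 2)\<close> and
  \<open>(2, 3)\<close> by \<open>b\<^sub>1, \<dots>, b\<^sub>4\<close> (\<open>normality_equations\<close>). Given \<open>b\<^sub>1, \<dots>, b\<^sub>4\<close> this leaves exactly one free number, the
  difference of the two outer diagonal coefficients.

  Equivalences come from the maps \<open>(g, p) \<mapsto> (g h\<^sub>0, p\<^sub>0 p)\<close> with constant \<open>h\<^sub>0 \<in> G\<close> commuting with \<open>K\<close> and
  \<open>p\<^sub>0 \<in> P\<close> commuting with \<open>i(K)\<close> (\<open>equivalent_by_translation\<close>). Here \<open>h\<^sub>0\<close> is an isometry of the plane
  with form \<open>diag(1, c)\<close> and acts on \<open>(b\<^sub>1, b\<^sub>2)\<close> and on \<open>(b\<^sub>3, b\<^sub>4)\<close> simultaneously, the diagonal of \<open>p\<^sub>0\<close>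
  rescales these two vectors independently, and the upper right corner of \<open>p\<^sub>0\<close> shifts the free number.
  So two normal extensions are equivalent as soon as their \<open>b\<^sub>1, \<dots>, b\<^sub>4\<close> are related by such a
  transformation (\<open>coeffs_equivalent\<close>). If \<open>b\<^sub>1\<^sup>2 + c b\<^sub>2\<^sup>2 > 0\<close>, which is automatic for \<open>c = 1\<close>, the first
  vector can be moved to \<open>(1, 0)\<close> and then the second one to \<open>(c t, 1)\<close>, and a reflection makes \<open>t\<close>
  nonnegative. If \<open>c = -1\<close> and \<open>b\<^sub>1\<^sup>2 = b\<^sub>2\<^sup>2\<close>, the first vector can be moved to \<open>(1, 1)\<close>, which is
  isotropic, and the second one to \<open>(0, 1)\<close> or to \<open>(-1, 1)\<close> according to whether \<open>b\<^sub>3\<^sup>2 < b\<^sub>4\<^sup>2\<close> or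
  \<open>b\<^sub>3\<^sup>2 = b\<^sub>4\<^sup>2\<close>.
\<close>

section \<open>Block matrices\<close>

lemma all_lidx: "(\<forall>i::'n lidx. P i) \<longleftrightarrow> P L1 \<and> (\<forall>k. P (LV k)) \<and> P L2"
  by (metis lidx.exhaust)

lemma all_gidx: "(\<forall>i::'n gidx. P i) \<longleftrightarrow> P G1 \<and> P G2 \<and> (\<forall>k. P (GV k))"
  by (metis gidx.exhaust)

lemma sum_lidx: "(\<Sum>i\<in>UNIV. f (i::'n::finite lidx)) = f L1 + (\<Sum>k\<in>UNIV. f (LV k)) + f L2"
proof -
  have U: "(UNIV :: 'n lidx set) = insert L1 (insert L2 (range LV))"
    by (auto intro: lidx.exhaust)
  have R: "sum f (range LV) = (\<Sum>k\<in>UNIV. f (LV k))"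
    by (subst sum.reindex) (auto simp: inj_on_def)
  have "sum f UNIV = f L1 + (f L2 + sum f (range LV))"
    unfolding U by (subst sum.insert; (subst sum.insert)?; auto)
  then show ?thesis
    unfolding R by (simp add: ac_simps)
qed

lemma sum_gidx: "(\<Sum>i\<in>UNIV. f (i::'n::finite gidx)) = f G1 + f G2 + (\<Sum>k\<in>UNIV. f (GV k))"
proof -
  have U: "(UNIV :: 'n gidx set) = insert G1 (insert G2 (range GV))"
    by (auto intro: gidx.exhaust)
  have R: "sum f (range GV) = (\<Sum>k\<in>UNIV. f (GV k))"
    by (subst sum.reindex) (auto simp: inj_on_def)
  have "sum f UNIV = f G1 + (f G2 + sum f (range GV))"
    unfolding U by (subst sum.insert; (subst sum.insert)?; auto)
  then show ?thesis
    unfolding R by (simp add: ac_simps)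
qed

lemma lblock_nth [simp]:
  "lblock x11 r12 x13 c21 m22 c23 x31 r32 x33 $ L1 $ L1 = x11"
  "lblock x11 r12 x13 c21 m22 c23 x31 r32 x33 $ L1 $ LV l = r12 $ l"
  "lblock x11 r12 x13 c21 m22 c23 x31 r32 x33 $ L1 $ L2 = x13"
  "lblock x11 r12 x13 c21 m22 c23 x31 r32 x33 $ LV k $ L1 = c21 $ k"
  "lblock x11 r12 x13 c21 m22 c23 x31 r32 x33 $ LV k $ LV l = m22 $ k $ l"
  "lblock x11 r12 x13 c21 m22 c23 x31 r32 x33 $ LV k $ L2 = c23 $ k"
  "lblock x11 r12 x13 c21 m22 c23 x31 r32 x33 $ L2 $ L1 = x31"
  "lblock x11 r12 x13 c21 m22 c23 x31 r32 x33 $ L2 $ LV l = r32 $ l"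
  "lblock x11 r12 x13 c21 m22 c23 x31 r32 x33 $ L2 $ L2 = x33"
  by (simp_all add: lblock_def)

lemma gblock_nth [simp]:
  "gblock x11 x12 r13 x21 x22 r23 c31 c32 m33 $ G1 $ G1 = x11"
  "gblock x11 x12 r13 x21 x22 r23 c31 c32 m33 $ G1 $ G2 = x12"
  "gblock x11 x12 r13 x21 x22 r23 c31 c32 m33 $ G1 $ GV l = r13 $ l"
  "gblock x11 x12 r13 x21 x22 r23 c31 c32 m33 $ G2 $ G1 = x21"
  "gblock x11 x12 r13 x21 x22 r23 c31 c32 m33 $ G2 $ G2 = x22"
  "gblock x11 x12 r13 x21 x22 r23 c31 c32 m33 $ G2 $ GV l = r23 $ l"
  "gblock x11 x12 r13 x21 x22 r23 c31 c32 m33 $ GV k $ G1 = c31 $ k"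
  "gblock x11 x12 r13 x21 x22 r23 c31 c32 m33 $ GV k $ G2 = c32 $ k"
  "gblock x11 x12 r13 x21 x22 r23 c31 c32 m33 $ GV k $ GV l = m33 $ k $ l"
  by (simp_all add: gblock_def)

lemma lmatrix_eq_iff:
  "(M :: ('n::finite) lmatrix) = N \<longleftrightarrow>
     M $ L1 $ L1 = N $ L1 $ L1 \<and> (\<forall>l. M $ L1 $ LV l = N $ L1 $ LV l) \<and> M $ L1 $ L2 = N $ L1 $ L2 \<and>
     (\<forall>k. M $ LV k $ L1 = N $ LV k $ L1) \<and> (\<forall>k l. M $ LV k $ LV l = N $ LV k $ LV l) \<and>
     (\<forall>k. M $ LV k $ L2 = N $ LV k $ L2) \<and>
     M $ L2 $ L1 = N $ L2 $ L1 \<and> (\<forall>l. M $ L2 $ LV l = N $ L2 $ LV l) \<and> M $ L2 $ L2 = N $ L2 $ L2"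
  unfolding vec_eq_iff all_lidx by auto

lemma gmatrix_eq_iff:
  "(M :: ('n::finite) gmatrix) = N \<longleftrightarrow>
     M $ G1 $ G1 = N $ G1 $ G1 \<and> M $ G1 $ G2 = N $ G1 $ G2 \<and> (\<forall>l. M $ G1 $ GV l = N $ G1 $ GV l) \<and>
     M $ G2 $ G1 = N $ G2 $ G1 \<and> M $ G2 $ G2 = N $ G2 $ G2 \<and> (\<forall>l. M $ G2 $ GV l = N $ G2 $ GV l) \<and>
     (\<forall>k. M $ GV k $ G1 = N $ GV k $ G1) \<and> (\<forall>k. M $ GV k $ G2 = N $ GV k $ G2) \<and>
     (\<forall>k l. M $ GV k $ GV l = N $ GV k $ GV l)"
  unfolding vec_eq_iff all_gidx by auto

lemma lblock_inject:
  "lblock x11 r12 x13 c21 m22 c23 x31 r32 x33 = lblock y11 s12 y13 d21 n22 d23 y31 s32 y33 \<longleftrightarrow>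
     x11 = y11 \<and> r12 = s12 \<and> x13 = y13 \<and> c21 = d21 \<and> m22 = n22 \<and> c23 = d23 \<and>
     x31 = y31 \<and> r32 = s32 \<and> x33 = y33"
  by (auto simp: lmatrix_eq_iff vec_eq_iff)

lemma outer_one_nth [simp]: "outer (mat 1) U X $ k $ l = U $ k * X $ l"
  by (simp add: outer_def)

lemma lblock_mult:
  "lblock x11 r12 x13 c21 m22 c23 x31 r32 x33 ** lblock y11 s12 y13 d21 n22 d23 y31 s32 y33 =
   lblock (x11 * y11 + r12 \<bullet> d21 + x13 * y31)
          (x11 *\<^sub>R s12 + r12 v* n22 + x13 *\<^sub>R s32)
          (x11 * y13 + r12 \<bullet> d23 + x13 * y33)
          (y11 *\<^sub>R c21 + m22 *v d21 + y31 *\<^sub>R c23)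
          (outer (mat 1) c21 s12 + m22 ** n22 + outer (mat 1) c23 s32)
          (y13 *\<^sub>R c21 + m22 *v d23 + y33 *\<^sub>R c23)
          (x31 * y11 + r32 \<bullet> d21 + x33 * y31)
          (x31 *\<^sub>R s12 + r32 v* n22 + x33 *\<^sub>R s32)
          (x31 * y13 + r32 \<bullet> d23 + x33 * y33)"
  by (simp add: lmatrix_eq_iff matrix_matrix_mult_def sum_lidx inner_vec_def
      matrix_vector_mult_def vector_matrix_mult_def mult.commute)

lemma gblock_mult:
  "gblock x11 x12 r13 x21 x22 r23 c31 c32 m33 ** gblock y11 y12 s13 y21 y22 s23 d31 d32 n33 =
   gblock (x11 * y11 + x12 * y21 + r13 \<bullet> d31)
          (x11 * y12 + x12 * y22 + r13 \<bullet> d32)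
          (x11 *\<^sub>R s13 + x12 *\<^sub>R s23 + r13 v* n33)
          (x21 * y11 + x22 * y21 + r23 \<bullet> d31)
          (x21 * y12 + x22 * y22 + r23 \<bullet> d32)
          (x21 *\<^sub>R s13 + x22 *\<^sub>R s23 + r23 v* n33)
          (y11 *\<^sub>R c31 + y21 *\<^sub>R c32 + m33 *v d31)
          (y12 *\<^sub>R c31 + y22 *\<^sub>R c32 + m33 *v d32)
          (outer (mat 1) c31 s13 + outer (mat 1) c32 s23 + m33 ** n33)"
  by (simp add: gmatrix_eq_iff matrix_matrix_mult_def sum_gidx inner_vec_def
      matrix_vector_mult_def vector_matrix_mult_def mult.commute)

lemma lblock_diff:
  "lblock x11 r12 x13 c21 m22 c23 x31 r32 x33 - lblock y11 s12 y13 d21 n22 d23 y31 s32 y33 =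
   lblock (x11 - y11) (r12 - s12) (x13 - y13) (c21 - d21) (m22 - n22) (c23 - d23)
     (x31 - y31) (r32 - s32) (x33 - y33)"
  by (simp add: lmatrix_eq_iff)

lemma gblock_diff:
  "gblock x11 x12 r13 x21 x22 r23 c31 c32 m33 - gblock y11 y12 s13 y21 y22 s23 d31 d32 n33 =
   gblock (x11 - y11) (x12 - y12) (r13 - s13) (x21 - y21) (x22 - y22) (r23 - s23)
     (c31 - d31) (c32 - d32) (m33 - n33)"
  by (simp add: gmatrix_eq_iff)

lemma trace_lblock:
  "trace (lblock x11 r12 x13 c21 m22 c23 x31 r32 x33) = x11 + trace m22 + x33"
  by (simp add: trace_def sum_lidx)

lemma lblock_one: "lblock 1 0 0 0 (mat 1) 0 0 0 1 = mat 1"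
  by (simp add: lmatrix_eq_iff mat_def)

lemma gblock_one: "gblock 1 0 0 0 1 0 0 0 (mat 1) = mat 1"
  by (simp add: gmatrix_eq_iff mat_def)

lemma outer_zero [simp]: "outer J 0 v = 0" "outer J u 0 = 0"
  by (simp_all add: outer_def vec_eq_iff vector_matrix_mult_def)

lemma matrix_inv_eqI:
  fixes A B :: "real ^ 'm ^ ('m::finite)"
  assumes "A ** B = mat 1"
  shows "matrix_inv A = B" "invertible A"
proof -
  have BA: "B ** A = mat 1" using assms by (simp add: matrix_left_right_inverse)
  show "invertible A" using assms BA unfolding invertible_def by blast
  have "matrix_inv A ** A = mat 1"
    unfolding matrix_inv_def by (rule someI2[of _ B]) (simp_all add: assms BA)
  then have "matrix_inv A ** (A ** B) = B" by (simp add: matrix_mul_assoc)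
  then show "matrix_inv A = B" by (simp add: assms)
qed

lemma alg_p_iff:
  "M \<in> alg_p \<longleftrightarrow> M \<in> alg_l \<and> (\<forall>k. M $ LV k $ L1 = 0) \<and> M $ L2 $ L1 = 0 \<and> (\<forall>l. M $ L2 $ LV l = 0)"
  unfolding alg_p_def filtr_def by (auto simp: all_lidx)

lemma matrix_mult_minus:
  fixes M :: "'a::comm_ring_1 ^ 'm ^ 'l" and N :: "'a ^ 'n ^ 'm"
  shows "M ** (- N) = - (M ** N)" "(- M) ** N = - (M ** N)"
  by (simp_all add: matrix_matrix_mult_def vec_eq_iff sum_negf)

lemma matrix_mult_add_left:
  fixes M N :: "'a::comm_semiring_1 ^ 'm ^ 'l" and R :: "'a ^ 'n ^ 'm"
  shows "(M + N) ** R = M ** R + N ** R"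
  by (simp add: matrix_matrix_mult_def vec_eq_iff distrib_right sum.distrib)

lemma vector_matrix_mult_minus: "(- V) v* N = - (V v* N)" for N :: "real ^ 'n ^ 'm"
  using scaleR_vector_matrix_assoc[of "-1" V N] by simp

lemma bracket_lblock:
  "bracket (lblock x11 r12 x13 c21 m22 c23 x31 r32 x33) (lblock y11 s12 y13 d21 n22 d23 y31 s32 y33) =
   lblock (r12 \<bullet> d21 + x13 * y31 - (s12 \<bullet> c21 + y13 * x31))
          (x11 *\<^sub>R s12 + r12 v* n22 + x13 *\<^sub>R s32 - (y11 *\<^sub>R r12 + s12 v* m22 + y13 *\<^sub>R r32))
          (x11 * y13 + r12 \<bullet> d23 + x13 * y33 - (y11 * x13 + s12 \<bullet> c23 + y13 * x33))
          (y11 *\<^sub>R c21 + m22 *v d21 + y31 *\<^sub>R c23 - (x11 *\<^sub>R d21 + n22 *v c21 + x31 *\<^sub>R d23))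
          (outer (mat 1) c21 s12 + m22 ** n22 + outer (mat 1) c23 s32
            - (outer (mat 1) d21 r12 + n22 ** m22 + outer (mat 1) d23 r32))
          (y13 *\<^sub>R c21 + m22 *v d23 + y33 *\<^sub>R c23 - (x13 *\<^sub>R d21 + n22 *v c23 + x33 *\<^sub>R d23))
          (x31 * y11 + r32 \<bullet> d21 + x33 * y31 - (y31 * x11 + s32 \<bullet> c21 + y33 * x31))
          (x31 *\<^sub>R s12 + r32 v* n22 + x33 *\<^sub>R s32 - (y31 *\<^sub>R r12 + s32 v* m22 + y33 *\<^sub>R r32))
          (r32 \<bullet> d23 + x31 * y13 - (s32 \<bullet> c23 + y31 * x13))"
  unfolding bracket_def lblock_mult lblock_diff by (simp add: lblock_inject)

section \<open>The diagonal form\<close>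

text \<open>
  Making the dimension \<open>n\<close> a real parameter of the locale keeps the scalar equations below free of type
  variables. The row \<open>X\<^sup>T I\<close> is \<open>X v* I\<close>.
\<close>

locale signature_form =
  fixes c n :: real and I :: "real ^ 'n ^ ('n::finite)"
  assumes n_def: "n = real CARD('n)" and c_sign: "c = 1 \<or> c = - 1"
    and I_offdiag: "i \<noteq> j \<Longrightarrow> I $ i $ j = 0"
    and I_diag: "I $ i $ i = 1 \<or> I $ i $ i = - 1"
begin

lemma c_sq: "c * c = 1" "c * (c * r) = r" "c\<^sup>2 = 1" "c \<noteq> 0"
  using c_sign by auto

lemma I_sq: "I $ i $ i * I $ i $ i = 1" "I $ i $ i * (I $ i $ i * r) = r"
  using I_diag[of i] by auto

lemma row_nth [simp]: "(X v* I) $ l = I $ l $ l * X $ l"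
proof -
  have "(\<Sum>i\<in>UNIV. X $ i * I $ i $ l) = (\<Sum>i\<in>UNIV. if i = l then I $ l $ l * X $ l else 0)"
    by (rule sum.cong) (auto simp: I_offdiag)
  then show ?thesis
    by (simp add: vector_matrix_mult_def mult.commute)
qed

lemma I_vec_nth [simp]: "(I *v X) $ l = I $ l $ l * X $ l"
proof -
  have "(\<Sum>i\<in>UNIV. I $ l $ i * X $ i) = (\<Sum>i\<in>UNIV. if i = l then I $ l $ l * X $ l else 0)"
    by (rule sum.cong) (auto simp: I_offdiag)
  then show ?thesis
    by (simp add: matrix_vector_mult_def)
qed

lemma I_I: "I ** I = mat 1"
proof -
  have "(\<Sum>k\<in>UNIV. I $ i $ k * I $ k $ j) = (if i = j then 1 else 0)" for i j
  proof -
    have "(\<Sum>k\<in>UNIV. I $ i $ k * I $ k $ j) = (\<Sum>k\<in>UNIV. if k = i then I $ i $ i * I $ i $ j else 0)"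
      by (rule sum.cong) (auto simp: I_offdiag)
    also have "\<dots> = (if i = j then 1 else 0)"
      by (simp add: I_sq I_offdiag)
    finally show ?thesis .
  qed
  then show ?thesis
    by (simp add: matrix_matrix_mult_def mat_def vec_eq_iff)
qed

lemma transpose_I: "transpose I = I"
  using I_offdiag unfolding transpose_def vec_eq_iff by (metis vec_lambda_beta)

lemma outer_nth [simp]: "outer I U X $ k $ l = U $ k * (I $ l $ l * X $ l)"
  by (simp add: outer_def)

end

section \<open>The curvature of a map given by blocks\<close>

text \<open>
  \<open>k\<^sub>i\<^sub>j\<close> is the coefficient of \<open>a\<close> in the block \<open>(i, j)\<close> of \<open>\<alpha>\<close>; \<open>k\<^sub>i\<^sub>j\<^sub>X\<close> and \<open>k\<^sub>i\<^sub>j\<^sub>Y\<close> are the coefficients of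
  \<open>X\<close> and \<open>Y\<close>. Thus \<open>k21X, k21Y, k32X, k32Y\<close> are the parameters \<open>b\<^sub>1, b\<^sub>2, b\<^sub>3, b\<^sub>4\<close>.
\<close>

record coeffs =
  k11 :: real  k12X :: real  k12Y :: real  k13 :: real
  k21X :: real  k21Y :: real  k22 :: real  k23X :: real  k23Y :: real
  k31 :: real  k32X :: real  k32Y :: real  k33 :: real

text \<open>
  The coefficients of a \<open>K\<close>-equivariant 2-form on \<open>\<gg>/\<kk>\<close>. The invariant scalar 2-form is
  \<open>Y\<^sup>T I Z - X\<^sup>T I U\<close>, the invariant vector-valued ones are \<open>P = b X - a Z\<close> and \<open>Q = b Y - a U\<close>, and the
  middle block is a combination of antisymmetrized products of two of the four vectors and of a
  multiple of the unit matrix.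
\<close>

record form_coeffs =
  f11 :: real  f12P :: real  f12Q :: real  f13 :: real
  f21P :: real  f21Q :: real
  fXZ :: real  fXU :: real  fYZ :: real  fYU :: real  f22 :: real
  f23P :: real  f23Q :: real
  f31 :: real  f32P :: real  f32Q :: real  f33 :: real

definition kdet :: "coeffs \<Rightarrow> real" where
  "kdet k = k21X k * k32Y k - k21Y k * k32X k"

context signature_form
begin

lemma ip_commute: "(X v* I) \<bullet> Y = (Y v* I) \<bullet> X"
  by (simp add: inner_vec_def ac_simps)

text \<open>
  An element of \<open>so(p, q)\<close> is skew for the form \<open>I\<close>, so it acts on rows \<open>X\<^sup>T I\<close> by minus its action on
  columns \<open>X\<close>. All terms of the curvature with \<open>A\<close> cancel because of this sign.
\<close>

lemma so_alg_row:
  assumes "B \<in> so_alg I"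
  shows "(X v* I) v* B = - ((B *v X) v* I)"
proof -
  have "I ** B = - (transpose B ** I)"
    using assms by (simp add: so_alg_def eq_neg_iff_add_eq_0 add.commute)
  then have "(X v* I) v* B = X v* (- (transpose B ** I))"
    by (simp add: vector_matrix_mul_assoc)
  also have "\<dots> = - (X v* (transpose B ** I))"
    using vector_scaleR_matrix_ac[of X "-1"] by simp
  finally show ?thesis
    by (simp flip: vector_matrix_mul_assoc)
qed

lemma so_alg_nth: "A \<in> so_alg I \<longleftrightarrow> (\<forall>i j. A $ j $ i * I $ j $ j + I $ i $ i * A $ i $ j = 0)"
proof -
  have "(transpose A ** I) $ i $ j = A $ j $ i * I $ j $ j" for i j
  proof -
    have "(transpose A ** I) $ i $ j = (\<Sum>k\<in>UNIV. if k = j then A $ j $ i * I $ j $ j else 0)"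
      unfolding matrix_matrix_mult_def transpose_def vec_lambda_beta
      by (rule sum.cong) (auto simp: I_offdiag)
    then show ?thesis by simp
  qed
  moreover have "(I ** A) $ i $ j = I $ i $ i * A $ i $ j" for i j
  proof -
    have "(I ** A) $ i $ j = (\<Sum>k\<in>UNIV. if k = i then I $ i $ i * A $ i $ j else 0)"
      unfolding matrix_matrix_mult_def vec_lambda_beta
      by (rule sum.cong) (auto simp: I_offdiag)
    then show ?thesis by simp
  qed
  ultimately show ?thesis
    by (simp add: so_alg_def vec_eq_iff)
qed

lemma so_alg_zero: "0 \<in> so_alg I"
  by (simp add: so_alg_nth)

lemma so_alg_add: "A \<in> so_alg I \<Longrightarrow> B \<in> so_alg I \<Longrightarrow> A + B \<in> so_alg I"
proof -
  assume "A \<in> so_alg I" "B \<in> so_alg I"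
  moreover have "(A + B) $ j $ i * I $ j $ j + I $ i $ i * (A + B) $ i $ j =
    (A $ j $ i * I $ j $ j + I $ i $ i * A $ i $ j) + (B $ j $ i * I $ j $ j + I $ i $ i * B $ i $ j)" for i j
    by (simp add: algebra_simps)
  ultimately show ?thesis
    by (simp add: so_alg_nth)
qed

lemma so_alg_scaleR: "A \<in> so_alg I \<Longrightarrow> r *\<^sub>R A \<in> so_alg I"
  by (simp add: so_alg_nth) (metis mult.assoc mult.left_commute distrib_left mult_zero_right)

lemma so_alg_outer: "outer I X Z - outer I Z X \<in> so_alg I"
  using I_sq by (auto simp: so_alg_nth algebra_simps)

lemma so_alg_bracket:
  assumes A: "A \<in> so_alg I" and B: "B \<in> so_alg I"
  shows "A ** B - B ** A \<in> so_alg I"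
proof -
  have tA: "transpose A ** I = - (I ** A)" and tB: "transpose B ** I = - (I ** B)"
    using A B by (simp_all add: so_alg_def eq_neg_iff_add_eq_0)
  have minus: "(M - N) ** I = M ** I - N ** I" "I ** (M - N) = I ** M - I ** N" for M N :: "real ^ 'n ^ 'n"
    by (simp_all add: matrix_matrix_mult_def vec_eq_iff left_diff_distrib right_diff_distrib sum_subtractf)
  have tminus: "transpose (M - N) = transpose M - transpose N" for M N :: "real ^ 'n ^ 'n"
    by (simp add: transpose_def vec_eq_iff)
  have "transpose (A ** B) ** I = I ** (B ** A)" "transpose (B ** A) ** I = I ** (A ** B)"
    by (simp_all add: matrix_transpose_mul matrix_mult_minus tA tB flip: matrix_mul_assoc)
       (simp_all add: matrix_mul_assoc tA tB matrix_mult_minus)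
  then show ?thesis
    by (simp add: so_alg_def minus tminus)
qed

lemma bracket_gmat:
  assumes A: "A \<in> so_alg I" and B: "B \<in> so_alg I"
  shows "bracket (gmat c I a X Y A) (gmat c I b Z U B) =
    gmat c I ((Y v* I) \<bullet> Z - (X v* I) \<bullet> U)
      (A *v Z - B *v X + c *\<^sub>R (a *\<^sub>R U - b *\<^sub>R Y))
      (A *v U - B *v Y + (b *\<^sub>R X - a *\<^sub>R Z))
      (A ** B - B ** A - (outer I X Z - outer I Z X) - c *\<^sub>R (outer I Y U - outer I U Y))"
    (is "?L = gmat c I ?a ?X ?Y ?A")
  and "A ** B - B ** A - (outer I X Z - outer I Z X) - c *\<^sub>R (outer I Y U - outer I U Y) \<in> so_alg I"
proof -
  have mv: "(- V) v* N = - (V v* N)" "(r *\<^sub>R V) v* N = r *\<^sub>R (V v* N)" for V r and N :: "real ^ 'n ^ 'n"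
    using scaleR_vector_matrix_assoc[of "-1" V N] by (simp_all add: scaleR_vector_matrix_assoc)
  have row_lin: "(V + W) v* I = V v* I + W v* I" "(V - W) v* I = V v* I - W v* I" for V W
    by (simp_all add: vec_eq_iff algebra_simps)
  show "?L = gmat c I ?a ?X ?Y ?A"
    unfolding bracket_def gmat_def gblock_mult gblock_diff
    apply (simp add: mv so_alg_row[OF A] so_alg_row[OF B] row_lin ip_commute[of X] ip_commute[of Y])
    apply (simp add: gmatrix_eq_iff ip_commute[of Z] ip_commute[of U] c_sq algebra_simps)
    done
  show "?A \<in> so_alg I"
    using so_alg_bracket[OF A B] so_alg_outer[of X Z] so_alg_outer[of Y U]
      so_alg_add so_alg_scaleR[of _ "-1"] so_alg_scaleR[of _ "- c"]
    by (metis (no_types, lifting) scaleR_minus_left scaleR_one uminus_add_conv_diff add.commute)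
qed

definition coeff_block :: "coeffs \<Rightarrow> real \<Rightarrow> real ^ 'n \<Rightarrow> real ^ 'n \<Rightarrow> real ^ 'n ^ 'n \<Rightarrow> 'n lmatrix" where
  "coeff_block k a X Y A = lblock
     (k11 k * a) (k12X k *\<^sub>R (X v* I) + k12Y k *\<^sub>R (Y v* I)) (k13 k * a)
     (k21X k *\<^sub>R X + k21Y k *\<^sub>R Y) (A + (k22 k * a) *\<^sub>R mat 1) (k23X k *\<^sub>R X + k23Y k *\<^sub>R Y)
     (k31 k * a) (k32X k *\<^sub>R (X v* I) + k32Y k *\<^sub>R (Y v* I)) (k33 k * a)"

definition has_coeffs :: "('n gmatrix \<Rightarrow> 'n lmatrix) \<Rightarrow> coeffs \<Rightarrow> bool" where
  "has_coeffs \<alpha> k \<longleftrightarrow> (\<forall>a X Y. \<forall>A\<in>so_alg I. \<alpha> (gmat c I a X Y A) = coeff_block k a X Y A)"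

definition form_block ::
  "form_coeffs \<Rightarrow> real \<Rightarrow> real ^ 'n \<Rightarrow> real ^ 'n \<Rightarrow> real \<Rightarrow> real ^ 'n \<Rightarrow> real ^ 'n \<Rightarrow> 'n lmatrix" where
  "form_block h a X Y b Z U =
    (let s = (Y v* I) \<bullet> Z - (X v* I) \<bullet> U; P = b *\<^sub>R X - a *\<^sub>R Z; Q = b *\<^sub>R Y - a *\<^sub>R U
     in lblock
       (f11 h * s) (f12P h *\<^sub>R (P v* I) + f12Q h *\<^sub>R (Q v* I)) (f13 h * s)
       (f21P h *\<^sub>R P + f21Q h *\<^sub>R Q)
       (fXZ h *\<^sub>R (outer I X Z - outer I Z X) + fXU h *\<^sub>R (outer I X U - outer I Z Y)
         + fYZ h *\<^sub>R (outer I Y Z - outer I U X) + fYU h *\<^sub>R (outer I Y U - outer I U Y)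
         - (f22 h * s) *\<^sub>R mat 1)
       (f23P h *\<^sub>R P + f23Q h *\<^sub>R Q)
       (f31 h * s) (f32P h *\<^sub>R (P v* I) + f32Q h *\<^sub>R (Q v* I)) (f33 h * s))"

definition curv_coeffs :: "coeffs \<Rightarrow> form_coeffs" where
  "curv_coeffs k = \<lparr>
     f11 = k21X k * k12Y k - k21Y k * k12X k - k11 k,
     f12P = - ((k11 k - k22 k) * k12X k) - k13 k * k32X k - k12Y k,
     f12Q = - ((k11 k - k22 k) * k12Y k) - k13 k * k32Y k + c * k12X k,
     f13 = k12Y k * k23X k - k12X k * k23Y k - k13 k,
     f21P = (k11 k - k22 k) * k21X k + k31 k * k23X k - k21Y k,
     f21Q = (k11 k - k22 k) * k21Y k + k31 k * k23Y k + c * k21X k,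
     fXZ = k21X k * k12X k + k23X k * k32X k + 1,
     fXU = k21X k * k12Y k + k23X k * k32Y k,
     fYZ = k21Y k * k12X k + k23Y k * k32X k,
     fYU = k21Y k * k12Y k + k23Y k * k32Y k + c,
     f22 = k22 k,
     f23P = k13 k * k21X k + (k33 k - k22 k) * k23X k - k23Y k,
     f23Q = k13 k * k21Y k + (k33 k - k22 k) * k23Y k + c * k23X k,
     f31 = kdet k - k31 k,
     f32P = - (k31 k * k12X k) - (k33 k - k22 k) * k32X k - k32Y k,
     f32Q = - (k31 k * k12Y k) - (k33 k - k22 k) * k32Y k + c * k32X k,
     f33 = k32Y k * k23X k - k32X k * k23Y k - k33 k\<rparr>"

lemma row_times:
  assumes "B \<in> so_alg I"
  shows "((r *\<^sub>R (X v* I) + r' *\<^sub>R (Y v* I)) v* (B + e *\<^sub>R mat 1)) $ l =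
     I $ l $ l * (e * r * X $ l + e * r' * Y $ l - r * (B *v X) $ l - r' * (B *v Y) $ l)"
  by (simp add: vector_matrix_left_distrib vector_matrix_mult_add_rdistrib vector_scaleR_matrix_ac
      scaleR_vector_matrix_assoc so_alg_row[OF assms] algebra_simps)

lemma times_col:
  "((B + e *\<^sub>R mat 1) *v (r *\<^sub>R X + r' *\<^sub>R Y)) $ l =
     e * r * X $ l + e * r' * Y $ l + r * (B *v X) $ l + r' * (B *v Y) $ l"
  by (simp add: algebra_simps flip: scaleR_matrix_vector_assoc)

text \<open>
  The scalar matrices in the middle block of \<open>\<alpha>\<close> are central, so only the commutator of the
  \<open>so(p, q)\<close>-parts survives in the bracket.
\<close>

lemma commutator_shift:
  "(A + d *\<^sub>R mat 1) ** (B + e *\<^sub>R mat 1) - (B + e *\<^sub>R mat 1) ** (A + d *\<^sub>R mat 1) = A ** B - B ** (A :: real ^ 'n ^ 'n)"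
  by (simp add: matrix_mult_add_left matrix_add_ldistrib matrix_scalar_ac scaleR_add_right mult.commute
      flip: scalar_matrix_assoc)

text \<open>
  Terms with \<open>A\<close> or \<open>B\<close> cancel, since \<open>\<alpha>\<close> is a block-wise equivariant map extending the inclusion of
  \<open>\<kk>\<close>; this is the infinitesimal form of equivariance, and it makes the curvature a form on \<open>\<gg>/\<kk>\<close>.
\<close>

lemma curvature_coeffs:
  assumes \<alpha>: "has_coeffs \<alpha> k" and A: "A \<in> so_alg I" and B: "B \<in> so_alg I"
  shows "curvature \<alpha> (gmat c I a X Y A) (gmat c I b Z U B) = form_block (curv_coeffs k) a X Y b Z U"
proof -
  define s where "s = (Y v* I) \<bullet> Z - (X v* I) \<bullet> U"
  have br: "\<alpha> (bracket (gmat c I a X Y A) (gmat c I b Z U B)) =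
    coeff_block k s
      (A *v Z - B *v X + c *\<^sub>R (a *\<^sub>R U - b *\<^sub>R Y))
      (A *v U - B *v Y + (b *\<^sub>R X - a *\<^sub>R Z))
      (A ** B - B ** A - (outer I X Z - outer I Z X) - c *\<^sub>R (outer I Y U - outer I U Y))"
    unfolding bracket_gmat(1)[OF A B] s_def
    using \<alpha> bracket_gmat(2)[OF A B, of X Z Y U] unfolding has_coeffs_def by blast
  have args: "\<alpha> (gmat c I a X Y A) = coeff_block k a X Y A" "\<alpha> (gmat c I b Z U B) = coeff_block k b Z U B"
    using \<alpha> A B by (auto simp: has_coeffs_def)
  note ip = inner_add_left inner_add_right ip_commute[of Z X] ip_commute[of Z Y] ip_commute[of U X] ip_commute[of U Y]
  have comm: "(A ** B) $ i $ j - (B ** A) $ i $ j =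
     ((A + (k22 k * a) *\<^sub>R mat 1) ** (B + (k22 k * b) *\<^sub>R mat 1)) $ i $ j
     - ((B + (k22 k * b) *\<^sub>R mat 1) ** (A + (k22 k * a) *\<^sub>R mat 1)) $ i $ j" for i j
    using commutator_shift[of A "k22 k * a" B "k22 k * b"] by (metis vector_minus_component)
  show ?thesis
    unfolding curvature_def args br coeff_block_def bracket_lblock lblock_diff form_block_def Let_def curv_coeffs_def form_coeffs.simps lblock_inject
    apply (intro conjI)
    subgoal by (simp add: ip s_def algebra_simps)
    subgoal by (simp add: vec_eq_iff row_times[OF A] row_times[OF B]) (simp add: algebra_simps c_sq)
    subgoal by (simp add: ip s_def algebra_simps)
    subgoal by (simp add: vec_eq_iff times_col) (simp add: algebra_simps c_sq)
    subgoal
      unfolding vec_eq_iff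
      apply (intro allI)
      subgoal for i j
        using comm[of i j] by (simp add: algebra_simps s_def c_sq)
      done
    subgoal by (simp add: vec_eq_iff times_col) (simp add: algebra_simps c_sq)
    subgoal by (simp add: ip s_def kdet_def algebra_simps)
    subgoal by (simp add: vec_eq_iff row_times[OF A] row_times[OF B]) (simp add: algebra_simps c_sq)
    subgoal by (simp add: ip s_def algebra_simps)
    done
qed

end

section \<open>Equivariant maps are given by blocks\<close>

lemma lblock_blocks:
  "(M :: ('n::finite) lmatrix) = lblock (M $ L1 $ L1) (\<chi> l. M $ L1 $ LV l) (M $ L1 $ L2)
     (\<chi> k. M $ LV k $ L1) (\<chi> k l. M $ LV k $ LV l) (\<chi> k. M $ LV k $ L2)
     (M $ L2 $ L1) (\<chi> l. M $ L2 $ LV l) (M $ L2 $ L2)"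
  by (simp add: lmatrix_eq_iff)

context signature_form
begin

abbreviation K_elem :: "real ^ 'n ^ 'n \<Rightarrow> 'n gmatrix" where
  "K_elem T \<equiv> gblock 1 0 0 0 1 0 0 0 T"

definition isometries :: "(real ^ 'n ^ 'n) set" where
  "isometries = {T. transpose T ** I ** T = I}"

text \<open>
  For an isometry of the form \<open>I\<close> this is the inverse.
\<close>

definition metric_adjoint :: "real ^ 'n ^ 'n \<Rightarrow> real ^ 'n ^ 'n" where
  "metric_adjoint T = I ** transpose T ** I"

lemma grpK_iff: "g \<in> grpK I \<longleftrightarrow> (\<exists>T\<in>isometries. g = K_elem T)"
  by (auto simp: grpK_def isometries_def)

lemma metric_adjoint_inverse:
  assumes "T \<in> isometries" shows "metric_adjoint T ** T = mat 1" "T ** metric_adjoint T = mat 1"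
proof -
  have "metric_adjoint T ** T = I ** (transpose T ** I ** T)"
    by (simp add: metric_adjoint_def matrix_mul_assoc)
  also have "\<dots> = mat 1"
    using assms by (simp add: isometries_def I_I)
  finally show "metric_adjoint T ** T = mat 1" .
  then show "T ** metric_adjoint T = mat 1"
    by (simp add: matrix_left_right_inverse)
qed

lemma hom_i_K_elem: "hom_i (K_elem T) = lblock 1 0 0 0 T 0 0 0 1"
  by (simp add: hom_i_def vec_lambda_eta)

lemma K_elem_inverse:
  assumes "T \<in> isometries"
  shows "matrix_inv (K_elem T) = K_elem (metric_adjoint T)" "invertible (K_elem T)"
    "matrix_inv (hom_i (K_elem T)) = lblock 1 0 0 0 (metric_adjoint T) 0 0 0 1" "invertible (hom_i (K_elem T))"
proof -
  have "K_elem T ** K_elem (metric_adjoint T) = mat 1"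
    by (simp add: gblock_mult metric_adjoint_inverse[OF assms] gblock_one)
  then show "matrix_inv (K_elem T) = K_elem (metric_adjoint T)" "invertible (K_elem T)"
    by (rule matrix_inv_eqI)+
  have "hom_i (K_elem T) ** lblock 1 0 0 0 (metric_adjoint T) 0 0 0 1 = mat 1"
    by (simp add: hom_i_K_elem lblock_mult metric_adjoint_inverse[OF assms] lblock_one)
  then show "matrix_inv (hom_i (K_elem T)) = lblock 1 0 0 0 (metric_adjoint T) 0 0 0 1" "invertible (hom_i (K_elem T))"
    by (rule matrix_inv_eqI)+
qed

lemma Ad_hom_i:
  assumes "T \<in> isometries"
  shows "Ad (hom_i (K_elem T)) (lblock x11 r12 x13 c21 m22 c23 x31 r32 x33) =
    lblock x11 (r12 v* metric_adjoint T) x13 (T *v c21) (T ** m22 ** metric_adjoint T) (T *v c23) x31 (r32 v* metric_adjoint T) x33"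
  unfolding Ad_def K_elem_inverse[OF assms] unfolding hom_i_K_elem by (simp add: lblock_mult)

text \<open>
  The form \<open>I\<close> identifies rows with columns equivariantly. Equivariance of row blocks therefore reduces
  to that of column blocks.
\<close>

lemma row_metric_adjoint:
  assumes "T \<in> isometries"
  shows "(X v* I) v* metric_adjoint T = (T *v X) v* I"
proof -
  have "(X v* I) v* metric_adjoint T = X v* (I ** metric_adjoint T)"
    by (simp add: vector_matrix_mul_assoc)
  also have "I ** metric_adjoint T = transpose T ** I"
    by (simp add: metric_adjoint_def matrix_mul_assoc I_I)
  finally show ?thesis
    by (simp flip: vector_matrix_mul_assoc)
qed

lemma Ad_gmat:
  assumes "T \<in> isometries"
  shows "Ad (K_elem T) (gmat c I a X Y A) = gmat c I a (T *v X) (T *v Y) (T ** A ** metric_adjoint T)"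
proof -
  show ?thesis
    unfolding Ad_def K_elem_inverse[OF assms] gmat_def
    by (simp add: gblock_mult vector_matrix_mult_minus scaleR_vector_matrix_assoc row_metric_adjoint[OF assms])
qed

lemma minus_one_isometry: "- mat 1 \<in> isometries" "metric_adjoint (- mat 1) = - mat 1"
proof -
  have t: "transpose (- mat 1 :: real ^ 'n ^ 'n) = - mat 1"
    by (auto simp: transpose_def mat_def vec_eq_iff)
  show "- mat 1 \<in> isometries" "metric_adjoint (- mat 1) = - mat 1"
    by (simp_all add: isometries_def metric_adjoint_def t matrix_mult_minus I_I)
qed

text \<open>
  The reflection along a vector that is not isotropic. Reflections exist uniformly in all signatures,
  and they suffice for the rigidity of equivariant maps.
\<close>

definition reflection :: "real ^ 'n \<Rightarrow> real ^ 'n ^ 'n" where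
  "reflection v = mat 1 - (2 / ((v v* I) \<bullet> v)) *\<^sub>R outer I v v"

lemma reflection_times: "reflection v *v x = x - (2 * ((v v* I) \<bullet> x) / ((v v* I) \<bullet> v)) *\<^sub>R v"
proof -
  have "outer I v v *v x = ((v v* I) \<bullet> x) *\<^sub>R v"
    by (simp add: vec_eq_iff matrix_vector_mult_def inner_vec_def sum_distrib_left mult.assoc mult.commute mult.left_commute)
  then show ?thesis
    by (simp add: reflection_def matrix_vector_mult_diff_rdistrib flip: scaleR_matrix_vector_assoc)
qed

lemma isometriesI:
  assumes "\<And>x y. ((T *v x) v* I) \<bullet> (T *v y) = (x v* I) \<bullet> y"
  shows "T \<in> isometries"
proof -
  have "x \<bullet> ((transpose T ** I ** T) *v y) = x \<bullet> (I *v y)" for x y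
  proof -
    have "x \<bullet> ((transpose T ** I ** T) *v y) = (x v* (transpose T ** I ** T)) \<bullet> y"
      by (simp add: dot_lmul_matrix)
    also have "\<dots> = ((T *v x) v* I) \<bullet> (T *v y)"
      by (simp add: dot_lmul_matrix flip: vector_matrix_mul_assoc)
    also have "\<dots> = x \<bullet> (I *v y)"
      using assms[of x y] by (simp add: dot_lmul_matrix)
    finally show ?thesis .
  qed
  then show ?thesis
    unfolding isometries_def matrix_eq mem_Collect_eq by (metis vector_eq_ldot)
qed

lemma reflection_isometry:
  assumes "(v v* I) \<bullet> v \<noteq> 0"
  shows "reflection v \<in> isometries"
proof (rule isometriesI)
  fix x y
  define q where "q = (v v* I) \<bullet> v"
  have "(r *\<^sub>R v) v* I = r *\<^sub>R (v v* I)" for r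
    by (simp add: scaleR_vector_matrix_assoc)
  then show "((reflection v *v x) v* I) \<bullet> (reflection v *v y) = (x v* I) \<bullet> y"
    using assms
    by (simp add: reflection_times vector_matrix_mult_diff_distrib inner_diff_left inner_diff_right
        ip_commute[of x v] flip: q_def)
qed

text \<open>
  The reflection along \<open>v\<close> negates \<open>v\<close> and fixes only the orthogonal complement, so \<open>f v\<close>, which is
  negated as well, is a multiple of \<open>v\<close>. Two basis vectors have the same eigenvalue because the vector
  \<open>e\<^sub>k + 2 e\<^sub>l\<close> is an eigenvector too. The factor \<open>2\<close> makes it non-isotropic whatever the
  signs of \<open>e\<^sub>k\<close> and \<open>e\<^sub>l\<close> are.
\<close>

lemma commuting_scalar:
  fixes f :: "real ^ 'n \<Rightarrow> real ^ 'n"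
  assumes f: "linear f" and comm: "\<And>T x. T \<in> isometries \<Longrightarrow> f (T *v x) = T *v f x"
  shows "\<exists>\<beta>. \<forall>x. f x = \<beta> *\<^sub>R x"
proof -
  have eigen: "\<exists>\<mu>. f v = \<mu> *\<^sub>R v" if q: "(v v* I) \<bullet> v \<noteq> 0" for v
  proof -
    define m where "m = 2 * ((v v* I) \<bullet> f v) / ((v v* I) \<bullet> v)"
    have "reflection v *v v = - v"
      using q by (simp add: reflection_times vec_eq_iff)
    then have "reflection v *v f v = - f v"
      using comm[OF reflection_isometry[OF q], of v] by (metis linear_neg[OF f])
    then have "- (f v $ i) = f v $ i - m * v $ i" for i
      unfolding reflection_times vec_eq_iff by (simp add: m_def)
    then have "f v $ i = m / 2 * v $ i" for i
      by (simp add: field_simps add_eq_0_iff)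
    then have "f v = (m / 2) *\<^sub>R v"
      by (simp add: vec_eq_iff)
    then show ?thesis ..
  qed
  have ax: "(axis k 1 v* I) \<bullet> x = I $ k $ k * x $ k" for k x
  proof -
    have "(axis k 1 v* I) \<bullet> x = (\<Sum>i\<in>UNIV. if i = k then I $ k $ k * x $ k else 0)"
      unfolding inner_vec_def by (rule sum.cong) (auto simp: axis_def)
    then show ?thesis by simp
  qed
  have nz: "I $ k $ k \<noteq> 0" for k
    using I_diag[of k] by auto
  have "\<exists>\<mu>. f (axis k 1) = \<mu> *\<^sub>R axis k 1" for k
    by (rule eigen) (simp add: ax nz)
  then obtain \<mu> where \<mu>: "\<And>k. f (axis k 1) = \<mu> k *\<^sub>R axis k 1"
    by metis
  have "\<mu> k = \<mu> l" if "k \<noteq> l" for k l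
  proof -
    let ?v = "axis k 1 + 2 *\<^sub>R axis l 1 :: real ^ 'n"
    have "(?v v* I) \<bullet> ?v = I $ k $ k + 4 * I $ l $ l"
      using that
      by (simp add: vector_matrix_left_distrib scaleR_vector_matrix_assoc inner_add_left inner_add_right ax)
         (simp add: axis_def)
    also have "\<dots> \<noteq> 0"
      using I_diag[of k] I_diag[of l] by auto
    finally obtain \<nu> where "f ?v = \<nu> *\<^sub>R ?v"
      using eigen by blast
    then have "\<mu> k *\<^sub>R axis k 1 + (2 * \<mu> l) *\<^sub>R axis l 1 = \<nu> *\<^sub>R ?v"
      by (simp add: linear_add[OF f] linear_scale[OF f] \<mu>)
    then have "\<forall>i. (\<mu> k *\<^sub>R axis k 1 + (2 * \<mu> l) *\<^sub>R axis l 1) $ i = (\<nu> *\<^sub>R ?v) $ i"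
      by simp
    from this[rule_format, of k] this[rule_format, of l] that show ?thesis
      by (simp add: axis_def)
  qed
  then have "f (axis k 1) = \<mu> undefined *\<^sub>R axis k 1" for k
    using \<mu> by metis
  then have "f = (\<lambda>x. \<mu> undefined *\<^sub>R x)"
    by (intro linear_eq_stdbasis[OF f]) (auto simp: Basis_vec_def linear_iff algebra_simps)
  then show ?thesis
    by metis
qed

lemma gmat_add: "gmat c I a X Y A + gmat c I b Z U B = gmat c I (a + b) (X + Z) (Y + U) (A + B)"
  by (simp add: gmat_def gmatrix_eq_iff algebra_simps)

lemma gmat_scaleR: "r *\<^sub>R gmat c I a X Y A = gmat c I (r * a) (r *\<^sub>R X) (r *\<^sub>R Y) (r *\<^sub>R A)"
  by (simp add: gmat_def gmatrix_eq_iff algebra_simps)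

lemma gmat_in_algG: "A \<in> so_alg I \<Longrightarrow> gmat c I a X Y A \<in> algG c I"
  by (auto simp: algG_def)

lemma gmat_in_algK: "A \<in> so_alg I \<Longrightarrow> gmat c I a X Y A \<in> algK I \<longleftrightarrow> a = 0 \<and> X = 0 \<and> Y = 0"
  by (auto simp: algK_def gmat_def gmatrix_eq_iff vec_eq_iff)

lemma algK_eq: "algK I = {gmat c I 0 0 0 A | A. A \<in> so_alg I}"
  by (simp add: algK_def gmat_def)

lemma Ad_hom_i_blocks:
  assumes "T \<in> isometries"
  shows "Ad (hom_i (K_elem T)) M = lblock (M $ L1 $ L1) ((\<chi> l. M $ L1 $ LV l) v* metric_adjoint T) (M $ L1 $ L2)
       (T *v (\<chi> k. M $ LV k $ L1)) (T ** (\<chi> k l. M $ LV k $ LV l) ** metric_adjoint T) (T *v (\<chi> k. M $ LV k $ L2))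
       (M $ L2 $ L1) ((\<chi> l. M $ L2 $ LV l) v* metric_adjoint T) (M $ L2 $ L2)"
  by (subst lblock_blocks[of M]) (rule Ad_hom_i[OF assms])

text \<open>
  The four blocks of \<open>\<ll>\<close> on which \<open>O(p, q)\<close> acts by its standard representation or its dual.
\<close>

lemma equivariant_odd_blocks:
  fixes h :: "real ^ 'n \<Rightarrow> 'n lmatrix"
  assumes lin: "\<And>i j. linear (\<lambda>X. h X $ i $ j)"
    and equiv: "\<And>T X. T \<in> isometries \<Longrightarrow> h (T *v X) = Ad (hom_i (K_elem T)) (h X)"
  obtains \<rho> \<beta> \<gamma> \<sigma> where
    "\<And>X l. h X $ L1 $ LV l = \<rho> * (X v* I) $ l" "\<And>X k. h X $ LV k $ L1 = \<beta> * X $ k"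
    "\<And>X k. h X $ LV k $ L2 = \<gamma> * X $ k" "\<And>X l. h X $ L2 $ LV l = \<sigma> * (X v* I) $ l"
proof -
  have col: "\<exists>\<beta>. \<forall>X k. h X $ LV k $ j = \<beta> * X $ k"
    if eq: "\<And>T X. T \<in> isometries \<Longrightarrow> (\<chi> k. h (T *v X) $ LV k $ j) = T *v (\<chi> k. h X $ LV k $ j)" for j
  proof -
    have lin': "linear (\<lambda>X. \<chi> k. h X $ LV k $ j)"
      using lin[of "LV _" j] by (auto simp: linear_iff vec_eq_iff)
    obtain \<beta> where "\<forall>X. (\<chi> k. h X $ LV k $ j) = \<beta> *\<^sub>R X"
      using commuting_scalar[OF lin' eq] by blast
    then show ?thesis
      by (auto simp: vec_eq_iff)
  qed
  have row: "\<exists>\<beta>. \<forall>X l. h X $ i $ LV l = \<beta> * (X v* I) $ l"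
    if eq: "\<And>T X. T \<in> isometries \<Longrightarrow> (\<chi> l. h (T *v X) $ i $ LV l) = (\<chi> l. h X $ i $ LV l) v* metric_adjoint T" for i
  proof -
    have lin': "linear (\<lambda>X. I *v (\<chi> l. h X $ i $ LV l))"
      using lin[of i "LV _"] by (auto simp: linear_iff vec_eq_iff algebra_simps)
    have swap: "I *v (v v* metric_adjoint T) = T *v (I *v v)" if "T \<in> isometries" for T v
    proof -
      have "v = (I *v v) v* I" by (simp add: vec_eq_iff I_sq)
      then have "v v* metric_adjoint T = (T *v (I *v v)) v* I"
        using row_metric_adjoint[OF that, of "I *v v"] by metis
      then show ?thesis
        by (simp add: vec_eq_iff I_sq)
    qed
    have "I *v (\<chi> l. h (T *v X) $ i $ LV l) = T *v (I *v (\<chi> l. h X $ i $ LV l))" if "T \<in> isometries" for T X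
      by (simp only: eq[OF that] swap[OF that])
    from commuting_scalar[OF lin' this] obtain \<beta> where "\<forall>X. I *v (\<chi> l. h X $ i $ LV l) = \<beta> *\<^sub>R X"
      by blast
    then have *: "I $ l $ l * h X $ i $ LV l = \<beta> * X $ l" for X l
      by (simp add: vec_eq_iff)
    have "h X $ i $ LV l = \<beta> * (X v* I) $ l" for X l
    proof -
      have "h X $ i $ LV l = I $ l $ l * (I $ l $ l * h X $ i $ LV l)"
        by (simp add: I_sq)
      then show ?thesis
        unfolding * by simp
    qed
    then show ?thesis
      by blast
  qed
  have e: "h (T *v X) = lblock (h X $ L1 $ L1) ((\<chi> l. h X $ L1 $ LV l) v* metric_adjoint T) (h X $ L1 $ L2)
       (T *v (\<chi> k. h X $ LV k $ L1)) (T ** (\<chi> k l. h X $ LV k $ LV l) ** metric_adjoint T) (T *v (\<chi> k. h X $ LV k $ L2))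
       (h X $ L2 $ L1) ((\<chi> l. h X $ L2 $ LV l) v* metric_adjoint T) (h X $ L2 $ L2)" if "T \<in> isometries" for T X
    unfolding equiv[OF that] by (rule Ad_hom_i_blocks[OF that])
  have "\<exists>\<beta>. \<forall>X k. h X $ LV k $ L1 = \<beta> * X $ k" "\<exists>\<beta>. \<forall>X k. h X $ LV k $ L2 = \<beta> * X $ k"
    by (rule col; simp add: e vec_lambda_eta)+
  moreover have "\<exists>\<beta>. \<forall>X l. h X $ L1 $ LV l = \<beta> * (X v* I) $ l" "\<exists>\<beta>. \<forall>X l. h X $ L2 $ LV l = \<beta> * (X v* I) $ l"
    by (rule row; simp only: e lblock_nth vec_lambda_eta)+
  ultimately show thesis
    using that by blast
qed

text \<open>
  The odd blocks are scalars by \<open>equivariant_odd_blocks\<close>. The middle block of \<open>\<alpha>\<close> at \<open>a = 1\<close> commutes with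
  all isometries and is a scalar by the same principle, and on \<open>\<kk>\<close> the map is prescribed.
\<close>

lemma extension_has_coeffs:
  assumes ext: "extension c I \<alpha>"
  shows "\<exists>k. has_coeffs \<alpha> k"
proof -
  let ?g = "\<lambda>a X Y. gmat c I a X Y 0"
  have g[simp]: "?g a X Y \<in> algG c I" for a X Y
    by (simp add: gmat_in_algG so_alg_zero)
  have add: "\<alpha> (x + y) = \<alpha> x + \<alpha> y" if "x \<in> algG c I" "y \<in> algG c I" for x y
    using ext that by (auto simp: extension_def)
  have scale: "\<alpha> (r *\<^sub>R x) = r *\<^sub>R \<alpha> x" if "x \<in> algG c I" for r x
    using ext that by (auto simp: extension_def)
  have equiv: "\<alpha> (?g a (T *v X) (T *v Y)) = Ad (hom_i (K_elem T)) (\<alpha> (?g a X Y))" if "T \<in> isometries" for T a X Y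
  proof -
    have "K_elem T \<in> grpK I" using that by (auto simp: grpK_iff)
    then have "\<alpha> (Ad (K_elem T) (?g a X Y)) = Ad (hom_i (K_elem T)) (\<alpha> (?g a X Y))"
      using ext g unfolding extension_def by blast
    then show ?thesis
      by (simp add: Ad_gmat[OF that] matrix_mul_assoc)
  qed
  note equiv_entries = trans[OF equiv Ad_hom_i_blocks]
  have neg: "(- V) *v x = - (V *v x)" "x v* (- V) = - (x v* V)" for V :: "real ^ 'n ^ 'n" and x
    by (simp_all add: vec_eq_iff matrix_vector_mult_def vector_matrix_mult_def sum_negf)
  note minus = equiv_entries[OF minus_one_isometry(1) minus_one_isometry(1), unfolded minus_one_isometry(2)]
  \<comment> \<open>\<open>diag(1, 1, - E)\<close> fixes \<open>a\<close> and negates \<open>X\<close> and \<open>Y\<close>, so it separates the even from the odd blocks.\<close>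
  have even: "\<alpha> (?g a 0 0) = lblock (\<alpha> (?g a 0 0) $ L1 $ L1) 0 (\<alpha> (?g a 0 0) $ L1 $ L2)
      0 (\<chi> k l. \<alpha> (?g a 0 0) $ LV k $ LV l) 0 (\<alpha> (?g a 0 0) $ L2 $ L1) 0 (\<alpha> (?g a 0 0) $ L2 $ L2)" for a
    using minus[of a 0 0] by (simp add: lmatrix_eq_iff neg matrix_mult_minus)
  have odd: "\<alpha> (?g 0 X Y) = lblock 0 (\<chi> l. \<alpha> (?g 0 X Y) $ L1 $ LV l) 0
      (\<chi> k. \<alpha> (?g 0 X Y) $ LV k $ L1) 0 (\<chi> k. \<alpha> (?g 0 X Y) $ LV k $ L2)
      0 (\<chi> l. \<alpha> (?g 0 X Y) $ L2 $ LV l) 0" for X Y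
  proof -
    have "- 1 *\<^sub>R ?g 0 X Y = ?g 0 (- X) (- Y)"
      by (simp only: gmat_scaleR) simp
    then have "\<alpha> (?g 0 (- X) (- Y)) = - \<alpha> (?g 0 X Y)"
      using scale[OF g, of "-1" 0 X Y] by simp
    then show ?thesis
      using minus[of 0 X Y] by (simp add: lmatrix_eq_iff neg matrix_mult_minus)
  qed
  have lin: "linear (\<lambda>X. \<alpha> (?g 0 X 0) $ i $ j)" "linear (\<lambda>Y. \<alpha> (?g 0 0 Y) $ i $ j)" for i j
  proof -
    have "?g 0 (X + Y) 0 = ?g 0 X 0 + ?g 0 Y 0" "?g 0 0 (X + Y) = ?g 0 0 X + ?g 0 0 Y"
      "?g 0 (r *\<^sub>R X) 0 = r *\<^sub>R ?g 0 X 0" "?g 0 0 (r *\<^sub>R X) = r *\<^sub>R ?g 0 0 X" for X Y r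
      by (simp_all add: gmat_add gmat_scaleR)
    then show "linear (\<lambda>X. \<alpha> (?g 0 X 0) $ i $ j)" "linear (\<lambda>Y. \<alpha> (?g 0 0 Y) $ i $ j)"
      by (simp_all add: linear_iff add scale)
  qed
  have eX: "\<alpha> (?g 0 (T *v X) 0) = Ad (hom_i (K_elem T)) (\<alpha> (?g 0 X 0))"
    and eY: "\<alpha> (?g 0 0 (T *v X)) = Ad (hom_i (K_elem T)) (\<alpha> (?g 0 0 X))" if "T \<in> isometries" for T X
    using equiv[OF that, of 0 X 0] equiv[OF that, of 0 0 X] by simp_all
  obtain r1 b1 c1 b3 where X: "\<And>X l. \<alpha> (?g 0 X 0) $ L1 $ LV l = r1 * (X v* I) $ l"
    "\<And>X k. \<alpha> (?g 0 X 0) $ LV k $ L1 = b1 * X $ k"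
    "\<And>X k. \<alpha> (?g 0 X 0) $ LV k $ L2 = c1 * X $ k"
    "\<And>X l. \<alpha> (?g 0 X 0) $ L2 $ LV l = b3 * (X v* I) $ l"
  proof (rule equivariant_odd_blocks[where h="\<lambda>X. \<alpha> (?g 0 X 0)"])
    show "linear (\<lambda>X. \<alpha> (?g 0 X 0) $ i $ j)" for i j by (rule lin(1))
    show "\<alpha> (?g 0 (T *v X) 0) = Ad (hom_i (K_elem T)) (\<alpha> (?g 0 X 0))" if "T \<in> isometries" for T X using that by (rule eX)
  qed (rule that)
  obtain r2 b2 c2 b4 where Y: "\<And>X l. \<alpha> (?g 0 0 X) $ L1 $ LV l = r2 * (X v* I) $ l"
    "\<And>X k. \<alpha> (?g 0 0 X) $ LV k $ L1 = b2 * X $ k"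
    "\<And>X k. \<alpha> (?g 0 0 X) $ LV k $ L2 = c2 * X $ k"
    "\<And>X l. \<alpha> (?g 0 0 X) $ L2 $ LV l = b4 * (X v* I) $ l"
  proof (rule equivariant_odd_blocks[where h="\<lambda>X. \<alpha> (?g 0 0 X)"])
    show "linear (\<lambda>X. \<alpha> (?g 0 0 X) $ i $ j)" for i j by (rule lin(2))
    show "\<alpha> (?g 0 0 (T *v X)) = Ad (hom_i (K_elem T)) (\<alpha> (?g 0 0 X))" if "T \<in> isometries" for T X using that by (rule eY)
  qed (rule that)
  obtain e where e: "\<alpha> (?g 1 0 0) $ LV k $ LV l = (if k = l then e else 0)" for k l
  proof -
    define N where "N = (\<chi> k l. \<alpha> (?g 1 0 0) $ LV k $ LV l)"
    have N_nth: "N $ k $ l = \<alpha> (?g 1 0 0) $ LV k $ LV l" for k l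
      by (simp add: N_def)
    have "N = T ** N ** metric_adjoint T" if "T \<in> isometries" for T
    proof -
      have "\<alpha> (?g 1 (T *v 0) (T *v 0)) $ LV k $ LV l = (T ** N ** metric_adjoint T) $ k $ l" for k l
        by (simp only: equiv_entries[OF that that, of 1 0 0] lblock_nth N_def)
      then show ?thesis
        by (simp add: vec_eq_iff N_nth)
    qed
    then have "N ** T = T ** N" if "T \<in> isometries" for T
      using that by (metis metric_adjoint_inverse(1) matrix_mul_assoc matrix_mul_rid)
    then have "N *v (T *v x) = T *v (N *v x)" if "T \<in> isometries" for T x
      using that by (simp add: matrix_vector_mul_assoc)
    from commuting_scalar[OF matrix_vector_mul_linear this] obtain e where "\<forall>x. N *v x = e *\<^sub>R x"
      by blast
    then have "N = e *\<^sub>R mat 1"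
      by (simp add: matrix_eq flip: scaleR_matrix_vector_assoc)
    then show ?thesis
      using that[of e] by (simp add: N_def vec_eq_iff mat_def)
  qed
  let ?k = "\<lparr>k11 = \<alpha> (?g 1 0 0) $ L1 $ L1, k12X = r1, k12Y = r2, k13 = \<alpha> (?g 1 0 0) $ L1 $ L2,
    k21X = b1, k21Y = b2, k22 = e, k23X = c1, k23Y = c2,
    k31 = \<alpha> (?g 1 0 0) $ L2 $ L1, k32X = b3, k32Y = b4, k33 = \<alpha> (?g 1 0 0) $ L2 $ L2\<rparr>"
  have "\<alpha> (gmat c I a X Y A) = coeff_block ?k a X Y A" if A: "A \<in> so_alg I" for a X Y A
  proof -
    have K: "gmat c I 0 0 0 A \<in> algG c I"
      using A by (rule gmat_in_algG)
    have "gmat c I a X Y A = (a *\<^sub>R ?g 1 0 0 + ?g 0 X Y) + gmat c I 0 0 0 A" "?g a X Y = a *\<^sub>R ?g 1 0 0 + ?g 0 X Y"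
      "?g 0 X Y = ?g 0 X 0 + ?g 0 0 Y" "a *\<^sub>R ?g 1 0 0 = ?g a 0 0"
      by (simp_all add: gmat_add gmat_scaleR)
    then have "\<alpha> (gmat c I a X Y A) =
        a *\<^sub>R \<alpha> (?g 1 0 0) + (\<alpha> (?g 0 X 0) + (\<alpha> (?g 0 0 Y) + \<alpha> (gmat c I 0 0 0 A)))"
      using add[OF g K, of a X Y] add[OF g g, of a 0 0 0 X Y] add[OF g g, of 0 X 0 0 0 Y] scale[OF g, of a 1 0 0]
      by simp
    moreover have "\<alpha> (gmat c I 0 0 0 A) = lblock 0 0 0 0 A 0 0 0 0"
    proof -
      have "gmat c I 0 0 0 A \<in> algK I" using A by (auto simp: algK_eq)
      then have "\<alpha> (gmat c I 0 0 0 A) = hom_i' (gmat c I 0 0 0 A)"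
        using ext unfolding extension_def by blast
      then show ?thesis
        by (simp add: hom_i'_def gmat_def vec_lambda_eta)
    qed
    ultimately show ?thesis
      apply (subst (asm) even[of 1])
      apply (subst (asm) odd[of X 0])
      apply (subst (asm) odd[of 0 Y])
      apply (simp add: coeff_block_def lmatrix_eq_iff X Y e mat_def)
      done
  qed
  then show ?thesis
    unfolding has_coeffs_def by blast
qed

end

section \<open>Extensions and regularity\<close>

context signature_form
begin

text \<open>
  Besides the trace condition this says that \<open>\<alpha>\<close> induces an isomorphism from \<open>\<gg>/\<kk>\<close> to \<open>\<ll>/\<pp>\<close>, a map
  that consists of the \<open>2 \<times> 2\<close> matrix of \<open>b\<^sub>1, \<dots>, b\<^sub>4\<close> on the vectors and of one scalar on \<open>a\<close>.
\<close>

definition admissible :: "coeffs \<Rightarrow> bool" where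
  "admissible k \<longleftrightarrow> kdet k \<noteq> 0 \<and> k31 k \<noteq> 0 \<and> k11 k + n * k22 k + k33 k = 0"

lemma trace_so_alg: "A \<in> so_alg I \<Longrightarrow> trace A = 0"
proof -
  assume "A \<in> so_alg I"
  then have "A $ i $ i * I $ i $ i + I $ i $ i * A $ i $ i = 0" for i
    by (simp add: so_alg_nth)
  note sq = this
  have "A $ i $ i = 0" for i
  proof -
    from sq[of i] I_diag[of i] show ?thesis by auto
  qed
  then show ?thesis
    by (simp add: trace_def)
qed

lemma trace_coeff_block:
  "A \<in> so_alg I \<Longrightarrow> trace (coeff_block k a X Y A) = (k11 k + n * k22 k + k33 k) * a"
proof -
  have "trace (r *\<^sub>R mat 1 :: real ^ 'n ^ 'n) = n * r" for r
    by (simp add: trace_def mat_def n_def)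
  then show "A \<in> so_alg I \<Longrightarrow> trace (coeff_block k a X Y A) = (k11 k + n * k22 k + k33 k) * a"
    by (simp add: coeff_block_def trace_lblock trace_add trace_so_alg algebra_simps)
qed

lemma I_nz: "I $ i $ i \<noteq> 0"
  using I_diag[of i] by auto

lemma conj_so_alg:
  assumes "A \<in> so_alg I" shows "T ** A ** metric_adjoint T \<in> so_alg I"
proof -
  have "transpose A ** I = - (I ** A)"
    using assms by (simp add: so_alg_def eq_neg_iff_add_eq_0)
  then have "I ** (transpose A ** I) ** I = - (I ** (I ** A) ** I)"
    by (simp add: matrix_mult_minus)
  then have *: "I ** transpose A = - (A ** I)"
    by (metis I_I matrix_mul_assoc matrix_mul_lid matrix_mul_rid)
  have "transpose (T ** A ** metric_adjoint T) ** I = I ** T ** (I ** transpose A) ** transpose T ** I"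
    by (simp add: metric_adjoint_def matrix_transpose_mul transpose_I matrix_mul_assoc)
  also have "\<dots> = - (I ** (T ** A ** metric_adjoint T))"
    unfolding * by (simp add: matrix_mult_minus metric_adjoint_def matrix_mul_assoc)
  finally show ?thesis
    by (simp add: so_alg_def)
qed

lemma Ad_coeff_block:
  assumes "T \<in> isometries"
  shows "Ad (hom_i (K_elem T)) (coeff_block k a X Y A) = coeff_block k a (T *v X) (T *v Y) (T ** A ** metric_adjoint T)"
proof -
  have "T ** (A + e *\<^sub>R mat 1) ** metric_adjoint T = T ** A ** metric_adjoint T + e *\<^sub>R mat 1" for e
    by (simp add: matrix_add_ldistrib matrix_mult_add_left matrix_scalar_ac metric_adjoint_inverse[OF assms] flip: scalar_matrix_assoc)
  then show ?thesis
    unfolding coeff_block_def Ad_hom_i[OF assms] lblock_inject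
    by (simp add: vector_matrix_left_distrib scaleR_vector_matrix_assoc row_metric_adjoint[OF assms]
        matrix_vector_right_distrib matrix_vector_mult_scaleR)
qed

lemma coeff_block_in_alg_p:
  "coeff_block k a X Y A \<in> alg_p \<longleftrightarrow> trace (coeff_block k a X Y A) = 0 \<and> k31 k * a = 0 \<and>
     k21X k *\<^sub>R X + k21Y k *\<^sub>R Y = 0 \<and> k32X k *\<^sub>R X + k32Y k *\<^sub>R Y = 0"
proof -
  have "(k32X k *\<^sub>R (X v* I) + k32Y k *\<^sub>R (Y v* I)) $ l = I $ l $ l * (k32X k *\<^sub>R X + k32Y k *\<^sub>R Y) $ l" for l
    by (simp add: algebra_simps)
  then have "(\<forall>l. (k32X k *\<^sub>R (X v* I) + k32Y k *\<^sub>R (Y v* I)) $ l = 0) \<longleftrightarrow> k32X k *\<^sub>R X + k32Y k *\<^sub>R Y = 0"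
    using I_nz by (simp only: vec_eq_iff mult_eq_0_iff zero_index) blast
  then show ?thesis
    unfolding alg_p_iff alg_l_def coeff_block_def lblock_nth mem_Collect_eq
    by (auto simp: vec_eq_iff)
qed

lemma extension_iff_admissible:
  assumes \<alpha>: "has_coeffs \<alpha> k"
  shows "extension c I \<alpha> \<longleftrightarrow> admissible k"
proof
  have \<alpha>': "\<alpha> (gmat c I a X Y A) = coeff_block k a X Y A" if "A \<in> so_alg I" for a X Y A
    using \<alpha> that by (simp add: has_coeffs_def)
  {
    assume ext: "extension c I \<alpha>"
    let ?v = "axis undefined 1 :: real ^ 'n"
    have "\<alpha> (gmat c I 1 0 0 0) \<in> alg_l"
      using ext gmat_in_algG[OF so_alg_zero] unfolding extension_def by blast
    then have tr: "k11 k + n * k22 k + k33 k = 0"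
      by (simp add: alg_l_def \<alpha>' so_alg_zero trace_coeff_block)
    have inj: "a = 0 \<and> X = 0 \<and> Y = 0"
      if "k31 k * a = 0" "k21X k *\<^sub>R X + k21Y k *\<^sub>R Y = 0" "k32X k *\<^sub>R X + k32Y k *\<^sub>R Y = 0" for a and X Y :: "real ^ 'n"
    proof -
      have "\<alpha> (gmat c I a X Y 0) \<in> alg_p"
        using that tr by (simp add: \<alpha>' so_alg_zero coeff_block_in_alg_p trace_coeff_block)
      then have "gmat c I a X Y 0 \<in> algK I"
        using ext gmat_in_algG[OF so_alg_zero] unfolding extension_def by blast
      then show ?thesis
        by (simp add: gmat_in_algK so_alg_zero)
    qed
    have "k31 k \<noteq> 0"
      using inj[of 1 0 0] by auto
    moreover have "kdet k \<noteq> 0"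
    proof
      assume "kdet k = 0"
      then have "\<exists>l m. (l \<noteq> 0 \<or> m \<noteq> 0) \<and> k21X k * l + k21Y k * m = 0 \<and> k32X k * l + k32Y k * m = 0"
      proof (cases "k21X k = 0 \<and> k21Y k = 0")
        case True
        then show ?thesis
        proof (cases "k32X k = 0 \<and> k32Y k = 0")
          case False
          with True show ?thesis
            by (intro exI[of _ "k32Y k"] exI[of _ "- k32X k"]) auto
        qed (auto intro: exI[of _ 1])
      next
        case False
        then show ?thesis
          using \<open>kdet k = 0\<close>
          by (intro exI[of _ "k21Y k"] exI[of _ "- k21X k"]) (auto simp: kdet_def algebra_simps)
      qed
      then obtain l m where lm: "l \<noteq> 0 \<or> m \<noteq> 0" "k21X k * l + k21Y k * m = 0" "k32X k * l + k32Y k * m = 0"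
        by blast
      have "l *\<^sub>R ?v = 0 \<and> m *\<^sub>R ?v = 0"
        using inj[of 0 "l *\<^sub>R ?v" "m *\<^sub>R ?v"] lm(2,3) by (simp flip: scaleR_left_distrib)
      then show False
        using lm(1) by simp
    qed
    ultimately show "admissible k"
      using tr by (simp add: admissible_def)
  next
    assume adm: "admissible k"
    then have D: "kdet k \<noteq> 0" and w: "k31 k \<noteq> 0" and tr: "k11 k + n * k22 k + k33 k = 0"
      by (auto simp: admissible_def)
    have "\<alpha> ` algG c I \<subseteq> alg_l"
      by (auto simp: algG_def \<alpha>' alg_l_def trace_coeff_block tr)
    moreover have "\<forall>x\<in>algG c I. \<forall>y\<in>algG c I. \<alpha> (x + y) = \<alpha> x + \<alpha> y"
      unfolding algG_def
      by (auto simp: gmat_add \<alpha>' so_alg_add coeff_block_def lmatrix_eq_iff algebra_simps)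
    moreover have "\<forall>r. \<forall>x\<in>algG c I. \<alpha> (r *\<^sub>R x) = r *\<^sub>R \<alpha> x"
      unfolding algG_def
      by (auto simp: gmat_scaleR \<alpha>' so_alg_scaleR coeff_block_def lmatrix_eq_iff algebra_simps)
    moreover have "\<forall>g\<in>grpK I. \<forall>x\<in>algG c I. \<alpha> (Ad g x) = Ad (hom_i g) (\<alpha> x)"
    proof (intro ballI)
      fix g x assume "g \<in> grpK I" "x \<in> algG c I"
      then obtain T a X Y A where "T \<in> isometries" "g = K_elem T" "x = gmat c I a X Y A" "A \<in> so_alg I"
        by (auto simp: grpK_iff algG_def)
      then show "\<alpha> (Ad g x) = Ad (hom_i g) (\<alpha> x)"
        by (simp add: Ad_gmat \<alpha>' conj_so_alg Ad_coeff_block)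
    qed
    moreover have "\<forall>x\<in>algK I. \<alpha> x = hom_i' x"
    proof
      fix x assume "x \<in> algK I"
      then obtain A where A: "x = gmat c I 0 0 0 A" "A \<in> so_alg I"
        by (auto simp: algK_eq)
      have "hom_i' x = lblock 0 0 0 0 A 0 0 0 0"
        unfolding A by (simp add: hom_i'_def gmat_def vec_lambda_eta)
      then show "\<alpha> x = hom_i' x"
        using A by (simp add: \<alpha>' coeff_block_def)
    qed
    moreover have "\<forall>x\<in>algG c I. \<alpha> x \<in> alg_p \<longrightarrow> x \<in> algK I"
    proof (intro ballI impI)
      fix x assume "x \<in> algG c I" and p: "\<alpha> x \<in> alg_p"
      then obtain a X Y A where x: "x = gmat c I a X Y A" "A \<in> so_alg I"
        by (auto simp: algG_def)
      from p have a: "a = 0" and e: "k21X k *\<^sub>R X + k21Y k *\<^sub>R Y = 0" "k32X k *\<^sub>R X + k32Y k *\<^sub>R Y = 0"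
        unfolding x(1) \<alpha>'[OF x(2)] coeff_block_in_alg_p using w by simp_all
      have "kdet k *\<^sub>R X = k32Y k *\<^sub>R (k21X k *\<^sub>R X + k21Y k *\<^sub>R Y) - k21Y k *\<^sub>R (k32X k *\<^sub>R X + k32Y k *\<^sub>R Y)"
        "kdet k *\<^sub>R Y = k21X k *\<^sub>R (k32X k *\<^sub>R X + k32Y k *\<^sub>R Y) - k32X k *\<^sub>R (k21X k *\<^sub>R X + k21Y k *\<^sub>R Y)"
        by (simp_all add: kdet_def algebra_simps)
      then have "X = 0" "Y = 0"
        using D unfolding e by simp_all
      then show "x \<in> algK I"
        using a x by (simp add: gmat_in_algK)
    qed
    moreover have "\<forall>u\<in>alg_l. \<exists>x\<in>algG c I. u - \<alpha> x \<in> alg_p"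
    proof
      fix u :: "'n lmatrix" assume u: "u \<in> alg_l"
      let ?X = "\<chi> i. (k32Y k * u $ LV i $ L1 - k21Y k * (I $ i $ i * u $ L2 $ LV i)) / kdet k"
      let ?Y = "\<chi> i. (- k32X k * u $ LV i $ L1 + k21X k * (I $ i $ i * u $ L2 $ LV i)) / kdet k"
      let ?x = "gmat c I (u $ L2 $ L1 / k31 k) ?X ?Y 0"
      have "k21X k * ?X $ i + k21Y k * ?Y $ i = u $ LV i $ L1"
        "k32X k * ?X $ i + k32Y k * ?Y $ i = I $ i $ i * u $ L2 $ LV i" for i
        using D by (simp_all add: field_simps) (simp_all add: kdet_def algebra_simps)
      moreover have "k32X k * (I $ i $ i * ?X $ i) + k32Y k * (I $ i $ i * ?Y $ i) =
          I $ i $ i * (k32X k * ?X $ i + k32Y k * ?Y $ i)" for i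
        by (simp add: algebra_simps)
      ultimately have "u - \<alpha> ?x \<in> alg_p"
        unfolding alg_p_iff using u w
        by (simp add: \<alpha>' so_alg_zero alg_l_def trace_sub trace_coeff_block tr)
           (simp add: coeff_block_def I_sq)
      then show "\<exists>x\<in>algG c I. u - \<alpha> x \<in> alg_p"
        using gmat_in_algG[OF so_alg_zero] by blast
    qed
    ultimately show "extension c I \<alpha>"
      unfolding extension_def by blast
  }
qed

text \<open>
  The coordinates \<open>a, X, Y\<close> of the preimage in \<open>\<gg>/\<kk>\<close> of a class in \<open>\<ll>/\<pp>\<close>, obtained by Cramer's rule.
\<close>

definition pre_a :: "coeffs \<Rightarrow> 'n lmatrix \<Rightarrow> real" where
  "pre_a k u = u $ L2 $ L1 / k31 k"
definition pre_X :: "coeffs \<Rightarrow> 'n lmatrix \<Rightarrow> real ^ 'n" where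
  "pre_X k u = (\<chi> i. (k32Y k * u $ LV i $ L1 - k21Y k * (I $ i $ i * u $ L2 $ LV i)) / kdet k)"
definition pre_Y :: "coeffs \<Rightarrow> 'n lmatrix \<Rightarrow> real ^ 'n" where
  "pre_Y k u = (\<chi> i. (- k32X k * u $ LV i $ L1 + k21X k * (I $ i $ i * u $ L2 $ LV i)) / kdet k)"

lemma preimage_mod_coeffs:
  assumes \<alpha>: "has_coeffs \<alpha> k" and adm: "admissible k" and u: "u \<in> alg_l"
  obtains A where "A \<in> so_alg I" "preimage_mod c I \<alpha> u = gmat c I (pre_a k u) (pre_X k u) (pre_Y k u) A"
proof -
  have D: "kdet k \<noteq> 0" and w: "k31 k \<noteq> 0"
    using adm by (auto simp: admissible_def)
  let ?x = "preimage_mod c I \<alpha> u"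
  have "\<exists>x. x \<in> algG c I \<and> u - \<alpha> x \<in> alg_p"
    using extension_iff_admissible[OF \<alpha>] adm u unfolding extension_def by blast
  from someI_ex[OF this] have x: "?x \<in> algG c I" "u - \<alpha> ?x \<in> alg_p"
    by (auto simp: preimage_mod_def)
  then obtain a X Y A where A: "A \<in> so_alg I" and eq: "?x = gmat c I a X Y A"
    by (auto simp: algG_def)
  have "\<alpha> ?x = coeff_block k a X Y A"
    using \<alpha> A eq by (simp add: has_coeffs_def)
  with x(2) have e: "u $ L2 $ L1 = k31 k * a" "u $ LV i $ L1 = k21X k * X $ i + k21Y k * Y $ i"
    "u $ L2 $ LV i = k32X k * (I $ i $ i * X $ i) + k32Y k * (I $ i $ i * Y $ i)" for i
    by (auto simp: alg_p_iff coeff_block_def)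
  have "I $ i $ i * u $ L2 $ LV i = k32X k * X $ i + k32Y k * Y $ i" for i
    unfolding e by (simp add: algebra_simps I_sq)
  then have "a = pre_a k u" "X = pre_X k u" "Y = pre_Y k u"
    using D w by (simp_all add: pre_a_def pre_X_def pre_Y_def vec_eq_iff e(1,2) field_simps)
      (simp_all add: kdet_def algebra_simps)
  then show thesis
    using that A eq by blast
qed

text \<open>
  The chosen preimages are determined up to \<open>\<kk>\<close>, on which the curvature vanishes. So \<open>kappa\<close> is the
  2-form of \<open>curvature_coeffs\<close> at the preimage coordinates.
\<close>

lemma kappa_coeffs:
  assumes \<alpha>: "has_coeffs \<alpha> k" and adm: "admissible k" and u: "u \<in> alg_l" and v: "v \<in> alg_l"
  shows "kappa c I \<alpha> u v = form_block (curv_coeffs k) (pre_a k u) (pre_X k u) (pre_Y k u) (pre_a k v) (pre_X k v) (pre_Y k v)"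
proof -
  obtain A where A: "A \<in> so_alg I" "preimage_mod c I \<alpha> u = gmat c I (pre_a k u) (pre_X k u) (pre_Y k u) A"
    using preimage_mod_coeffs[OF \<alpha> adm u] .
  obtain B where B: "B \<in> so_alg I" "preimage_mod c I \<alpha> v = gmat c I (pre_a k v) (pre_X k v) (pre_Y k v) B"
    using preimage_mod_coeffs[OF \<alpha> adm v] .
  show ?thesis
    unfolding kappa_def A(2) B(2) by (rule curvature_coeffs[OF \<alpha> A(1) B(1)])
qed

lemma ip_axis: "(X v* I) \<bullet> (r *\<^sub>R axis k 1) = r * (I $ k $ k * X $ k)"
  by (simp add: inner_axis)

lemma matrix_unit_alg_l: "i \<noteq> j \<Longrightarrow> matrix_unit i j \<in> (alg_l :: 'n lmatrix set)"
  by (auto simp: alg_l_def trace_def matrix_unit_def intro!: sum.neutral)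

lemma bracket_alg_l: "bracket M N \<in> (alg_l :: 'n lmatrix set)"
  by (simp add: alg_l_def bracket_def trace_sub trace_mul_sym[of M N])

lemma pre_matrix_unit:
  assumes "admissible k"
  shows "pre_a k (matrix_unit (LV m) L1) = 0" "pre_X k (matrix_unit (LV m) L1) = (k32Y k / kdet k) *\<^sub>R axis m 1"
    "pre_Y k (matrix_unit (LV m) L1) = (- k32X k / kdet k) *\<^sub>R axis m 1"
    "pre_a k (matrix_unit L2 (LV m)) = 0" "pre_X k (matrix_unit L2 (LV m)) = (- k21Y k / kdet k * I $ m $ m) *\<^sub>R axis m 1"
    "pre_Y k (matrix_unit L2 (LV m)) = (k21X k / kdet k * I $ m $ m) *\<^sub>R axis m 1"
    "pre_a k (matrix_unit L2 L1) = 1 / k31 k" "pre_X k (matrix_unit L2 L1) = 0" "pre_Y k (matrix_unit L2 L1) = 0"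
  by (auto simp: pre_a_def pre_X_def pre_Y_def matrix_unit_def vec_eq_iff axis_def)

text \<open>
  Only the component \<open>\<ll>\<^sub>-\<^sub>1 \<times> \<ll>\<^sub>-\<^sub>1 \<rightarrow> \<ll>\<^sub>-\<^sub>2\<close> of the curvature has a homogeneity that regularity excludes, and this
  component is \<open>D - k\<^sub>3\<^sub>1\<close> times the invariant scalar 2-form.
\<close>

lemma regular_iff:
  assumes \<alpha>: "has_coeffs \<alpha> k" and adm: "admissible k"
  shows "regular c I \<alpha> \<longleftrightarrow> k31 k = kdet k"
proof
  have D: "kdet k \<noteq> 0" using adm by (simp add: admissible_def)
  assume reg: "regular c I \<alpha>"
  let ?m = "undefined :: 'n"
  let ?u = "matrix_unit (LV ?m) L1 :: 'n lmatrix" and ?v = "matrix_unit L2 (LV ?m) :: 'n lmatrix"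
  have g: "?u \<in> grade (- 1)" "?v \<in> grade (- 1)"
    by (auto simp: grade_def matrix_unit_alg_l) (auto simp: matrix_unit_def split: if_splits)
  then have "kappa c I \<alpha> ?u ?v \<in> filtr (- 1 + - 1 + 1)"
    using reg unfolding regular_def by (metis neg_less_0_iff_less zero_less_one)
  then have "kappa c I \<alpha> ?u ?v $ L2 $ L1 = 0"
    unfolding filtr_def mem_Collect_eq by (metis (no_types, lifting) level.simps(1,3) add_uminus_conv_diff
        diff_add_cancel diff_0 neg_le_iff_le numeral_le_one_iff semiring_norm(69))
  moreover have "kappa c I \<alpha> ?u ?v = form_block (curv_coeffs k) (pre_a k ?u) (pre_X k ?u) (pre_Y k ?u) (pre_a k ?v) (pre_X k ?v) (pre_Y k ?v)"
    using kappa_coeffs[OF \<alpha> adm] by (simp add: matrix_unit_alg_l)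
  ultimately have "(kdet k - k31 k) * ((pre_Y k ?u v* I) \<bullet> pre_X k ?v - (pre_X k ?u v* I) \<bullet> pre_Y k ?v) = 0"
    by (simp add: form_block_def curv_coeffs_def Let_def)
  moreover have "(pre_Y k ?u v* I) \<bullet> pre_X k ?v - (pre_X k ?u v* I) \<bullet> pre_Y k ?v = - (1 / kdet k)"
  proof -
    have "(pre_Y k ?u v* I) \<bullet> pre_X k ?v - (pre_X k ?u v* I) \<bullet> pre_Y k ?v
        = (k32X k * k21Y k - k32Y k * k21X k) / (kdet k * kdet k)"
      unfolding pre_matrix_unit[OF adm] ip_axis by (simp add: I_sq axis_def diff_divide_distrib ac_simps)
    also have "k32X k * k21Y k - k32Y k * k21X k = - kdet k"
      by (simp add: kdet_def)
    finally show ?thesis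
      using D by simp
  qed
  \<comment> \<open>On a dual pair of basis vectors of \<open>\<ll>\<^sub>-\<^sub>1\<close> the scalar 2-form is \<open>- 1 / D\<close>.\<close>
  ultimately show "k31 k = kdet k"
    using D by simp
next
  assume eq: "k31 k = kdet k"
  have D: "kdet k \<noteq> 0" using adm by (simp add: admissible_def)
  have alg_l: "kappa c I \<alpha> u v \<in> alg_l" if uv: "u \<in> alg_l" "v \<in> alg_l" for u v
  proof -
    obtain A where A: "A \<in> so_alg I" "preimage_mod c I \<alpha> u = gmat c I (pre_a k u) (pre_X k u) (pre_Y k u) A"
      using preimage_mod_coeffs[OF \<alpha> adm uv(1)] .
    obtain B where B: "B \<in> so_alg I" "preimage_mod c I \<alpha> v = gmat c I (pre_a k v) (pre_X k v) (pre_Y k v) B"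
      using preimage_mod_coeffs[OF \<alpha> adm uv(2)] .
    let ?z = "bracket (gmat c I (pre_a k u) (pre_X k u) (pre_Y k u) A) (gmat c I (pre_a k v) (pre_X k v) (pre_Y k v) B)"
    have "?z \<in> algG c I"
      unfolding bracket_gmat(1)[OF A(1) B(1)] by (rule gmat_in_algG[OF bracket_gmat(2)[OF A(1) B(1)]])
    then have "\<alpha> ?z \<in> alg_l"
      using extension_iff_admissible[OF \<alpha>] adm unfolding extension_def by blast
    then show ?thesis
      using bracket_alg_l unfolding kappa_def A(2) B(2) curvature_def
      by (simp add: alg_l_def trace_sub)
  qed
  show "regular c I \<alpha>"
    unfolding regular_def
  proof (intro allI impI)
    fix i j :: int and u v :: "'n lmatrix"
    assume ij: "i < 0" "j < 0" and u: "u \<in> grade i" and v: "v \<in> grade j"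
    have uv: "u \<in> alg_l" "v \<in> alg_l"
      using u v by (auto simp: grade_def)
    have "kappa c I \<alpha> u v $ L2 $ L1 = 0"
      unfolding kappa_coeffs[OF \<alpha> adm uv] by (simp add: form_block_def Let_def curv_coeffs_def eq)
    then have "level b - level a \<ge> - 1" if "kappa c I \<alpha> u v $ a $ b \<noteq> 0" for a b
      using that by (cases a; cases b) auto
    then show "kappa c I \<alpha> u v \<in> filtr (i + j + 1)"
      using ij alg_l[OF uv] unfolding filtr_def by fastforce
  qed
qed

end

section \<open>Normality\<close>

text \<open>
  The scalar content of normality. The left hand side lists the components of the
  normality equation, where \<open>d11, d13, d33\<close>, \<open>s1, s2\<close>, \<open>t1, t2\<close>, \<open>p1, p2\<close>, \<open>q1, q2\<close> and the \<open>m\<close>'s are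
  the curvature coefficients, \<open>x, e, y, z\<close> the coefficients of \<open>a\<close> in the diagonal and in the upper right
  corner, and \<open>r1, r2\<close> and \<open>c1, c2\<close> those of \<open>X, Y\<close> in the blocks \<open>(1,2)\<close> and \<open>(2,3)\<close>.

  The first four equations are the \<open>X\<close>- and \<open>Y\<close>-components of two covectors on the plane of pairs
  \<open>(X, Y)\<close>. Evaluated on \<open>(b\<^sub>4, - b\<^sub>3)\<close> and \<open>(- b\<^sub>2, b\<^sub>1)\<close>, which are proportional to the
  coordinates of the basis of \<open>\<ll>\<^sub>-\<^sub>1\<close>, they involve only one of \<open>G\<close>, \<open>H\<close> or the diagonal coefficients each. The equations for the
  diagonal coefficients are linear and determine them up to \<open>x - y\<close>; the equation for the corner entry \<open>z\<close>
  then reads \<open>3 D d13 = 0\<close>.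
\<close>

lemma normality_equations:
  fixes x y e z b1 b2 b3 b4 r1 r2 c1 c2 c D n :: real
  defines "G \<equiv> b4 * r1 - b3 * r2" and "H \<equiv> b1 * c2 - b2 * c1"
    and "W \<equiv> b2 * b4 + c * b1 * b3"
    and "d11 \<equiv> b1 * r2 - b2 * r1 - x" and "d13 \<equiv> r2 * c1 - r1 * c2 - z" and "d33 \<equiv> b4 * c1 - b3 * c2 - y"
    and "p1 \<equiv> - ((x - e) * r1) - z * b3 - r2" and "p2 \<equiv> - ((x - e) * r2) - z * b4 + c * r1"
    and "s1 \<equiv> (x - e) * b1 + D * c1 - b2" and "s2 \<equiv> (x - e) * b2 + D * c2 + c * b1"
    and "q1 \<equiv> z * b1 + (y - e) * c1 - c2" and "q2 \<equiv> z * b2 + (y - e) * c2 + c * c1"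
    and "t1 \<equiv> - (D * r1) - (y - e) * b3 - b4" and "t2 \<equiv> - (D * r2) - (y - e) * b4 + c * b3"
    and "mXZ \<equiv> b1 * r1 + c1 * b3 + 1" and "mXU \<equiv> b1 * r2 + c1 * b4"
    and "mYZ \<equiv> b2 * r1 + c2 * b3" and "mYU \<equiv> b2 * r2 + c2 * b4 + c"
  assumes D: "D = b1 * b4 - b2 * b3" "D \<noteq> 0" and n: "n > 0" and tr: "x + n * e + y = 0"
  shows
    "(1 - n) * b4 * mXZ - b3 * mXU + n * b3 * mYZ - (e + d11) * b3 + t1 = 0 \<and>
     - n * b4 * mXU + b4 * mYZ - (1 - n) * b3 * mYU - (e + d11) * b4 + t2 = 0 \<and>
     - d33 * b1 + (n - 1) * b2 * mXZ - n * b1 * mXU + b1 * mYZ - e * b1 - s1 = 0 \<and>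
     - d33 * b2 - b2 * mXU + n * b2 * mYZ - (n - 1) * b1 * mYU - e * b2 - s2 = 0 \<and>
     D * d11 = s1 * b4 - s2 * b3 \<and> D * d33 = t1 * b2 - t2 * b1 \<and>
     D * d13 = q1 * b4 - q2 * b3 + p1 * b2 - p2 * b1 \<and>
     mXU - mYZ + n * e = d11 + d33
   \<longleftrightarrow> (n + 1) * (D * e) = - W \<and> d11 = 0 \<and> d33 = 0 \<and> d13 = 0 \<and>
       D * G = - (b4\<^sup>2 + c * b3\<^sup>2) \<and> D * H = - (b2\<^sup>2 + c * b1\<^sup>2)"
    (is "?L \<longleftrightarrow> ?R")
proof -
  define g h where "g = b1 * r2 - b2 * r1" and "h = b4 * c1 - b3 * c2"
  have d: "d11 = g - x" "d33 = h - y"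
    by (simp_all add: d11_def d33_def g_def h_def)
  have Ds: "s1 * b4 - s2 * b3 = D * (x - e) + D * h - W"
    unfolding s1_def s2_def h_def W_def D by (simp add: algebra_simps)
  have Dt: "t1 * b2 - t2 * b1 = D * g + D * (y - e) - W"
    unfolding t1_def t2_def g_def W_def D by (simp add: algebra_simps)
  have zz: "D * (r2 * c1 - r1 * c2) = g * h - G * H"
    unfolding g_def h_def G_def H_def D by (simp add: algebra_simps)
  have q: "q1 * b4 - q2 * b3 = D * z + (y - e) * h - (b4 * c2 + c * b3 * c1)"
    unfolding q1_def q2_def h_def D by (simp add: algebra_simps)
  have p: "p1 * b2 - p2 * b1 = D * z + (x - e) * g - (b2 * r2 + c * b1 * r1)"
    unfolding p1_def p2_def g_def D by (simp add: algebra_simps)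
  have bc: "D * (b4 * c2 + c * b3 * c1) = h * W + H * (b4\<^sup>2 + c * b3\<^sup>2)"
    unfolding g_def h_def G_def H_def W_def D by (simp add: algebra_simps power2_eq_square)
  have br: "D * (b2 * r2 + c * b1 * r1) = g * W + G * (b2\<^sup>2 + c * b1\<^sup>2)"
    unfolding g_def h_def G_def H_def W_def D by (simp add: algebra_simps power2_eq_square)
  let ?EX1 = "(1 - n) * b4 * mXZ - b3 * mXU + n * b3 * mYZ - (e + d11) * b3 + t1"
  let ?EY1 = "- n * b4 * mXU + b4 * mYZ - (1 - n) * b3 * mYU - (e + d11) * b4 + t2"
  let ?EX3 = "- d33 * b1 + (n - 1) * b2 * mXZ - n * b1 * mXU + b1 * mYZ - e * b1 - s1"
  let ?EY3 = "- d33 * b2 - b2 * mXU + n * b2 * mYZ - (n - 1) * b1 * mYU - e * b2 - s2"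
  note m = mXZ_def mXU_def mYZ_def mYU_def d11_def d33_def
  have c1: "b4 * ?EX1 - b3 * ?EY1 = - n * (D * G + b4\<^sup>2 + c * b3\<^sup>2)"
    unfolding m t1_def t2_def G_def D by (simp add: algebra_simps power2_eq_square)
  have c2: "- b2 * ?EX1 + b1 * ?EY1 = D * (x - y) - 2 * D * g - n * D * (g + h) + n * W"
    unfolding m t1_def t2_def g_def h_def W_def D by (simp add: algebra_simps power2_eq_square)
  have c3: "- b2 * ?EX3 + b1 * ?EY3 = - n * (D * H + b2\<^sup>2 + c * b1\<^sup>2)"
    unfolding m s1_def s2_def H_def D by (simp add: algebra_simps power2_eq_square)
  have c4: "b4 * ?EX3 - b3 * ?EY3 = D * (y - x) - 2 * D * h - n * D * (g + h) + n * W"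
    unfolding m s1_def s2_def g_def h_def W_def D by (simp add: algebra_simps power2_eq_square)
  \<comment> \<open>The contraction is invertible, with determinant \<open>D\<close>.\<close>
  have inv: "?EX1 = 0 \<and> ?EY1 = 0 \<longleftrightarrow> b4 * ?EX1 - b3 * ?EY1 = 0 \<and> - b2 * ?EX1 + b1 * ?EY1 = 0"
    "?EX3 = 0 \<and> ?EY3 = 0 \<longleftrightarrow> - b2 * ?EX3 + b1 * ?EY3 = 0 \<and> b4 * ?EX3 - b3 * ?EY3 = 0"
  proof -
    have *: "u = 0 \<and> v = 0 \<longleftrightarrow> b4 * u - b3 * v = 0 \<and> - b2 * u + b1 * v = 0" for u v
    proof -
      have "b1 * (b4 * u - b3 * v) + b3 * (- b2 * u + b1 * v) = D * u"
        "b2 * (b4 * u - b3 * v) + b4 * (- b2 * u + b1 * v) = D * v"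
        by (simp_all add: D algebra_simps)
      then show ?thesis
        using \<open>D \<noteq> 0\<close> by (metis add_0 diff_zero mult_eq_0_iff mult_zero_right)
    qed
    from *[of ?EX1 ?EY1] *[of ?EX3 ?EY3] show
      "?EX1 = 0 \<and> ?EY1 = 0 \<longleftrightarrow> b4 * ?EX1 - b3 * ?EY1 = 0 \<and> - b2 * ?EX1 + b1 * ?EY1 = 0"
      "?EX3 = 0 \<and> ?EY3 = 0 \<longleftrightarrow> - b2 * ?EX3 + b1 * ?EY3 = 0 \<and> b4 * ?EX3 - b3 * ?EY3 = 0"
      by blast+
  qed
  have L: "?L \<longleftrightarrow> D * G + b4\<^sup>2 + c * b3\<^sup>2 = 0 \<and> D * H + b2\<^sup>2 + c * b1\<^sup>2 = 0 \<and>
      D * (x - y) - 2 * D * g - n * D * (g + h) + n * W = 0 \<and>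
      D * (y - x) - 2 * D * h - n * D * (g + h) + n * W = 0 \<and>
      D * (g - x) = D * (x - e) + D * h - W \<and> D * (h - y) = D * g + D * (y - e) - W \<and>
      D * d13 = q1 * b4 - q2 * b3 + p1 * b2 - p2 * b1 \<and>
      g + h + n * e = d11 + d33"
  proof -
    have "?EX1 = 0 \<and> ?EY1 = 0 \<longleftrightarrow> D * G + b4\<^sup>2 + c * b3\<^sup>2 = 0 \<and>
        D * (x - y) - 2 * D * g - n * D * (g + h) + n * W = 0"
      unfolding inv(1) c1 c2 using n by simp
    moreover have "?EX3 = 0 \<and> ?EY3 = 0 \<longleftrightarrow> D * H + b2\<^sup>2 + c * b1\<^sup>2 = 0 \<and>
        D * (y - x) - 2 * D * h - n * D * (g + h) + n * W = 0"
      unfolding inv(2) c3 c4 using n by simp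
    moreover have "D * d11 = s1 * b4 - s2 * b3 \<longleftrightarrow> D * (g - x) = D * (x - e) + D * h - W"
      "D * d33 = t1 * b2 - t2 * b1 \<longleftrightarrow> D * (h - y) = D * g + D * (y - e) - W"
      unfolding Ds Dt d by (rule refl)+
    moreover have "mXU - mYZ = g + h"
      by (simp add: m g_def h_def)
    ultimately show ?thesis
      by (smt (verit))
  qed
  have sol: "(n + 1) * (D * e) = - W" "g = x" "h = y"
    if "D * (x - y) - 2 * D * g - n * D * (g + h) + n * W = 0"
      "D * (y - x) - 2 * D * h - n * D * (g + h) + n * W = 0"
      "D * (g - x) = D * (x - e) + D * h - W" "D * (h - y) = D * g + D * (y - e) - W"
  proof -
    have 1: "(n + 1) * (D * (g + h)) = n * W"
      using that(1,2) by (simp add: algebra_simps)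
    have 2: "D * (x - y) = D * (g - h)"
      using that(1,2) by (simp add: algebra_simps)
    have xy: "x + y = - (n * e)" using tr by simp
    have "D * (x + y) - D * e = W"
      using that(3,4) by (simp add: algebra_simps)
    then show 3: "(n + 1) * (D * e) = - W"
      unfolding xy by (simp add: algebra_simps)
    have "(n + 1) * (D * (x + y)) = - n * ((n + 1) * (D * e))"
      unfolding xy by simp
    also have "\<dots> = n * W"
      unfolding 3 by simp
    finally have "(n + 1) * (D * (x + y)) = (n + 1) * (D * (g + h))"
      using 1 by simp
    then have "x + y = g + h"
      using n \<open>D \<noteq> 0\<close> by simp
    moreover have "x - y = g - h"
      using 2 \<open>D \<noteq> 0\<close> by simp
    ultimately show "g = x" "h = y"
      by linarith+
  qed
  \<comment> \<open>Once the other equations hold, the right hand side is \<open>- 2 D d13\<close>.\<close>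
  have corner: "D * d13 = q1 * b4 - q2 * b3 + p1 * b2 - p2 * b1 \<longleftrightarrow> d13 = 0"
    if e: "(n + 1) * (D * e) = - W" and gh: "g = x" "h = y"
      and GH: "D * G + b4\<^sup>2 + c * b3\<^sup>2 = 0" "D * H + b2\<^sup>2 + c * b1\<^sup>2 = 0"
  proof -
    have GH': "b4\<^sup>2 + c * b3\<^sup>2 = - (D * G)" "b2\<^sup>2 + c * b1\<^sup>2 = - (D * H)"
      using GH by auto
    have xy: "x + y = - (n * e)" using tr by simp
    have W: "W = D * (x + y) - D * e"
      using e unfolding xy by (simp add: algebra_simps)
    let ?rhs = "q1 * b4 - q2 * b3 + p1 * b2 - p2 * b1"
    have r: "?rhs = D * z + (y - e) * y + D * z + (x - e) * x - (b4 * c2 + c * b3 * c1) - (b2 * r2 + c * b1 * r1)"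
      using p q unfolding gh by linarith
    have "D * ?rhs = D * (D * z + (y - e) * y + D * z + (x - e) * x) - D * (b4 * c2 + c * b3 * c1) - D * (b2 * r2 + c * b1 * r1)"
      unfolding r by (simp add: algebra_simps)
    also have "\<dots> = D * (2 * D * z + (y - e) * y + (x - e) * x - (x + y) * (x + y) + (x + y) * e + 2 * G * H)"
      unfolding bc br GH' W gh by (simp add: algebra_simps)
    also have "\<dots> = D * (2 * D * z - 2 * (D * (r2 * c1 - r1 * c2)))"
      unfolding zz gh by (simp add: algebra_simps)
    also have "\<dots> = D * (- 2 * (D * d13))"
      by (simp add: d13_def algebra_simps)
    finally have "?rhs = - 2 * (D * d13)"
      using \<open>D \<noteq> 0\<close> by (metis mult_left_cancel)
    then show ?thesis
      using \<open>D \<noteq> 0\<close> by auto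
  qed
  show ?thesis
  proof
    assume ?L
    then have l: "D * G + b4\<^sup>2 + c * b3\<^sup>2 = 0" "D * H + b2\<^sup>2 + c * b1\<^sup>2 = 0"
      "D * (x - y) - 2 * D * g - n * D * (g + h) + n * W = 0"
      "D * (y - x) - 2 * D * h - n * D * (g + h) + n * W = 0"
      "D * (g - x) = D * (x - e) + D * h - W" "D * (h - y) = D * g + D * (y - e) - W"
      "D * d13 = q1 * b4 - q2 * b3 + p1 * b2 - p2 * b1"
      unfolding L by blast+
    note s = sol[OF l(3-6)]
    have "d13 = 0"
      using corner[OF s l(1,2)] l(7) by blast
    then show ?R
      using s l(1,2) d by (auto simp: eq_neg_iff_add_eq_0 add.assoc)
  next
    assume R: ?R
    then have gh: "g = x" "h = y" and e: "(n + 1) * (D * e) = - W"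
      and GH: "D * G + b4\<^sup>2 + c * b3\<^sup>2 = 0" "D * H + b2\<^sup>2 + c * b1\<^sup>2 = 0"
      using d by auto
    have xy: "x + y = - (n * e)" using tr by simp
    have W: "W = D * (x + y) - D * e"
      using e unfolding xy by (simp add: algebra_simps)
    have "n * D * (x + y) + D * (x + y) = n * (- ((n + 1) * (D * e)))"
      unfolding xy by (simp add: algebra_simps)
    then have "n * D * (x + y) + D * (x + y) = n * W"
      unfolding e by simp
    then have "D * (x - y) - 2 * D * x - n * D * (x + y) + n * W = 0"
      "D * (y - x) - 2 * D * y - n * D * (x + y) + n * W = 0"
      by (simp_all add: algebra_simps)
    moreover have "D * (x - x) = D * (x - e) + D * y - W" "D * (y - y) = D * x + D * (y - e) - W"
      unfolding W by (simp_all add: algebra_simps)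
    moreover have "D * d13 = q1 * b4 - q2 * b3 + p1 * b2 - p2 * b1"
      using R corner[OF e gh GH] by blast
    moreover have "x + y + n * e = d11 + d33"
      using R tr by simp
    ultimately show ?L
      using GH by (intro iffD2[OF L[unfolded gh]] conjI)
  qed
qed

text \<open>
  The bracket with a matrix unit moves one row and one column, so that the codifferential can be read
  off entry by entry.
\<close>

lemma bracket_unit_nth:
  "bracket (matrix_unit p q) M $ a $ b = (if a = p then M $ q $ b else 0) - (if b = q then M $ a $ p else 0)"
  for M :: "real ^ 'm ^ ('m::finite)"
proof -
  have "(matrix_unit p q ** M) $ a $ b = (if a = p then M $ q $ b else 0)"
    by (simp add: matrix_matrix_mult_def matrix_unit_def if_distrib[of "\<lambda>x. x * _"] if_distribR sum.delta cong: if_cong)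
  moreover have "(M ** matrix_unit p q) $ a $ b = (if b = q then M $ a $ p else 0)"
  proof -
    have "(\<Sum>k\<in>UNIV. M $ a $ k * matrix_unit p q $ k $ b) = (\<Sum>k\<in>UNIV. if k = p then (if b = q then M $ a $ p else 0) else 0)"
      by (rule sum.cong) (auto simp: matrix_unit_def)
    then show ?thesis
      by (simp add: matrix_matrix_mult_def)
  qed
  ultimately show ?thesis
    by (simp add: bracket_def)
qed

lemma sum_lower:
  fixes f :: "('n::finite) lidx \<Rightarrow> 'n lidx \<Rightarrow> 'b::comm_monoid_add"
  shows "(\<Sum>(i, j)\<in>{(i, j). level j < level i}. f i j) =
    (\<Sum>k\<in>UNIV. f (LV k) L1) + (\<Sum>k\<in>UNIV. f L2 (LV k)) + f L2 L1"
proof -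
  let ?A = "(\<lambda>k::'n. (LV k, L1)) ` UNIV" and ?B = "(\<lambda>k::'n. (L2, LV k)) ` UNIV"
  have *: "level j < level i \<longleftrightarrow> (i, j) \<in> (?A \<union> ?B) \<union> {(L2, L1)}" for i j :: "'n lidx"
    by (cases i; cases j) auto
  have S: "{(i, j). level j < level i} = (?A \<union> ?B) \<union> {(L2, L1)}"
    using * by auto
  have "(\<Sum>p\<in>?A \<union> ?B \<union> {(L2, L1)}. case_prod f p) = sum (case_prod f) ?A + sum (case_prod f) ?B + f L2 L1"
    by (subst sum.union_disjoint; (subst sum.union_disjoint)?; auto)
  moreover have "sum (case_prod f) ?A = (\<Sum>k\<in>UNIV. f (LV k) L1)" "sum (case_prod f) ?B = (\<Sum>k\<in>UNIV. f L2 (LV k))"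
    by (subst sum.reindex; auto simp: inj_on_def)+
  ultimately show ?thesis
    unfolding S by simp
qed

context signature_form
begin

lemma sum_delta_const: "(\<Sum>k\<in>UNIV. (if k = l then p else 0) + q) = p + n * (q :: real)" for l :: 'n
  by (simp add: sum.distrib n_def)

lemma sum_matrix_nth: "(\<Sum>k\<in>S. F k) $ i $ j = (\<Sum>k\<in>S. F k $ i $ j)" for F :: "'n \<Rightarrow> real ^ 'm ^ 'l"
  by simp

text \<open>
  The part of the codifferential of the form \<open>h\<close> that comes from the unit vectors of the block \<open>(2, 1)\<close>, whose
  preimages in \<open>\<gg>/\<kk>\<close> are \<open>X = z e\<^sub>k\<close>, \<open>Y = u e\<^sub>k\<close>. The factors \<open>n\<close> count the summands in which \<open>e\<^sub>k\<close> is
  contracted with itself.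
\<close>

lemma codiff_sum_left:
  assumes "f31 h = 0"
  shows "(\<Sum>k\<in>UNIV. bracket (matrix_unit L1 (LV k)) (form_block h a X Y 0 (z *\<^sub>R axis k 1) (u *\<^sub>R axis k 1))) =
    lblock (- (n * a * (f21P h * z + f21Q h * u)))
      (\<chi> l. I $ l $ l *
         (X $ l * ((1 - n) * z * fXZ h + u * fXU h - n * u * fYZ h + (f22 h + f11 h) * u)
        + Y $ l * (- n * z * fXU h + z * fYZ h + (1 - n) * u * fYU h - (f22 h + f11 h) * z)))
      (- (n * a * (f23P h * z + f23Q h * u)))
      0 ((a * (f21P h * z + f21Q h * u)) *\<^sub>R mat 1) 0
      0 0 0"
proof -
  let ?K = "\<lambda>k. form_block h a X Y 0 (z *\<^sub>R axis k 1) (u *\<^sub>R axis k 1)"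
  have s: "(Y v* I) \<bullet> (z *\<^sub>R axis k 1) - (X v* I) \<bullet> (u *\<^sub>R axis k 1) = I $ k $ k * (z * Y $ k - u * X $ k)" for k
    unfolding ip_axis by (simp add: algebra_simps)
  have e1: "?K k $ LV k $ L1 = - (a * (f21P h * z + f21Q h * u))"
    "?K k $ LV k $ L2 = - (a * (f23P h * z + f23Q h * u))" for k
    by (simp_all add: form_block_def Let_def axis_def algebra_simps)
  have e2: "?K k $ LV i $ L1 = (if i = k then - (a * (f21P h * z + f21Q h * u)) else 0)" for i k
    by (simp add: form_block_def Let_def axis_def algebra_simps)
  have e3: "?K k $ L2 $ L1 = 0" for k
    by (simp add: form_block_def Let_def assms)
  have e4: "?K k $ LV k $ LV l - (if l = k then ?K k $ L1 $ L1 else 0) =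
    (if k = l then I $ l $ l *
       (X $ l * (z * fXZ h + u * fXU h + (f22 h + f11 h) * u)
      + Y $ l * (z * fYZ h + u * fYU h - (f22 h + f11 h) * z)) else 0)
    + - (I $ l $ l * (X $ l * (z * fXZ h + u * fYZ h) + Y $ l * (z * fXU h + u * fYU h)))" for k l
    unfolding form_block_def Let_def s by (simp add: axis_def mat_def algebra_simps)
  show ?thesis
    unfolding lmatrix_eq_iff sum_matrix_nth bracket_unit_nth
    apply (intro conjI allI)
    subgoal by (simp add: e1 n_def)
    subgoal for l by (simp add: e4 sum_subtractf n_def[symmetric]) (simp add: algebra_simps)
    subgoal by (simp add: e1 n_def)
    subgoal by simp
    subgoal for i l by (simp add: e2 e3 mat_def sum_negf)
    subgoal by simp
    subgoal by simp
    subgoal for l by (simp add: e3 cong: if_cong)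
    subgoal by simp
    done
qed

text \<open>
  The same for the unit vectors of the block \<open>(3, 2)\<close>; their preimages carry a factor \<open>I\<^sub>k\<^sub>k\<close>, since rows
  are stored as \<open>X\<^sup>T I\<close>.
\<close>

lemma codiff_sum_right:
  assumes "f31 h = 0"
  shows "(\<Sum>k\<in>UNIV. bracket (matrix_unit (LV k) L2)
      (form_block h a X Y 0 ((z * I $ k $ k) *\<^sub>R axis k 1) ((u * I $ k $ k) *\<^sub>R axis k 1))) =
    lblock 0 0 (n * a * (f12P h * z + f12Q h * u))
      0 ((- (a * (f32P h * z + f32Q h * u))) *\<^sub>R mat 1)
      (\<chi> m. X $ m * ((1 - n) * z * fXZ h - n * u * fXU h + u * fYZ h - (f22 h + f33 h) * u)
           + Y $ m * (z * fXU h - n * z * fYZ h + (1 - n) * u * fYU h + (f22 h + f33 h) * z))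
      0 0 (n * a * (f32P h * z + f32Q h * u))"
proof -
  let ?L = "\<lambda>k. form_block h a X Y 0 ((z * I $ k $ k) *\<^sub>R axis k 1) ((u * I $ k $ k) *\<^sub>R axis k 1)"
  have s: "(Y v* I) \<bullet> ((z * I $ k $ k) *\<^sub>R axis k 1) - (X v* I) \<bullet> ((u * I $ k $ k) *\<^sub>R axis k 1) = z * Y $ k - u * X $ k" for k
    unfolding ip_axis by (simp add: I_sq algebra_simps)
  have e1: "?L k $ L2 $ LV k = - (a * (f32P h * z + f32Q h * u))"
    "?L k $ L1 $ LV k = - (a * (f12P h * z + f12Q h * u))" for k
    by (simp_all add: form_block_def Let_def axis_def I_sq algebra_simps)
  have e2: "?L k $ L2 $ LV i = (if i = k then - (a * (f32P h * z + f32Q h * u)) else 0)" for i k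
    by (simp add: form_block_def Let_def axis_def I_sq algebra_simps)
  have e3: "?L k $ L2 $ L1 = 0" for k
    by (simp add: form_block_def Let_def assms)
  have e4: "(if m = k then ?L k $ L2 $ L2 else 0) - ?L k $ LV m $ LV k =
    (if k = m then
       X $ m * (z * fXZ h + u * fYZ h - (f22 h + f33 h) * u)
      + Y $ m * (z * fXU h + u * fYU h + (f22 h + f33 h) * z) else 0)
    + - (X $ m * (z * fXZ h + u * fXU h) + Y $ m * (z * fYZ h + u * fYU h))" for k m
    unfolding form_block_def Let_def s by (simp add: axis_def mat_def I_sq algebra_simps)
  show ?thesis
    unfolding lmatrix_eq_iff sum_matrix_nth bracket_unit_nth
    apply (intro conjI allI)
    subgoal by simp
    subgoal by simp
    subgoal by (simp add: e1 n_def)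
    subgoal by (simp add: e3)
    subgoal for i l by (simp add: e2 mat_def)
    subgoal for m by (simp add: e4 sum_delta_const) (simp add: algebra_simps)
    subgoal by simp
    subgoal by simp
    subgoal by (simp add: e1 n_def)
    done
qed

lemma codiff_top:
  assumes "f31 h = 0"
  shows "bracket (matrix_unit L1 L2) (form_block h a X Y b 0 0) =
    lblock 0 (\<chi> l. b * (I $ l $ l * (f32P h * X $ l + f32Q h * Y $ l))) 0
      0 0 (\<chi> m. - (b * (f21P h * X $ m + f21Q h * Y $ m))) 0 0 0"
  unfolding lmatrix_eq_iff bracket_unit_nth
  by (simp add: form_block_def Let_def assms algebra_simps)

text \<open>
  The left hand side of the normality equation evaluates the form on dual pairs of basis vectors of
  \<open>\<ll>\<^sub>-\<^sub>1\<close> only, since \<open>[Z\<^sub>i, X]\<close> lies in \<open>\<pp>\<close> unless \<open>Z\<^sub>i\<close> has degree 1 and \<open>X\<close> has a component of degree \<open>-2\<close>.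
\<close>

lemma form_sum_dual:
  assumes "f31 h = 0"
  shows "(\<Sum>k\<in>UNIV. form_block h 0 ((x * I $ k $ k) *\<^sub>R axis k 1) ((y * I $ k $ k) *\<^sub>R axis k 1)
      0 (z *\<^sub>R axis k 1) (u *\<^sub>R axis k 1)) =
    lblock (n * (y * z - x * u) * f11 h) 0 (n * (y * z - x * u) * f13 h)
      0 (((x * u - y * z) * (fXU h - fYZ h + n * f22 h)) *\<^sub>R mat 1) 0
      0 0 (n * (y * z - x * u) * f33 h)"
    (is "(\<Sum>k\<in>UNIV. ?K k) = _")
  "(\<Sum>k\<in>UNIV. form_block h 0 (z *\<^sub>R axis k 1) (u *\<^sub>R axis k 1)
      0 ((x * I $ k $ k) *\<^sub>R axis k 1) ((y * I $ k $ k) *\<^sub>R axis k 1)) =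
    lblock (n * (u * x - z * y) * f11 h) 0 (n * (u * x - z * y) * f13 h)
      0 (((z * y - u * x) * (fXU h - fYZ h + n * f22 h)) *\<^sub>R mat 1) 0
      0 0 (n * (u * x - z * y) * f33 h)"
    (is "(\<Sum>k\<in>UNIV. ?L k) = _")
proof -
  have K: "?K k = lblock ((y * z - x * u) * f11 h) 0 ((y * z - x * u) * f13 h)
      0 (\<chi> i j. (if k = i then (if i = j then (x * u - y * z) * (fXU h - fYZ h) else 0) else 0) +
            (if i = j then (x * u - y * z) * f22 h else 0)) 0
      0 0 ((y * z - x * u) * f33 h)" for k
    unfolding form_block_def Let_def ip_axis lmatrix_eq_iff
    by (simp add: axis_def mat_def I_sq assms algebra_simps)
  have L: "?L k = lblock ((u * x - z * y) * f11 h) 0 ((u * x - z * y) * f13 h)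
      0 (\<chi> i j. (if k = i then (if i = j then (z * y - u * x) * (fXU h - fYZ h) else 0) else 0) +
            (if i = j then (z * y - u * x) * f22 h else 0)) 0
      0 0 ((u * x - z * y) * f33 h)" for k
    unfolding form_block_def Let_def ip_axis lmatrix_eq_iff
    by (simp add: axis_def mat_def I_sq assms algebra_simps)
  show "(\<Sum>k\<in>UNIV. ?K k) = lblock (n * (y * z - x * u) * f11 h) 0 (n * (y * z - x * u) * f13 h)
      0 (((x * u - y * z) * (fXU h - fYZ h + n * f22 h)) *\<^sub>R mat 1) 0
      0 0 (n * (y * z - x * u) * f33 h)"
    unfolding K lmatrix_eq_iff sum_matrix_nth by (simp add: n_def sum_delta_const mat_def) (simp add: sum.distrib algebra_simps)
  show "(\<Sum>k\<in>UNIV. ?L k) = lblock (n * (u * x - z * y) * f11 h) 0 (n * (u * x - z * y) * f13 h)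
      0 (((z * y - u * x) * (fXU h - fYZ h + n * f22 h)) *\<^sub>R mat 1) 0
      0 0 (n * (u * x - z * y) * f33 h)"
    unfolding L lmatrix_eq_iff sum_matrix_nth by (simp add: n_def sum_delta_const mat_def) (simp add: sum.distrib algebra_simps)
qed

text \<open>
  Apart from nondegeneracy, regularity and the trace condition these are the equations found in
  \<open>normality_equations\<close>.
\<close>

definition normal_coeffs :: "coeffs \<Rightarrow> bool" where
  "normal_coeffs k \<longleftrightarrow> kdet k \<noteq> 0 \<and> k31 k = kdet k \<and> k11 k + n * k22 k + k33 k = 0 \<and>
     (n + 1) * (kdet k * k22 k) = - (k21Y k * k32Y k + c * k21X k * k32X k) \<and>
     k21X k * k12Y k - k21Y k * k12X k = k11 k \<and> k32Y k * k23X k - k32X k * k23Y k = k33 k \<and>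
     k12Y k * k23X k - k12X k * k23Y k = k13 k \<and>
     kdet k * (k32Y k * k12X k - k32X k * k12Y k) = - ((k32Y k)\<^sup>2 + c * (k32X k)\<^sup>2) \<and>
     kdet k * (k21X k * k23Y k - k21Y k * k23X k) = - ((k21Y k)\<^sup>2 + c * (k21X k)\<^sup>2)"

lemma normal_equation_blocks:
  assumes \<alpha>: "has_coeffs \<alpha> k" and adm: "admissible k" and w: "k31 k = kdet k" and W: "W \<in> alg_l"
  defines "h \<equiv> curv_coeffs k" and "a \<equiv> pre_a k W" and "X \<equiv> pre_X k W" and "Y \<equiv> pre_Y k W" and "D \<equiv> kdet k"
  shows "(\<Sum>(i, j)\<in>{(i, j). level j < level i}.
           kappa c I \<alpha> (bracket (matrix_unit j i) W) (matrix_unit i j)) =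
     lblock (- (2 * n * a * f11 h)) 0 (- (2 * n * a * f13 h))
      0 ((2 * a * (fXU h - fYZ h + n * f22 h)) *\<^sub>R mat 1) 0
      0 0 (- (2 * n * a * f33 h))" (is ?lhs)
  and "(\<Sum>(i, j)\<in>{(i, j). level j < level i}.
           bracket (matrix_unit j i) (kappa c I \<alpha> W (matrix_unit i j))) =
    lblock (- (n * a * ((f21P h * k32Y k - f21Q h * k32X k) / D)))
      (\<chi> l. I $ l $ l *
         (X $ l * (((1 - n) * k32Y k * fXZ h - k32X k * fXU h + n * k32X k * fYZ h - (f22 h + f11 h) * k32X k + f32P h) / D)
        + Y $ l * ((- n * k32Y k * fXU h + k32Y k * fYZ h - (1 - n) * k32X k * fYU h - (f22 h + f11 h) * k32Y k + f32Q h) / D)))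
      (- (n * a * ((f23P h * k32Y k - f23Q h * k32X k + f12P h * k21Y k - f12Q h * k21X k) / D)))
      0 ((a * ((f21P h * k32Y k - f21Q h * k32X k + f32P h * k21Y k - f32Q h * k21X k) / D)) *\<^sub>R mat 1)
      (\<chi> m. X $ m * ((- f33 h * k21X k + (n - 1) * k21Y k * fXZ h - n * k21X k * fXU h + k21X k * fYZ h - f22 h * k21X k - f21P h) / D)
           + Y $ m * ((- f33 h * k21Y k - k21Y k * fXU h + n * k21Y k * fYZ h - (n - 1) * k21X k * fYU h - f22 h * k21Y k - f21Q h) / D))
      0 0 (- (n * a * ((f32P h * k21Y k - f32Q h * k21X k) / D)))" (is ?rhs)
proof -
  have D: "D \<noteq> 0"
    using adm by (simp add: admissible_def D_def)
  have f31: "f31 h = 0"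
    by (simp add: h_def curv_coeffs_def w)
  note co = pre_matrix_unit[OF adm, folded D_def, unfolded w, folded D_def]
  have unit: "matrix_unit (LV m) L1 \<in> (alg_l :: 'n lmatrix set)" "matrix_unit L2 (LV m) \<in> (alg_l :: 'n lmatrix set)"
    "matrix_unit L2 L1 \<in> (alg_l :: 'n lmatrix set)" for m
    by (simp_all add: matrix_unit_alg_l)
  have kap: "kappa c I \<alpha> u v = form_block h (pre_a k u) (pre_X k u) (pre_Y k u) (pre_a k v) (pre_X k v) (pre_Y k v)"
    if "u \<in> alg_l" "v \<in> alg_l" for u v
    unfolding h_def by (rule kappa_coeffs[OF \<alpha> adm that])
  have \<tau>: "W $ L2 $ L1 = a * D"
    using D by (simp add: a_def pre_a_def w D_def)
  have br: "pre_a k (bracket (matrix_unit L1 (LV m)) W) = 0"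
     "pre_X k (bracket (matrix_unit L1 (LV m)) W) = (a * k21Y k * I $ m $ m) *\<^sub>R axis m 1"
     "pre_Y k (bracket (matrix_unit L1 (LV m)) W) = (- a * k21X k * I $ m $ m) *\<^sub>R axis m 1"
     "pre_a k (bracket (matrix_unit (LV m) L2) W) = 0"
     "pre_X k (bracket (matrix_unit (LV m) L2) W) = (a * k32Y k) *\<^sub>R axis m 1"
     "pre_Y k (bracket (matrix_unit (LV m) L2) W) = (- a * k32X k) *\<^sub>R axis m 1"
     "pre_a k (bracket (matrix_unit L1 L2) W) = 0" "pre_X k (bracket (matrix_unit L1 L2) W) = 0"
     "pre_Y k (bracket (matrix_unit L1 L2) W) = 0" for m
    using D by (auto simp: pre_a_def pre_X_def pre_Y_def bracket_unit_nth vec_eq_iff axis_def \<tau> D_def)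
  have zero: "form_block h 0 0 0 b Z U = 0" for b Z U
    by (simp add: form_block_def Let_def lmatrix_eq_iff)
  have Dk: "k21X k * k32Y k - k21Y k * k32X k = D"
    by (simp add: D_def kdet_def)
  have z: "((- a * k21X k) * (k32Y k / D) - (a * k21Y k) * (- k32X k / D)) = - a"
    "((- a * k32X k) * (- k21Y k / D) - (a * k32Y k) * (k21X k / D)) = - a"
    "(a * k21Y k) * (- k32X k / D) - (- a * k21X k) * (k32Y k / D) = a"
    "(a * k32Y k) * (k21X k / D) - (- a * k32X k) * (- k21Y k / D) = a"
    using D by (simp_all add: field_simps) (simp_all add: algebra_simps flip: Dk)
  show ?lhs
    unfolding sum_lower kap[OF bracket_alg_l unit(1)] kap[OF bracket_alg_l unit(2)] kap[OF bracket_alg_l unit(3)] br co zero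
      form_sum_dual[OF f31] z
    unfolding lmatrix_eq_iff by (simp add: mat_def)
  show ?rhs
    unfolding sum_lower kap[OF W unit(1)] kap[OF W unit(2)] kap[OF W unit(3)] co
      codiff_sum_left[OF f31] codiff_sum_right[OF f31] codiff_top[OF f31]
      a_def[symmetric] X_def[symmetric] Y_def[symmetric]
    unfolding lmatrix_eq_iff
    by (simp add: D mat_def field_simps)
qed

text \<open>
  Arbitrary coordinates occur, so the normality equation can be compared coefficient by coefficient.
\<close>

lemma pre_surj:
  assumes adm: "admissible k"
  obtains W where "W \<in> (alg_l :: 'n lmatrix set)" "pre_a k W = a" "pre_X k W = X" "pre_Y k W = Y"
proof
  let ?W = "lblock 0 0 0 (k21X k *\<^sub>R X + k21Y k *\<^sub>R Y) 0 0 (k31 k * a) (k32X k *\<^sub>R (X v* I) + k32Y k *\<^sub>R (Y v* I)) 0"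
  have D: "kdet k \<noteq> 0" and w: "k31 k \<noteq> 0"
    using adm by (auto simp: admissible_def)
  show "?W \<in> alg_l"
    by (simp add: alg_l_def trace_lblock) (simp add: trace_def)
  show "pre_a k ?W = a"
    using w by (simp add: pre_a_def)
  have e: "I $ i $ i * (k32X k * (I $ i $ i * X $ i) + k32Y k * (I $ i $ i * Y $ i)) = k32X k * X $ i + k32Y k * Y $ i" for i
    by (simp add: distrib_left I_sq mult.left_commute[of "I $ i $ i" "k32X k"] mult.left_commute[of "I $ i $ i" "k32Y k"])
  show "pre_X k ?W = X" "pre_Y k ?W = Y"
    using D by (simp_all add: pre_X_def pre_Y_def vec_eq_iff e field_simps) (simp_all add: kdet_def algebra_simps I_sq)
qed

lemma normal_iff:
  assumes \<alpha>: "has_coeffs \<alpha> k" and adm: "admissible k" and w: "k31 k = kdet k"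
  shows "normal c I \<alpha> \<longleftrightarrow> normal_coeffs k"
proof -
  define h where "h = curv_coeffs k"
  define D where "D = kdet k"
  have D: "D \<noteq> 0"
    using adm by (simp add: admissible_def D_def)
  have n: "n > 0"
    by (simp add: n_def)
  define X1 where "X1 = (1 - n) * k32Y k * fXZ h - k32X k * fXU h + n * k32X k * fYZ h - (f22 h + f11 h) * k32X k + f32P h"
  define Y1 where "Y1 = - n * k32Y k * fXU h + k32Y k * fYZ h - (1 - n) * k32X k * fYU h - (f22 h + f11 h) * k32Y k + f32Q h"
  define X3 where "X3 = - f33 h * k21X k + (n - 1) * k21Y k * fXZ h - n * k21X k * fXU h + k21X k * fYZ h - f22 h * k21X k - f21P h"
  define Y3 where "Y3 = - f33 h * k21Y k - k21Y k * fXU h + n * k21Y k * fYZ h - (n - 1) * k21X k * fYU h - f22 h * k21Y k - f21Q h"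
  define S where "S = f21P h * k32Y k - f21Q h * k32X k"
  define T where "T = f32P h * k21Y k - f32Q h * k21X k"
  define R where "R = f23P h * k32Y k - f23Q h * k32X k + f12P h * k21Y k - f12Q h * k21X k"
  have eqs: "normal c I \<alpha> \<longleftrightarrow> (\<forall>W\<in>alg_l.
     lblock (- (2 * n * pre_a k W * f11 h)) 0 (- (2 * n * pre_a k W * f13 h))
      0 ((2 * pre_a k W * (fXU h - fYZ h + n * f22 h)) *\<^sub>R mat 1) 0
      0 0 (- (2 * n * pre_a k W * f33 h)) =
     2 *\<^sub>R lblock (- (n * pre_a k W * (S / D)))
      (\<chi> l. I $ l $ l * (pre_X k W $ l * (X1 / D) + pre_Y k W $ l * (Y1 / D)))
      (- (n * pre_a k W * (R / D)))
      0 ((pre_a k W * ((S + T) / D)) *\<^sub>R mat 1)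
      (\<chi> m. pre_X k W $ m * (X3 / D) + pre_Y k W $ m * (Y3 / D))
      0 0 (- (n * pre_a k W * (T / D))))"
    unfolding normal_def
    by (rule ball_cong[OF refl], subst normal_equation_blocks(1)[OF \<alpha> adm w], assumption,
        subst normal_equation_blocks(2)[OF \<alpha> adm w], assumption,
        simp only: X1_def Y1_def X3_def Y3_def S_def T_def R_def add_diff_eq h_def D_def)
  have "normal c I \<alpha> \<longleftrightarrow> X1 = 0 \<and> Y1 = 0 \<and> X3 = 0 \<and> Y3 = 0 \<and> D * f11 h = S \<and> D * f33 h = T \<and>
      D * f13 h = R \<and> fXU h - fYZ h + n * f22 h = f11 h + f33 h"
  proof
    assume nrm: "normal c I \<alpha>"
    let ?e = "axis undefined 1 :: real ^ 'n"
    obtain W1 where W1: "W1 \<in> alg_l" "pre_a k W1 = 1" "pre_X k W1 = 0" "pre_Y k W1 = 0"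
      using pre_surj[OF adm] .
    obtain W2 where W2: "W2 \<in> alg_l" "pre_a k W2 = 0" "pre_X k W2 = ?e" "pre_Y k W2 = 0"
      using pre_surj[OF adm] .
    obtain W3 where W3: "W3 \<in> alg_l" "pre_a k W3 = 0" "pre_X k W3 = 0" "pre_Y k W3 = ?e"
      using pre_surj[OF adm] .
    note n1 = nrm[unfolded eqs, rule_format, OF W1(1), unfolded W1(2-4), unfolded lmatrix_eq_iff]
    note n2 = nrm[unfolded eqs, rule_format, OF W2(1), unfolded W2(2-4), unfolded lmatrix_eq_iff]
    note n3 = nrm[unfolded eqs, rule_format, OF W3(1), unfolded W3(2-4), unfolded lmatrix_eq_iff]
    have "f11 h = S / D" "f13 h = R / D" "f33 h = T / D"
      using n1 n D by (auto simp: field_simps)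
    moreover have "fXU h - fYZ h + n * f22 h = (S + T) / D"
      using n1[THEN conjunct2, THEN conjunct2, THEN conjunct2, THEN conjunct2, THEN conjunct1,
        rule_format, of undefined undefined] D by (simp add: mat_def field_simps)
    moreover have "X1 = 0" "X3 = 0"
      using n2 D I_nz by (auto simp: axis_def split: if_splits)
    moreover have "Y1 = 0" "Y3 = 0"
      using n3 D I_nz by (auto simp: axis_def split: if_splits)
    ultimately show "X1 = 0 \<and> Y1 = 0 \<and> X3 = 0 \<and> Y3 = 0 \<and> D * f11 h = S \<and> D * f33 h = T \<and>
      D * f13 h = R \<and> fXU h - fYZ h + n * f22 h = f11 h + f33 h"
      using D by (simp add: add_divide_distrib)
  next
    assume e: "X1 = 0 \<and> Y1 = 0 \<and> X3 = 0 \<and> Y3 = 0 \<and> D * f11 h = S \<and> D * f33 h = T \<and>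
      D * f13 h = R \<and> fXU h - fYZ h + n * f22 h = f11 h + f33 h"
    then have "S / D = f11 h" "T / D = f33 h" "R / D = f13 h" "(S + T) / D = fXU h - fYZ h + n * f22 h"
      using D by (auto simp: field_simps)
    then show "normal c I \<alpha>"
      unfolding eqs using e by (simp add: lmatrix_eq_iff)
  qed
  also have "\<dots> \<longleftrightarrow> normal_coeffs k"
  proof -
    have tr: "k11 k + n * k22 k + k33 k = 0"
      using adm by (simp add: admissible_def)
    note N = normality_equations[of "kdet k" "k21X k" "k32Y k" "k21Y k" "k32X k" n "k11 k" "k22 k" "k33 k"
        "k12X k" "k23X k" "k12Y k" "k23Y k" c "k13 k", OF kdet_def _ n tr]
    show ?thesis
      unfolding X1_def Y1_def X3_def Y3_def S_def T_def R_def h_def curv_coeffs_def form_coeffs.simps normal_coeffs_def w D_def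
      using N D tr by (auto simp: D_def w)
  qed
  finally show ?thesis .
qed

end

section \<open>Equivalence by constant translations\<close>

text \<open>
  Two solutions of the normality equations, the primed one and the other one, whose \<open>b\<^sub>1, \<dots>, b\<^sub>4\<close> are related
  by the plane isometry with columns \<open>(u, v)\<close> and \<open>(- c \<delta> v, \<delta> u)\<close> and by the scalings \<open>\<mu>\<close> and \<open>\<nu>\<close>. The conclusions,
  together with these relations, are the entries of \<open>\<alpha>'(h\<^sub>0\<^sup>-\<^sup>1 \<xi> h\<^sub>0) p\<^sub>0 = p\<^sub>0 \<alpha>(\<xi>)\<close>. The corner \<open>\<zeta>\<close> is chosen to match the first diagonal entries.
  Everything else follows since the right hand sides of the normality equations are built from \<open>D\<close> and the values of
  the form \<open>diag(1, c)\<close> on \<open>(b\<^sub>1, b\<^sub>2)\<close> and \<open>(b\<^sub>3, b\<^sub>4)\<close>, which are preserved up to explicit factors.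
\<close>

lemma gauge_equations:
  fixes x y e z b1 b2 b3 b4 r1 r2 c1 c2 D x' y' e' z' b1' b2' b3' b4' r1' r2' c1' c2' D' :: real
    and c n u v \<delta> \<mu> \<nu> :: real
  assumes D: "D = b1 * b4 - b2 * b3" "D \<noteq> 0" and D': "D' = b1' * b4' - b2' * b3'" "D' \<noteq> 0"
    and n: "n > 0" and tr: "x + n * e + y = 0" "x' + n * e' + y' = 0"
    and e: "(n + 1) * (D * e) = - (b2 * b4 + c * b1 * b3)" "(n + 1) * (D' * e') = - (b2' * b4' + c * b1' * b3')"
    and x: "b1 * r2 - b2 * r1 = x" "b1' * r2' - b2' * r1' = x'"
    and y: "b4 * c1 - b3 * c2 = y" "b4' * c1' - b3' * c2' = y'"
    and z: "r2 * c1 - r1 * c2 = z" "r2' * c1' - r1' * c2' = z'"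
    and G: "D * (b4 * r1 - b3 * r2) = - (b4\<^sup>2 + c * b3\<^sup>2)" "D' * (b4' * r1' - b3' * r2') = - (b4'\<^sup>2 + c * b3'\<^sup>2)"
    and H: "D * (b1 * c2 - b2 * c1) = - (b2\<^sup>2 + c * b1\<^sup>2)" "D' * (b1' * c2' - b2' * c1') = - (b2'\<^sup>2 + c * b1'\<^sup>2)"
    and c: "c * c = 1" and uv: "u\<^sup>2 + c * v\<^sup>2 = 1" and \<delta>: "\<delta> * \<delta> = 1" and \<mu>: "\<mu> \<noteq> 0" and \<nu>: "\<nu> \<noteq> 0"
    and b: "b1 = \<mu> * (b1' * u - c * \<delta> * v * b2')" "b2 = \<mu> * (b1' * v + \<delta> * u * b2')"
      "\<nu> * b3 = b3' * u - c * \<delta> * v * b4'" "\<nu> * b4 = b3' * v + \<delta> * u * b4'"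
  defines "\<zeta> \<equiv> \<mu> * (\<delta> * x' - x) / D"
  shows "\<mu> * (\<delta> * x') = \<mu> * x + \<zeta> * D" "\<delta> * e' = e"
    "r1' * u - c * \<delta> * v * r2' = \<mu> * r1 + \<zeta> * b3" "r1' * v + \<delta> * u * r2' = \<mu> * r2 + \<zeta> * b4"
    "\<zeta> * (\<delta> * x') + \<nu> * (\<delta> * z') = \<mu> * z + \<zeta> * y"
    "\<zeta> * (b1' * u - c * \<delta> * v * b2') + \<nu> * (c1' * u - c * \<delta> * v * c2') = c1"
    "\<zeta> * (b1' * v + \<delta> * u * b2') + \<nu> * (c1' * v + \<delta> * u * c2') = c2"
    "\<mu> * (\<delta> * D') = \<nu> * D" "\<zeta> * (\<delta> * D') + \<nu> * (\<delta> * y') = \<nu> * y"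
proof -
  define G0 G1 H0 H1 where "G0 = b4 * r1 - b3 * r2" and "G1 = b4' * r1' - b3' * r2'"
    and "H0 = b1 * c2 - b2 * c1" and "H1 = b1' * c2' - b2' * c1'"
  have \<delta>\<delta>: "\<delta> * (\<delta> * t) = t" for t
    using \<delta> by (simp flip: mult.assoc)
  have cc: "c * (c * t) = t" for t
    using c by (simp flip: mult.assoc)
  have u2: "u * u = 1 - c * (v * v)"
    using uv by (simp add: power2_eq_square algebra_simps)
  have uu: "u * (u * t) = t - c * (v * (v * t))" for t
    using arg_cong[OF u2, of "\<lambda>s. s * t"] by (simp add: algebra_simps)
  have \<nu>D: "\<nu> * D = \<mu> * (\<delta> * D')"
  proof -
    have "\<nu> * D = b1 * (\<nu> * b4) - b2 * (\<nu> * b3)"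
      by (simp add: D algebra_simps)
    also have "\<dots> = \<mu> * (\<delta> * D')"
      unfolding b D' by (simp add: algebra_simps \<delta>\<delta> cc u2 uu)
    finally show ?thesis .
  qed
  have W: "\<nu> * (b2 * b4 + c * b1 * b3) = \<mu> * (b2' * b4' + c * b1' * b3')"
  proof -
    have "\<nu> * (b2 * b4 + c * b1 * b3) = b2 * (\<nu> * b4) + c * b1 * (\<nu> * b3)"
      by (simp add: algebra_simps)
    also have "\<dots> = \<mu> * (b2' * b4' + c * b1' * b3')"
      unfolding b by (simp add: algebra_simps \<delta>\<delta> cc u2 uu)
    finally show ?thesis .
  qed
  have N3: "\<nu>\<^sup>2 * (b4\<^sup>2 + c * b3\<^sup>2) = b4'\<^sup>2 + c * b3'\<^sup>2"
  proof -
    have "\<nu>\<^sup>2 * (b4\<^sup>2 + c * b3\<^sup>2) = (\<nu> * b4) * (\<nu> * b4) + c * ((\<nu> * b3) * (\<nu> * b3))"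
      by (simp add: power2_eq_square algebra_simps)
    also have "\<dots> = b4'\<^sup>2 + c * b3'\<^sup>2"
      unfolding b by (simp add: power2_eq_square algebra_simps \<delta> \<delta>\<delta> c cc u2 uu)
    finally show ?thesis .
  qed
  have N1: "b2\<^sup>2 + c * b1\<^sup>2 = \<mu>\<^sup>2 * (b2'\<^sup>2 + c * b1'\<^sup>2)"
    unfolding b by (simp add: power2_eq_square algebra_simps \<delta> \<delta>\<delta> c cc u2 uu)
  have D'eq: "\<mu> * D' = \<nu> * \<delta> * D"
    using \<nu>D by (simp add: mult.left_commute[of \<nu>] \<delta>\<delta> mult.assoc)
  show *: "\<mu> * (\<delta> * D') = \<nu> * D"
    using \<nu>D by simp
  show e': "\<delta> * e' = e"
  proof -
    have "\<nu> * ((n + 1) * (D * e)) = \<mu> * ((n + 1) * (D' * e'))"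
      unfolding e by (simp only: mult_minus_right W)
    moreover have "\<nu> * ((n + 1) * (D * e)) = (n + 1) * (\<nu> * D * e)"
      by simp
    ultimately have "(n + 1) * \<mu> * D' * (\<delta> * e) = (n + 1) * \<mu> * D' * e'"
      unfolding \<nu>D by (simp add: algebra_simps)
    then have "\<delta> * e = e'"
      using n \<mu> D'(2) by simp
    then show ?thesis
      using \<delta>\<delta>[of e] by simp
  qed
  have xy: "\<delta> * (x' + y') = x + y"
  proof -
    have "x' + y' = - n * e'" "x + y = - n * e"
      using tr by auto
    then show ?thesis
      using e' by (simp add: mult.left_commute)
  qed
  have Gq: "G1 = \<nu> * \<mu> * \<delta> * G0"
  proof -
    have "D' * G1 = \<nu>\<^sup>2 * (D * G0)"
      unfolding G0_def G1_def G by (simp only: mult_minus_right N3)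
    also have "\<dots> = \<nu> * (\<nu> * D) * G0"
      by (simp add: power2_eq_square)
    also have "\<dots> = D' * (\<nu> * \<mu> * \<delta> * G0)"
      unfolding \<nu>D by (simp add: algebra_simps)
    finally show ?thesis
      using D'(2) by simp
  qed
  have Hq: "H0 = \<nu> * \<mu> * \<delta> * H1"
  proof -
    have "D * H0 = \<mu>\<^sup>2 * (D' * H1)"
      unfolding H0_def H1_def H by (simp only: mult_minus_right N1)
    also have "\<dots> = \<mu> * (\<mu> * D') * H1"
      by (simp add: power2_eq_square)
    also have "\<dots> = D * (\<nu> * \<mu> * \<delta> * H1)"
      unfolding D'eq by (simp add: algebra_simps)
    finally show ?thesis
      using D(2) by simp
  qed
  have Dr: "D * r1 = b3 * x + b1 * G0" "D * r2 = b4 * x + b2 * G0"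
    "D' * r1' = b3' * x' + b1' * G1" "D' * r2' = b4' * x' + b2' * G1"
    unfolding x[symmetric] G0_def G1_def D D' by (simp_all add: algebra_simps)
  have Dc: "D * c1 = b1 * y + b3 * H0" "D * c2 = b2 * y + b4 * H0"
    "D' * c1' = b1' * y' + b3' * H1" "D' * c2' = b2' * y' + b4' * H1"
    unfolding y[symmetric] H0_def H1_def D D' by (simp_all add: algebra_simps)
  have Dz: "D * z = x * y - G0 * H0" "D' * z' = x' * y' - G1 * H1"
    unfolding x[symmetric] y[symmetric] z[symmetric] G0_def G1_def H0_def H1_def D D' by (simp_all add: algebra_simps)
  have \<zeta>D: "\<zeta> * D = \<mu> * (\<delta> * x' - x)"
    using D(2) by (simp add: \<zeta>_def)
  show "\<mu> * (\<delta> * x') = \<mu> * x + \<zeta> * D"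
    unfolding \<zeta>D by (simp add: algebra_simps)
  have b': "b1' * u - c * \<delta> * v * b2' = b1 / \<mu>" "b1' * v + \<delta> * u * b2' = b2 / \<mu>"
    using \<mu> by (simp_all add: b)
  have row: "r = \<mu> * \<rho> + \<zeta> * \<beta>3"
    if "D' * r = x' * (\<nu> * \<beta>3) + G1 * (\<beta>1 / \<mu>)" "D * \<rho> = \<beta>3 * x + \<beta>1 * G0" for r \<rho> \<beta>1 \<beta>3
  proof -
    have "\<mu> * D' * r = \<mu> * (D' * r)"
      by simp
    also have "\<dots> = \<nu> * \<delta> * (\<mu> * (\<delta> * x' * \<beta>3 + \<beta>1 * G0))"
      unfolding that(1) Gq using \<mu> by (simp add: field_simps \<delta>\<delta>)
    also have "\<dots> = \<nu> * \<delta> * (\<mu> * (D * \<rho>) + \<zeta> * D * \<beta>3)"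
      unfolding that(2) \<zeta>D by (simp add: algebra_simps)
    also have "\<dots> = \<mu> * D' * (\<mu> * \<rho> + \<zeta> * \<beta>3)"
      unfolding D'eq by (simp add: algebra_simps)
    finally show ?thesis
      using \<mu> D'(2) by simp
  qed
  show "r1' * u - c * \<delta> * v * r2' = \<mu> * r1 + \<zeta> * b3"
  proof (rule row[OF _ Dr(1)])
    have "D' * (r1' * u - c * \<delta> * v * r2') = (D' * r1') * u - c * \<delta> * v * (D' * r2')"
      by (simp add: algebra_simps)
    also have "\<dots> = x' * (\<nu> * b3) + G1 * (b1 / \<mu>)"
      unfolding Dr b(3,4) b'[symmetric] by (simp add: algebra_simps)
    finally show "D' * (r1' * u - c * \<delta> * v * r2') = x' * (\<nu> * b3) + G1 * (b1 / \<mu>)" .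
  qed
  show "r1' * v + \<delta> * u * r2' = \<mu> * r2 + \<zeta> * b4"
  proof (rule row[OF _ Dr(2)])
    have "D' * (r1' * v + \<delta> * u * r2') = (D' * r1') * v + \<delta> * u * (D' * r2')"
      by (simp add: algebra_simps)
    also have "\<dots> = x' * (\<nu> * b4) + G1 * (b2 / \<mu>)"
      unfolding Dr b(3,4) b'[symmetric] by (simp add: algebra_simps)
    finally show "D' * (r1' * v + \<delta> * u * r2') = x' * (\<nu> * b4) + G1 * (b2 / \<mu>)" .
  qed
  have col: "\<zeta> * (\<beta>1 / \<mu>) + \<nu> * r = \<gamma>"
    if "D' * r = y' * (\<beta>1 / \<mu>) + H1 * (\<nu> * \<beta>3)" "D * \<gamma> = \<beta>1 * y + \<beta>3 * H0" for r \<gamma> \<beta>1 \<beta>3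
  proof -
    have "\<mu> * (D * (\<zeta> * (\<beta>1 / \<mu>) + \<nu> * r)) = \<zeta> * D * \<beta>1 + \<mu> * (\<nu> * D) * r"
      using \<mu> by (simp add: algebra_simps)
    also have "\<dots> = \<mu> * ((\<delta> * x' - x) * \<beta>1 + \<mu> * \<delta> * (D' * r))"
      unfolding \<nu>D \<zeta>D by (simp add: algebra_simps)
    also have "\<dots> = \<mu> * ((\<delta> * (x' + y') - x) * \<beta>1 + \<beta>3 * (\<nu> * \<mu> * \<delta> * H1))"
      unfolding that(1) using \<mu> by (simp add: algebra_simps)
    also have "\<dots> = \<mu> * (D * \<gamma>)"
      unfolding that(2) xy Hq by simp
    finally show ?thesis
      using \<mu> D(2) by simp
  qed
  show "\<zeta> * (b1' * u - c * \<delta> * v * b2') + \<nu> * (c1' * u - c * \<delta> * v * c2') = c1"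
    unfolding b'
  proof (rule col[OF _ Dc(1)])
    have "D' * (c1' * u - c * \<delta> * v * c2') = (D' * c1') * u - c * \<delta> * v * (D' * c2')"
      by (simp add: algebra_simps)
    also have "\<dots> = y' * (b1 / \<mu>) + H1 * (\<nu> * b3)"
      unfolding Dc b(3,4) b'[symmetric] by (simp add: algebra_simps)
    finally show "D' * (c1' * u - c * \<delta> * v * c2') = y' * (b1 / \<mu>) + H1 * (\<nu> * b3)" .
  qed
  show "\<zeta> * (b1' * v + \<delta> * u * b2') + \<nu> * (c1' * v + \<delta> * u * c2') = c2"
    unfolding b'
  proof (rule col[OF _ Dc(2)])
    have "D' * (c1' * v + \<delta> * u * c2') = (D' * c1') * v + \<delta> * u * (D' * c2')"
      by (simp add: algebra_simps)
    also have "\<dots> = y' * (b2 / \<mu>) + H1 * (\<nu> * b4)"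
      unfolding Dc b(3,4) b'[symmetric] by (simp add: algebra_simps)
    finally show "D' * (c1' * v + \<delta> * u * c2') = y' * (b2 / \<mu>) + H1 * (\<nu> * b4)" .
  qed
  show "\<zeta> * (\<delta> * D') + \<nu> * (\<delta> * y') = \<nu> * y"
  proof -
    have "\<mu> * (\<zeta> * (\<delta> * D') + \<nu> * (\<delta> * y')) = \<nu> * (\<zeta> * D) + \<mu> * \<nu> * (\<delta> * y')"
      using * by (simp add: algebra_simps)
    also have "\<dots> = \<mu> * (\<nu> * (\<delta> * (x' + y') - x))"
      unfolding \<zeta>D by (simp add: algebra_simps)
    finally show ?thesis
      unfolding xy using \<mu> by simp
  qed
  show "\<zeta> * (\<delta> * x') + \<nu> * (\<delta> * z') = \<mu> * z + \<zeta> * y"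
  proof -
    have GH: "G1 * H1 = G0 * H0"
      unfolding Gq Hq by simp
    have y'': "y = \<delta> * (x' + y') - x"
      using xy by simp
    have "D * (\<zeta> * (\<delta> * x') + \<nu> * (\<delta> * z')) = \<zeta> * D * (\<delta> * x') + \<nu> * D * (\<delta> * z')"
      by (simp add: algebra_simps)
    also have "\<dots> = \<mu> * ((\<delta> * x' - x) * (\<delta> * x') + D' * z')"
      unfolding \<zeta>D \<nu>D by (simp add: algebra_simps \<delta>\<delta>)
    also have "\<dots> = \<mu> * (D * z + (\<delta> * x' - x) * y)"
      unfolding Dz GH y'' by (simp add: algebra_simps \<delta>\<delta>)
    also have "\<dots> = \<mu> * (D * z) + \<zeta> * D * y"
      unfolding \<zeta>D by (simp add: algebra_simps)
    also have "\<dots> = D * (\<mu> * z + \<zeta> * y)"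
      by (simp add: algebra_simps)
    finally show ?thesis
      using D(2) by simp
  qed
qed

lemma matrix_inv_works:
  fixes A :: "real ^ 'm ^ ('m::finite)"
  assumes "invertible A"
  shows "A ** matrix_inv A = mat 1" "matrix_inv A ** A = mat 1" "invertible (matrix_inv A)" "matrix_inv (matrix_inv A) = A"
proof -
  obtain B where B: "A ** B = mat 1" "B ** A = mat 1"
    using assms unfolding invertible_def by blast
  have "matrix_inv A = B"
    by (rule matrix_inv_eqI[OF B(1)])
  with B show "A ** matrix_inv A = mat 1" "matrix_inv A ** A = mat 1" "invertible (matrix_inv A)" "matrix_inv (matrix_inv A) = A"
    using matrix_inv_eqI[OF B(2)] by simp_all
qed

lemma matrix_inv_mult:
  fixes A B :: "real ^ 'm ^ ('m::finite)"
  assumes "invertible A" "invertible B"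
  shows "matrix_inv (A ** B) = matrix_inv B ** matrix_inv A" "invertible (A ** B)"
proof -
  have "(A ** B) ** (matrix_inv B ** matrix_inv A) = A ** (B ** matrix_inv B) ** matrix_inv A"
    by (simp add: matrix_mul_assoc)
  then have "(A ** B) ** (matrix_inv B ** matrix_inv A) = mat 1"
    by (simp add: matrix_inv_works assms)
  then show "matrix_inv (A ** B) = matrix_inv B ** matrix_inv A" "invertible (A ** B)"
    by (rule matrix_inv_eqI)+
qed

lemma grpP_mult:
  assumes "p \<in> grpP" "r \<in> grpP"
  shows "p ** r \<in> (grpP :: ('n::finite) lmatrix set)"
proof -
  have "level i \<le> level j" if "(p ** r) $ i $ j \<noteq> 0" for i j
  proof -
    have "(\<Sum>k\<in>UNIV. p $ i $ k * r $ k $ j) \<noteq> 0"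
      using that by (simp add: matrix_matrix_mult_def)
    then obtain k where "p $ i $ k * r $ k $ j \<noteq> 0"
      by (meson sum.neutral)
    then have "level i \<le> level k" "level k \<le> level j"
      using assms by (auto simp: grpP_def upper_block_def)
    then show ?thesis by simp
  qed
  then show ?thesis
    using assms matrix_inv_mult(2) by (auto simp: grpP_def upper_block_def)
qed

lemma Ck_on_const: "Ck_on m S (\<lambda>x. a)"
  by (induction m arbitrary: a) (simp_all add: frechet_derivative_const)

text \<open>
  The translations used below are restrictions of linear maps of pairs of matrices, which makes their smoothness
  immediate.
\<close>

lemma smooth_on_linear:
  fixes f :: "'a::euclidean_space \<Rightarrow> 'b::real_normed_vector"
  assumes "linear f"
  shows "smooth_on S f"
proof -
  have bl: "bounded_linear f"
    using assms by (simp add: linear_conv_bounded_linear)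
  have fd: "frechet_derivative f (at x) = f" for x
    using bounded_linear_imp_has_derivative[OF bl] by (metis frechet_derivative_at)
  have "Ck_on m S f" for m
  proof (cases m)
    case 0
    then show ?thesis
      using bl by (simp add: linear_continuous_on)
  next
    case (Suc m)
    then show ?thesis
      using bl by (simp add: fd Ck_on_const bounded_linear_imp_differentiable)
  qed
  then show ?thesis
    by (simp add: smooth_on_def)
qed

lemma matrix_scaleR_mult:
  fixes M N :: "real ^ 'm ^ ('m::finite)"
  shows "M ** (s *\<^sub>R N) = s *\<^sub>R (M ** N)" "(s *\<^sub>R M) ** N = s *\<^sub>R (M ** N)"
  by (simp_all add: matrix_scalar_ac scalar_matrix_assoc)

context signature_form
begin

lemma gram_invertible: "gram c I ** gram c I = mat 1"
  by (simp add: gram_def gblock_mult I_I c_sq gblock_one)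

lemma grpG_invertible:
  assumes "g \<in> grpG c I" shows "invertible g"
proof -
  have "(gram c I ** transpose g ** gram c I) ** g = gram c I ** (transpose g ** gram c I ** g)"
    by (simp add: matrix_mul_assoc)
  also have "\<dots> = mat 1"
    using assms by (simp add: grpG_def gram_invertible)
  finally show ?thesis
    by (metis invertible_def matrix_left_right_inverse)
qed

lemma grpG_mult:
  assumes "g \<in> grpG c I" "h \<in> grpG c I" shows "g ** h \<in> grpG c I"
proof -
  have "transpose (g ** h) ** gram c I ** (g ** h) = transpose h ** (transpose g ** gram c I ** g) ** h"
    by (simp add: matrix_transpose_mul matrix_mul_assoc)
  then show ?thesis
    using assms by (simp add: grpG_def)
qed

text \<open>
  The map \<open>(g, p) \<mapsto> (g h\<^sub>0, p\<^sub>0 p)\<close> is compatible with the relation defining \<open>G \<times>\<^sub>i P\<close>, because \<open>h\<^sub>0\<close> and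
  \<open>p\<^sub>0\<close> commute with \<open>K\<close> and \<open>i(K)\<close>, and with the right action of \<open>P\<close>. It pulls \<open>\<omega>\<^bsub>\<alpha>'\<^esub>\<close> back to the form belonging to
  \<open>Ad(p\<^sub>0\<^sup>-\<^sup>1) \<circ> \<alpha>' \<circ> Ad(h\<^sub>0\<^sup>-\<^sup>1)\<close>.
\<close>

lemma equivalent_by_translation:
  fixes \<alpha> \<alpha>' :: "'n gmatrix \<Rightarrow> 'n lmatrix"
  assumes h0: "h0 \<in> grpG c I" and p0: "p0 \<in> grpP"
    and comm_h0: "\<And>g. g \<in> grpK I \<Longrightarrow> h0 ** g = g ** h0"
    and comm_p0: "\<And>g. g \<in> grpK I \<Longrightarrow> p0 ** hom_i g = hom_i g ** p0"
    and inter: "\<And>\<xi>. \<xi> \<in> algG c I \<Longrightarrow> \<alpha>' (matrix_inv h0 ** \<xi> ** h0) ** p0 = p0 ** \<alpha> \<xi>"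
  shows "equivalent c I \<alpha> \<alpha>'"
proof -
  define F :: "'n gmatrix \<times> 'n lmatrix \<Rightarrow> 'n gmatrix \<times> 'n lmatrix" where
    "F = (\<lambda>(g, p). (g ** h0, p0 ** p))"
  define \<Phi> where "\<Phi> = (`) F"
  have inv: "invertible h0" "invertible p0"
    using grpG_invertible[OF h0] p0 by (auto simp: grpP_def)
  have F_in: "F z \<in> prodGP c I" if "z \<in> prodGP c I" for z
    using that grpG_mult[OF _ h0] grpP_mult[OF p0] by (auto simp: F_def prodGP_def)
  have comm_inv: "p0 ** matrix_inv (hom_i g) = matrix_inv (hom_i g) ** p0" if "g \<in> grpK I" for g
  proof -
    have i: "invertible (hom_i g)"
      using that K_elem_inverse(4) by (auto simp: grpK_iff)
    have "matrix_inv (hom_i g) ** (p0 ** hom_i g) ** matrix_inv (hom_i g)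
      = matrix_inv (hom_i g) ** (hom_i g ** p0) ** matrix_inv (hom_i g)"
      by (simp add: comm_p0[OF that])
    then have "matrix_inv (hom_i g) ** p0 ** (hom_i g ** matrix_inv (hom_i g))
      = (matrix_inv (hom_i g) ** hom_i g) ** p0 ** matrix_inv (hom_i g)"
      by (simp only: matrix_mul_assoc)
    then show ?thesis
      by (simp add: matrix_inv_works[OF i])
  qed
  have proj: "\<Phi> (proj c I z) = proj c I (F z)" if z: "z \<in> prodGP c I" for z
  proof -
    obtain g p where gp: "z = (g, p)" "g \<in> grpG c I" "p \<in> grpP"
      using z by (auto simp: prodGP_def)
    have e: "F (g ** k, s *\<^sub>R (matrix_inv (hom_i k) ** p)) = (g ** h0 ** k, s *\<^sub>R (matrix_inv (hom_i k) ** (p0 ** p)))"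
      if "k \<in> grpK I" for k s
    proof -
      have "p0 ** (matrix_inv (hom_i k) ** p) = matrix_inv (hom_i k) ** (p0 ** p)"
        by (simp add: matrix_mul_assoc comm_inv[OF that])
      moreover have "g ** k ** h0 = g ** h0 ** k"
        using comm_h0[OF that] by (simp flip: matrix_mul_assoc)
      ultimately show ?thesis
        by (simp add: F_def matrix_scaleR_mult)
    qed
    have P: "proj c I (g, p) = {(g ** k, s *\<^sub>R (matrix_inv (hom_i k) ** p)) | k s. k \<in> grpK I \<and> s \<noteq> 0}"
      if "(g, p) \<in> prodGP c I" for g p
      using that by (auto simp: proj_def bundle_rel_def)
    have "\<Phi> (proj c I z) = {F (g ** k, s *\<^sub>R (matrix_inv (hom_i k) ** p)) | k s. k \<in> grpK I \<and> s \<noteq> 0}"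
      unfolding gp(1) P[OF z[unfolded gp(1)]] \<Phi>_def by blast
    also have "\<dots> = {(g ** h0 ** k, s *\<^sub>R (matrix_inv (hom_i k) ** (p0 ** p))) | k s. k \<in> grpK I \<and> s \<noteq> 0}"
      using e by (metis (no_types, lifting))
    also have "\<dots> = proj c I (F z)"
      using P F_in[OF z] by (simp add: gp F_def)
    finally show ?thesis .
  qed
  have lin: "linear F"
    by (rule linearI) (auto simp: F_def matrix_add_ldistrib matrix_scaleR_mult matrix_mult_add_left split_def)
  have fd: "frechet_derivative F (at z) = F" for z
    using lin unfolding linear_conv_bounded_linear
    by (metis bounded_linear_imp_has_derivative frechet_derivative_at)
  have lift: "local_lift c I \<Phi> UNIV F"
    using F_in proj smooth_on_linear[OF lin] by (simp add: local_lift_def)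
  have "bundle_morphism c I \<Phi>"
    unfolding bundle_morphism_def
  proof (intro conjI ballI)
    show "\<Phi> ` assoc_bundle c I \<subseteq> assoc_bundle c I"
    proof
      fix e assume "e \<in> \<Phi> ` assoc_bundle c I"
      then obtain z where z: "z \<in> prodGP c I" "e = \<Phi> (proj c I z)"
        by (auto simp: assoc_bundle_def quotient_def proj_def)
      then have "e = bundle_rel c I `` {F z}"
        using proj[OF z(1)] by (simp add: proj_def)
      then show "e \<in> assoc_bundle c I"
        using F_in[OF z(1)] unfolding assoc_bundle_def quotient_def by blast
    qed
    show "\<Phi> (right_act e r) = right_act (\<Phi> e) r" for e r
      by (auto simp: \<Phi>_def right_act_def F_def image_image split_def matrix_mul_assoc)
    show "\<exists>V F. z \<in> V \<and> local_lift c I \<Phi> V F" for z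
      using lift by blast
  qed
  moreover have "pulls_back c I \<Phi> \<alpha>' \<alpha>"
    unfolding pulls_back_def
  proof (intro ballI exI conjI)
    fix z assume z: "z \<in> prodGP c I"
    show "z \<in> UNIV" "local_lift c I \<Phi> UNIV F"
      using lift by simp_all
    fix w assume w: "w \<in> tangent c I z"
    obtain g p where gp: "z = (g, p)" "g \<in> grpG c I" "p \<in> grpP"
      using z by (auto simp: prodGP_def)
    obtain \<xi> \<eta> where \<xi>: "w = (g ** \<xi>, p ** \<eta>)" "\<xi> \<in> algG c I"
      using w by (auto simp: tangent_def gp)
    have ig: "invertible g" and ip: "invertible p"
      using grpG_invertible[OF gp(2)] gp(3) by (auto simp: grpP_def)
    have "matrix_inv (g ** h0) ** (g ** \<xi> ** h0) = matrix_inv h0 ** (matrix_inv g ** g) ** \<xi> ** h0"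
      by (simp add: matrix_inv_mult[OF ig inv(1)] matrix_mul_assoc)
    then have 1: "matrix_inv (g ** h0) ** (g ** \<xi> ** h0) = matrix_inv h0 ** \<xi> ** h0"
      by (simp add: matrix_inv_works(2)[OF ig])
    have "matrix_inv (p0 ** p) ** (p0 ** (p ** \<eta>)) = matrix_inv p ** (matrix_inv p0 ** p0) ** p ** \<eta>"
      by (simp add: matrix_inv_mult[OF inv(2) ip] matrix_mul_assoc)
    then have 2: "matrix_inv (p0 ** p) ** (p0 ** (p ** \<eta>)) = \<eta>"
      by (simp add: matrix_inv_works[OF ip] matrix_inv_works[OF inv(2)])
    have 3: "matrix_inv g ** (g ** \<xi>) = \<xi>" "matrix_inv p ** (p ** \<eta>) = \<eta>"
      by (simp_all add: matrix_mul_assoc matrix_inv_works[OF ig] matrix_inv_works[OF ip])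
    have i2: "invertible (p0 ** p)"
      by (rule matrix_inv_mult(2)[OF inv(2) ip])
    have "Ad (matrix_inv (p0 ** p)) (\<alpha>' (matrix_inv h0 ** \<xi> ** h0))
      = matrix_inv p ** matrix_inv p0 ** (\<alpha>' (matrix_inv h0 ** \<xi> ** h0) ** p0) ** p"
      unfolding Ad_def matrix_inv_works(4)[OF i2] by (simp add: matrix_inv_mult(1)[OF inv(2) ip] matrix_mul_assoc)
    also have "\<dots> = matrix_inv p ** (matrix_inv p0 ** p0) ** \<alpha> \<xi> ** p"
      unfolding inter[OF \<xi>(2)] by (simp add: matrix_mul_assoc)
    also have "\<dots> = Ad (matrix_inv p) (\<alpha> \<xi>)"
      by (simp add: Ad_def matrix_inv_works[OF ip] matrix_inv_works[OF inv(2)])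
    finally show "omega \<alpha>' (F z) (frechet_derivative F (at z) w) = omega \<alpha> z w"
      unfolding fd by (simp add: omega_def F_def gp(1) \<xi>(1) 1 2 3)
  qed
  ultimately show ?thesis
    unfolding equivalent_def by blast
qed

text \<open>
  For \<open>u\<^sup>2 + c v\<^sup>2 = 1\<close> and \<open>\<delta> = \<plusminus>1\<close> these are the isometries of \<open>diag(1, c)\<close>, acting on the first two
  coordinates: \<open>O(2)\<close> for \<open>c = 1\<close> and \<open>O(1, 1)\<close> for \<open>c = - 1\<close>. The determinant is \<open>\<delta>\<close>.
\<close>

definition plane_isometry :: "real \<Rightarrow> real \<Rightarrow> real \<Rightarrow> 'n gmatrix" where
  "plane_isometry u v \<delta> = gblock u (- c * \<delta> * v) 0 v (\<delta> * u) 0 0 0 (mat 1)"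

lemma plane_isometry_properties:
  assumes uv: "u\<^sup>2 + c * v\<^sup>2 = 1" and \<delta>: "\<delta> * \<delta> = 1"
  shows "plane_isometry u v \<delta> \<in> grpG c I"
    "matrix_inv (plane_isometry u v \<delta>) = gblock u (c * v) 0 (- \<delta> * v) (\<delta> * u) 0 0 0 (mat 1)"
    "matrix_inv (plane_isometry u v \<delta>) ** gmat c I a X Y A ** plane_isometry u v \<delta> =
       gmat c I (\<delta> * a) (u *\<^sub>R X + v *\<^sub>R Y) ((- c * \<delta> * v) *\<^sub>R X + (\<delta> * u) *\<^sub>R Y) A"
proof -
  have \<delta>\<delta>: "\<delta> * (\<delta> * t) = t" for t
    using \<delta> by (simp flip: mult.assoc)
  have u2: "u * u = 1 - c * (v * v)"
    using uv by (simp add: power2_eq_square algebra_simps)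
  have t: "transpose (plane_isometry u v \<delta>) = gblock u v 0 (- c * \<delta> * v) (\<delta> * u) 0 0 0 (mat 1)"
    by (simp add: plane_isometry_def gmatrix_eq_iff transpose_def mat_def)
  show "plane_isometry u v \<delta> \<in> grpG c I"
    unfolding grpG_def mem_Collect_eq t unfolding plane_isometry_def gram_def
    by (simp add: gblock_mult) (simp add: gmatrix_eq_iff algebra_simps \<delta> \<delta>\<delta> c_sq u2)
  have "plane_isometry u v \<delta> ** gblock u (c * v) 0 (- \<delta> * v) (\<delta> * u) 0 0 0 (mat 1) = gblock 1 0 0 0 1 0 0 0 (mat 1)"
    unfolding plane_isometry_def by (simp add: gblock_mult) (simp add: gmatrix_eq_iff algebra_simps \<delta> \<delta>\<delta> c_sq u2)
  then show inv: "matrix_inv (plane_isometry u v \<delta>) = gblock u (c * v) 0 (- \<delta> * v) (\<delta> * u) 0 0 0 (mat 1)"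
    unfolding gblock_one by (rule matrix_inv_eqI(1))
  have uu: "u * (u * t) = t - c * (v * (v * t))" for t
    using arg_cong[OF u2, of "\<lambda>s. s * t"] by (simp add: algebra_simps)
  show "matrix_inv (plane_isometry u v \<delta>) ** gmat c I a X Y A ** plane_isometry u v \<delta> =
       gmat c I (\<delta> * a) (u *\<^sub>R X + v *\<^sub>R Y) ((- c * \<delta> * v) *\<^sub>R X + (\<delta> * u) *\<^sub>R Y) A"
    unfolding inv unfolding plane_isometry_def gmat_def
    by (simp add: gblock_mult) (simp add: gmatrix_eq_iff algebra_simps \<delta> \<delta>\<delta> c_sq u2 uu)
qed

text \<open>
  The coefficients outside the blocks \<open>(2, 1)\<close> and \<open>(3, 2)\<close> enter only through the choice of \<open>\<zeta>\<close>: normality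
  determines them up to the freedom that the corner of \<open>p\<^sub>0\<close> absorbs.
\<close>

lemma coeffs_equivalent:
  assumes k: "has_coeffs \<alpha> k" "normal_coeffs k" and k': "has_coeffs \<alpha>' k'" "normal_coeffs k'"
    and uv: "u\<^sup>2 + c * v\<^sup>2 = 1" and \<delta>: "\<delta> * \<delta> = 1" and \<mu>: "\<mu> \<noteq> 0" and \<nu>: "\<nu> \<noteq> 0"
    and b: "k21X k = \<mu> * (k21X k' * u - c * \<delta> * v * k21Y k')" "k21Y k = \<mu> * (k21X k' * v + \<delta> * u * k21Y k')"
      "\<nu> * k32X k = k32X k' * u - c * \<delta> * v * k32Y k'" "\<nu> * k32Y k = k32X k' * v + \<delta> * u * k32Y k'"
  shows "equivalent c I \<alpha> \<alpha>'"
proof -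
  define \<zeta> where "\<zeta> = \<mu> * (\<delta> * k11 k' - k11 k) / kdet k"
  define p0 :: "'n lmatrix" where "p0 = lblock \<mu> 0 \<zeta> 0 (mat 1) 0 0 0 \<nu>"
  have n: "n > 0"
    by (simp add: n_def)
  have K: "kdet k \<noteq> 0" "k31 k = kdet k" "k11 k + n * k22 k + k33 k = 0"
     "(n + 1) * (kdet k * k22 k) = - (k21Y k * k32Y k + c * k21X k * k32X k)"
     "k21X k * k12Y k - k21Y k * k12X k = k11 k" "k32Y k * k23X k - k32X k * k23Y k = k33 k"
     "k12Y k * k23X k - k12X k * k23Y k = k13 k"
     "kdet k * (k32Y k * k12X k - k32X k * k12Y k) = - ((k32Y k)\<^sup>2 + c * (k32X k)\<^sup>2)"
     "kdet k * (k21X k * k23Y k - k21Y k * k23X k) = - ((k21Y k)\<^sup>2 + c * (k21X k)\<^sup>2)"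
    if "normal_coeffs k" for k
    using that by (auto simp: normal_coeffs_def)
  note a = K[OF k(2)] and a' = K[OF k'(2)]
  note eqs = gauge_equations[OF kdet_def a(1) kdet_def a'(1) n a(3) a'(3) a(4) a'(4) a(5) a'(5) a(6) a'(6)
      a(7) a'(7) a(8) a'(8) a(9) a'(9) c_sq(1) uv \<delta> \<mu> \<nu> b, folded \<zeta>_def]
  show ?thesis
  proof (rule equivalent_by_translation)
    show "plane_isometry u v \<delta> \<in> grpG c I"
      by (rule plane_isometry_properties(1)[OF uv \<delta>])
    have "p0 ** lblock (1 / \<mu>) 0 (- \<zeta> / (\<mu> * \<nu>)) 0 (mat 1) 0 0 0 (1 / \<nu>) = lblock 1 0 0 0 (mat 1) 0 0 0 1"
      unfolding p0_def lblock_mult lblock_inject using \<mu> \<nu> by simp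
    then have "p0 ** lblock (1 / \<mu>) 0 (- \<zeta> / (\<mu> * \<nu>)) 0 (mat 1) 0 0 0 (1 / \<nu>) = mat 1"
      by (simp only: lblock_one)
    then have "invertible p0"
      by (rule matrix_inv_eqI(2))
    moreover have "p0 \<in> upper_block"
      by (auto simp: upper_block_def all_lidx p0_def)
    ultimately show "p0 \<in> grpP"
      by (simp add: grpP_def)
    show "plane_isometry u v \<delta> ** g = g ** plane_isometry u v \<delta>" "p0 ** hom_i g = hom_i g ** p0" if "g \<in> grpK I" for g
      using that by (auto simp: grpK_iff plane_isometry_def p0_def hom_i_K_elem gblock_mult lblock_mult)
    fix \<xi> :: "'n gmatrix" assume "\<xi> \<in> algG c I"
    then obtain r X Y A where \<xi>: "\<xi> = gmat c I r X Y A" "A \<in> so_alg I"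
      by (auto simp: algG_def)
    have "\<alpha>' (matrix_inv (plane_isometry u v \<delta>) ** \<xi> ** plane_isometry u v \<delta>) ** p0 =
       coeff_block k' (\<delta> * r) (u *\<^sub>R X + v *\<^sub>R Y) ((- c * \<delta> * v) *\<^sub>R X + (\<delta> * u) *\<^sub>R Y) A ** p0"
      unfolding \<xi>(1) plane_isometry_properties(3)[OF uv \<delta>] using k'(1) \<xi>(2) by (simp add: has_coeffs_def)
    also have "\<dots> = p0 ** coeff_block k r X Y A"
    proof -
      have lin: "s * (u * p + v * q) + s' * (- c * \<delta> * v * p + \<delta> * u * q) = \<sigma> * p + \<tau> * q"
        if "s * u - c * \<delta> * v * s' = \<sigma>" "s * v + \<delta> * u * s' = \<tau>" for s s' p q \<sigma> \<tau> :: real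
        unfolding that[symmetric] by (simp add: algebra_simps)
      have scal: "s * r = t * r" if "s = t" for s t
        using that by simp
      note e11 = scal[OF eqs(1)] and e22 = scal[OF eqs(2)] and e13 = scal[OF eqs(5)] and e31 = scal[OF eqs(8)] and e33 = scal[OF eqs(9)]
      have b1: "\<mu> * k21X k' * u - c * \<delta> * v * (\<mu> * k21Y k') = k21X k" "\<mu> * k21X k' * v + \<delta> * u * (\<mu> * k21Y k') = k21Y k"
        by (simp_all add: b algebra_simps)
      have c1: "(\<zeta> * k21X k' + \<nu> * k23X k') * u - c * \<delta> * v * (\<zeta> * k21Y k' + \<nu> * k23Y k') = k23X k"
         "(\<zeta> * k21X k' + \<nu> * k23X k') * v + \<delta> * u * (\<zeta> * k21Y k' + \<nu> * k23Y k') = k23Y k"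
        unfolding eqs(6,7)[symmetric] by (simp_all add: algebra_simps)
      show ?thesis
        unfolding coeff_block_def p0_def lblock_mult lblock_inject
        apply (intro conjI)
        subgoal using e11 by (simp add: a(2) algebra_simps)
        subgoal
          unfolding vec_eq_iff
          apply (intro allI)
          subgoal for i
            using lin[OF eqs(3,4), of "I $ i $ i * X $ i" "I $ i $ i * Y $ i"] by (simp add: algebra_simps)
          done
        subgoal using e13 by (simp add: a(2) algebra_simps)
        subgoal
          unfolding vec_eq_iff
          apply (intro allI)
          subgoal for i
            using lin[OF b1, of "X $ i" "Y $ i"] by (simp add: algebra_simps)
          done
        subgoal using e22 by (simp add: algebra_simps)
        subgoal
          unfolding vec_eq_iff
          apply (intro allI)
          subgoal for i
            using lin[OF c1, of "X $ i" "Y $ i"] by (simp add: algebra_simps)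
          done
        subgoal using e31 by (simp add: a(2) a'(2) algebra_simps)
        subgoal
          unfolding vec_eq_iff
          apply (intro allI)
          subgoal for i
            using lin[OF b(3,4)[symmetric], of "I $ i $ i * X $ i" "I $ i $ i * Y $ i"] by (simp add: algebra_simps)
          done
        subgoal using e33 by (simp add: a(2) a'(2) algebra_simps)
        done
    qed
    also have "\<dots> = p0 ** \<alpha> \<xi>"
      using k(1) \<xi> by (simp add: has_coeffs_def)
    finally show "\<alpha>' (matrix_inv (plane_isometry u v \<delta>) ** \<xi> ** plane_isometry u v \<delta>) ** p0 = p0 ** \<alpha> \<xi>" .
  qed
qed

end

section \<open>The normal forms\<close>

context signature_form
begin

lemma regular_normal_extension_iff:
  assumes "has_coeffs \<alpha> k"
  shows "regular_normal_extension c I \<alpha> \<longleftrightarrow> normal_coeffs k"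
proof -
  have "normal_coeffs k \<Longrightarrow> admissible k \<and> k31 k = kdet k"
    by (auto simp: normal_coeffs_def admissible_def)
  then show ?thesis
    unfolding regular_normal_extension_def
    using extension_iff_admissible[OF assms] regular_iff[OF assms] normal_iff[OF assms] by blast
qed

lemma regular_normal_extension_coeffs:
  assumes "regular_normal_extension c I \<alpha>"
  obtains k where "has_coeffs \<alpha> k" "normal_coeffs k"
proof -
  obtain k where "has_coeffs \<alpha> k"
    using assms extension_has_coeffs unfolding regular_normal_extension_def by blast
  then show thesis
    using that assms regular_normal_extension_iff by blast
qed

text \<open>
  In particular the parameters \<open>b\<^sub>1, \<dots>, b\<^sub>4\<close> of a regular normal extension are unique.
\<close>

lemma ext_params_coeffs:
  assumes \<alpha>: "has_coeffs \<alpha> k" and k: "normal_coeffs k"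
  shows "ext_params c I \<alpha> b1 b2 b3 b4 \<longleftrightarrow> b1 = k21X k \<and> b2 = k21Y k \<and> b3 = k32X k \<and> b4 = k32Y k"
proof
  assume p: "ext_params c I \<alpha> b1 b2 b3 b4"
  let ?e = "axis undefined 1 :: real ^ 'n"
  have "\<alpha> (gmat c I 0 X Y 0) = coeff_block k 0 X Y 0" for X Y
    using \<alpha> so_alg_zero by (simp add: has_coeffs_def)
  then have col: "coeff_block k 0 X Y 0 $ LV i $ L1 = (b1 *\<^sub>R X + b2 *\<^sub>R Y) $ i"
    and row: "coeff_block k 0 X Y 0 $ L2 $ LV i = (b3 *\<^sub>R (X v* I) + b4 *\<^sub>R (Y v* I)) $ i" for X Y i
    using p so_alg_zero unfolding ext_params_def by metis+
  show "b1 = k21X k \<and> b2 = k21Y k \<and> b3 = k32X k \<and> b4 = k32Y k"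
    using col[of ?e 0 undefined] col[of 0 ?e undefined] row[of ?e 0 undefined] row[of 0 ?e undefined] I_nz
    by (simp add: coeff_block_def)
next
  assume "b1 = k21X k \<and> b2 = k21Y k \<and> b3 = k32X k \<and> b4 = k32Y k"
  then show "ext_params c I \<alpha> b1 b2 b3 b4"
    using \<alpha> k unfolding ext_params_def has_coeffs_def normal_coeffs_def kdet_def
    by (simp add: coeff_block_def)
qed

text \<open>
  All rational functions of \<open>n\<close> in the normal forms are polynomials in this one.
\<close>

definition \<theta> :: real where
  "\<theta> = n / (2 * (n + 1))"

lemma \<theta>_simps:
  "n / (2 * (n + 1)) = \<theta>" "(n + 2) / (2 * (n + 1)) = 1 - \<theta>" "1 / (n + 1) = 1 - 2 * \<theta>"
  "(3 * n + 2) * (n + 2) / (4 * (n + 1)\<^sup>2) = 1 - \<theta>\<^sup>2"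
  "n / (4 * (n + 1)) = \<theta> / 2" "n\<^sup>2 / (8 * (n + 1)\<^sup>2) = \<theta>\<^sup>2 / 2"
  "(n + 2) / (n + 1) = 2 - 2 * \<theta>" "n * (1 - 2 * \<theta>) = 2 * \<theta>" "(n + 1) * (1 - 2 * \<theta>) = 1"
proof -
  have "n > 0" "n + 1 \<noteq> 0"
    by (auto simp: n_def)
  then show
    "n / (2 * (n + 1)) = \<theta>" "(n + 2) / (2 * (n + 1)) = 1 - \<theta>" "1 / (n + 1) = 1 - 2 * \<theta>"
    "n / (4 * (n + 1)) = \<theta> / 2" "n\<^sup>2 / (8 * (n + 1)\<^sup>2) = \<theta>\<^sup>2 / 2"
    "(n + 2) / (n + 1) = 2 - 2 * \<theta>" "n * (1 - 2 * \<theta>) = 2 * \<theta>" "(n + 1) * (1 - 2 * \<theta>) = 1"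
    unfolding \<theta>_def by (simp_all add: field_simps power2_eq_square)
  have A: "(3 * n + 2) / (2 * (n + 1)) = 1 + \<theta>" and B: "(n + 2) / (2 * (n + 1)) = 1 - \<theta>"
    unfolding \<theta>_def using \<open>n > 0\<close> by (simp_all add: field_simps)
  have "(3 * n + 2) * (n + 2) / (4 * (n + 1)\<^sup>2) = (3 * n + 2) / (2 * (n + 1)) * ((n + 2) / (2 * (n + 1)))"
    by (simp add: power2_eq_square) (simp add: algebra_simps)
  also have "\<dots> = 1 - \<theta>\<^sup>2"
    unfolding A B by (simp add: power2_eq_square algebra_simps)
  finally show "(3 * n + 2) * (n + 2) / (4 * (n + 1)\<^sup>2) = 1 - \<theta>\<^sup>2" .
qed

definition coeffs_I :: "real \<Rightarrow> coeffs" where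
  "coeffs_I t = \<lparr>k11 = \<theta> * t, k12X = - ((1 - \<theta>) * c * t\<^sup>2 + 1), k12Y = \<theta> * t, k13 = - (1 - \<theta>\<^sup>2) * t\<^sup>2 - c,
     k21X = 1, k21Y = 0, k22 = - ((1 - 2 * \<theta>) * t), k23X = - ((1 - \<theta>) * t), k23Y = - c,
     k31 = 1, k32X = c * t, k32Y = 1, k33 = \<theta> * t\<rparr>"

definition coeffs_IIa :: coeffs where
  "coeffs_IIa = \<lparr>k11 = \<theta>, k12X = - 1, k12Y = - (1 - \<theta>), k13 = \<theta>\<^sup>2,
     k21X = 1, k21Y = 1, k22 = - (1 - 2 * \<theta>), k23X = \<theta>, k23Y = \<theta>,
     k31 = 1, k32X = 0, k32Y = 1, k33 = \<theta>\<rparr>"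

definition coeffs_IIb :: coeffs where
  "coeffs_IIb = \<lparr>k11 = \<theta>, k12X = - (\<theta> / 2), k12Y = \<theta> / 2, k13 = \<theta>\<^sup>2 / 2,
     k21X = 1, k21Y = 1, k22 = - (1 - 2 * \<theta>), k23X = \<theta> / 2, k23Y = \<theta> / 2,
     k31 = 2, k32X = - 1, k32Y = 1, k33 = \<theta>\<rparr>"

lemma has_coeffs_I: "has_coeffs (alpha_I c I t) (coeffs_I t)"
  unfolding has_coeffs_def alpha_I_def of_blocks_gmat Let_def coeff_block_def coeffs_I_def coeffs.simps
    lblock_inject n_def[symmetric] \<theta>_simps
  by (simp add: algebra_simps)

lemma has_coeffs_IIa: "c = - 1 \<Longrightarrow> has_coeffs (alpha_IIa I) coeffs_IIa"
  unfolding has_coeffs_def alpha_IIa_def of_blocks_gmat Let_def coeff_block_def coeffs_IIa_def coeffs.simps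
    lblock_inject n_def[symmetric] \<theta>_simps
  by (simp add: algebra_simps)

lemma has_coeffs_IIb: "c = - 1 \<Longrightarrow> has_coeffs (alpha_IIb I) coeffs_IIb"
  unfolding has_coeffs_def alpha_IIb_def of_blocks_gmat Let_def coeff_block_def coeffs_IIb_def coeffs.simps
    lblock_inject n_def[symmetric] \<theta>_simps
  by (simp add: algebra_simps)

lemma normal_coeffs_I: "normal_coeffs (coeffs_I t)"
proof -
  have "n * (- ((1 - 2 * \<theta>) * t)) = - (2 * \<theta> * t)" "(n + 1) * (r * - ((1 - 2 * \<theta>) * t)) = - (r * t)" for r
    using \<theta>_simps(8,9) by (metis mult.assoc mult.commute mult_minus_right mult_1)+
  then show ?thesis
    unfolding normal_coeffs_def coeffs_I_def coeffs.simps kdet_def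
    by (simp add: algebra_simps power2_eq_square c_sq)
qed

lemma normal_coeffs_IIa: "c = - 1 \<Longrightarrow> normal_coeffs coeffs_IIa"
  using \<theta>_simps(8,9) unfolding normal_coeffs_def coeffs_IIa_def coeffs.simps kdet_def
  by (simp add: algebra_simps power2_eq_square)

lemma normal_coeffs_IIb: "c = - 1 \<Longrightarrow> normal_coeffs coeffs_IIb"
  using \<theta>_simps(8,9) unfolding normal_coeffs_def coeffs_IIb_def coeffs.simps kdet_def
  by (simp add: algebra_simps power2_eq_square)

lemma curvature_I:
  "curvature (alpha_I c I t) (gmat c I a X Y 0) (gmat c I b Z U 0) = curv_I c I t a X Y b Z U"
proof -
  have "curv_coeffs (coeffs_I t) = \<lparr>f11 = 0, f12P = (2 - 2 * \<theta>) * t * (1 + c * t\<^sup>2), f12Q = 0, f13 = 0,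
     f21P = 0, f21Q = 0, fXZ = - ((2 - 2 * \<theta>) * c * t\<^sup>2), fXU = - ((1 - 2 * \<theta>) * t), fYZ = - t, fYU = 0,
     f22 = - ((1 - 2 * \<theta>) * t), f23P = - (2 - 2 * \<theta>) * t\<^sup>2, f23Q = - (2 - 2 * \<theta>) * t * c, f31 = 0,
     f32P = 0, f32Q = 0, f33 = 0\<rparr>"
    unfolding curv_coeffs_def coeffs_I_def coeffs.simps kdet_def
    by (simp add: algebra_simps power2_eq_square c_sq)
  then have L: "curvature (alpha_I c I t) (gmat c I a X Y 0) (gmat c I b Z U 0) = form_block \<lparr>f11 = 0, f12P = (2 - 2 * \<theta>) * t * (1 + c * t\<^sup>2), f12Q = 0, f13 = 0,
     f21P = 0, f21Q = 0, fXZ = - ((2 - 2 * \<theta>) * c * t\<^sup>2), fXU = - ((1 - 2 * \<theta>) * t), fYZ = - t, fYU = 0,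
     f22 = - ((1 - 2 * \<theta>) * t), f23P = - (2 - 2 * \<theta>) * t\<^sup>2, f23Q = - (2 - 2 * \<theta>) * t * c, f31 = 0,
     f32P = 0, f32Q = 0, f33 = 0\<rparr> a X Y b Z U"
    using curvature_coeffs[OF has_coeffs_I so_alg_zero so_alg_zero] by simp
  have q: "(n + 2) * t / (n + 1) = (2 - 2 * \<theta>) * t" "t / (n + 1) = (1 - 2 * \<theta>) * t"
    "t * r / (n + 1) = (1 - 2 * \<theta>) * t * r" for r
    unfolding \<theta>_simps(3,7)[symmetric] by simp_all
  have m: "(1 - 2 * \<theta>) * t * (n + 1) = t" "(1 - 2 * \<theta>) * t * ((n + 2) * c * t) = (2 - 2 * \<theta>) * c * t\<^sup>2"
  proof -
    show "(1 - 2 * \<theta>) * t * (n + 1) = t"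
      using \<theta>_simps(9) by (metis mult.assoc mult.commute mult_1)
    have "(1 - 2 * \<theta>) * (n + 2) = 2 - 2 * \<theta>"
      using \<theta>_simps(9) by (simp add: algebra_simps)
    moreover have "(1 - 2 * \<theta>) * t * ((n + 2) * c * t) = (1 - 2 * \<theta>) * (n + 2) * c * t\<^sup>2"
      by (simp add: power2_eq_square ac_simps)
    ultimately show "(1 - 2 * \<theta>) * t * ((n + 2) * c * t) = (2 - 2 * \<theta>) * c * t\<^sup>2"
      by simp
  qed
  show ?thesis
    unfolding L form_block_def curv_I_def Let_def form_coeffs.simps n_def[symmetric] q scaleR_add_right scaleR_diff_right
      scaleR_scaleR m lblock_inject
    by (simp add: vec_eq_iff mat_def ip_commute[of U X] algebra_simps power2_eq_square)
qed

lemma curvature_IIa: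
  assumes c: "c = - 1"
  shows "curvature (alpha_IIa I) (gmat c I a X Y 0) (gmat c I b Z U 0) = curv_IIa I a X Y b Z U"
proof -
  have "curv_coeffs coeffs_IIa = \<lparr>f11 = 0, f12P = 2 - 2 * \<theta>, f12Q = 2 - 2 * \<theta>, f13 = 0,
     f21P = 0, f21Q = 0, fXZ = 0, fXU = - (1 - 2 * \<theta>), fYZ = - 1, fYU = - (2 - 2 * \<theta>),
     f22 = - (1 - 2 * \<theta>), f23P = 0, f23Q = 0, f31 = 0, f32P = 0, f32Q = 0, f33 = 0\<rparr>"
    unfolding curv_coeffs_def coeffs_IIa_def coeffs.simps kdet_def
    by (simp add: c algebra_simps power2_eq_square)
  then have L: "curvature (alpha_IIa I) (gmat c I a X Y 0) (gmat c I b Z U 0) = form_block \<lparr>f11 = 0,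
     f12P = 2 - 2 * \<theta>, f12Q = 2 - 2 * \<theta>, f13 = 0,
     f21P = 0, f21Q = 0, fXZ = 0, fXU = - (1 - 2 * \<theta>), fYZ = - 1, fYU = - (2 - 2 * \<theta>),
     f22 = - (1 - 2 * \<theta>), f23P = 0, f23Q = 0, f31 = 0, f32P = 0, f32Q = 0, f33 = 0\<rparr> a X Y b Z U"
    using curvature_coeffs[OF has_coeffs_IIa[OF c] so_alg_zero so_alg_zero] by simp
  have q: "r / (n + 1) = (1 - 2 * \<theta>) * r" for r
    unfolding \<theta>_simps(3)[symmetric] by simp
  have m: "(1 - 2 * \<theta>) * (n + 1) = 1" "(1 - 2 * \<theta>) * (n + 2) = 2 - 2 * \<theta>"
    using \<theta>_simps(9) by (simp_all add: algebra_simps)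
  show ?thesis
    unfolding L form_block_def curv_IIa_def Let_def form_coeffs.simps n_def[symmetric] q scaleR_add_right scaleR_diff_right
      scaleR_scaleR mult_1_right m lblock_inject
    by (simp add: vec_eq_iff mat_def ip_commute[of U X] algebra_simps)
qed

lemma curvature_IIb:
  assumes c: "c = - 1"
  shows "curvature (alpha_IIb I) (gmat c I a X Y 0) (gmat c I b Z U 0) = curv_IIb I a X Y b Z U"
proof -
  have "curv_coeffs coeffs_IIb = \<lparr>f11 = 0, f12P = 0, f12Q = 0, f13 = 0,
     f21P = 0, f21Q = 0, fXZ = 1 - \<theta>, fXU = \<theta>, fYZ = - \<theta>, fYU = - (1 - \<theta>),
     f22 = - (1 - 2 * \<theta>), f23P = 0, f23Q = 0, f31 = 0, f32P = 0, f32Q = 0, f33 = 0\<rparr>"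
    unfolding curv_coeffs_def coeffs_IIb_def coeffs.simps kdet_def
    by (simp add: c algebra_simps power2_eq_square) (simp add: field_simps)
  then have L: "curvature (alpha_IIb I) (gmat c I a X Y 0) (gmat c I b Z U 0) = form_block \<lparr>f11 = 0,
     f12P = 0, f12Q = 0, f13 = 0,
     f21P = 0, f21Q = 0, fXZ = 1 - \<theta>, fXU = \<theta>, fYZ = - \<theta>, fYU = - (1 - \<theta>),
     f22 = - (1 - 2 * \<theta>), f23P = 0, f23Q = 0, f31 = 0, f32P = 0, f32Q = 0, f33 = 0\<rparr> a X Y b Z U"
    using curvature_coeffs[OF has_coeffs_IIb[OF c] so_alg_zero so_alg_zero] by simp
  have q: "r / (n + 1) = (1 - 2 * \<theta>) * r" for r
    unfolding \<theta>_simps(3)[symmetric] by simp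
  have m: "1 / (2 * (n + 1)) * n = \<theta>" "1 / (2 * (n + 1)) * (n + 2) = 1 - \<theta>"
    using \<theta>_simps(1,2) by simp_all
  show ?thesis
    unfolding L form_block_def curv_IIb_def Let_def form_coeffs.simps n_def[symmetric] q scaleR_add_right scaleR_diff_right
      scaleR_scaleR m lblock_inject
    by (simp add: vec_eq_iff mat_def ip_commute[of U X] algebra_simps)
qed

text \<open>
  The isometry has first column \<open>(b\<^sub>1, b\<^sub>2) / r\<close> and determinant \<open>\<epsilon>\<close>. It brings \<open>(b\<^sub>3, b\<^sub>4)\<close> to a multiple
  of \<open>(c t, 1)\<close> with \<open>t = \<epsilon> (b\<^sub>2b\<^sub>4 + c b\<^sub>1b\<^sub>3) / D\<close>, so a suitable sign \<open>\<epsilon>\<close> makes \<open>t\<close> nonnegative.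
\<close>

lemma equivalent_alpha_I:
  assumes k: "has_coeffs \<alpha> k" "normal_coeffs k" and pos: "(k21X k)\<^sup>2 + c * (k21Y k)\<^sup>2 > 0"
  shows "\<exists>t\<ge>0. equivalent c I \<alpha> (alpha_I c I t)"
proof -
  define r where "r = sqrt ((k21X k)\<^sup>2 + c * (k21Y k)\<^sup>2)"
  define W where "W = (k21Y k * k32Y k + c * k21X k * k32X k) / kdet k"
  define \<epsilon> :: real where "\<epsilon> = (if W \<ge> 0 then 1 else - 1)"
  have r: "r > 0" "r * r = k21X k * k21X k + c * (k21Y k * k21Y k)"
    using pos by (simp_all add: r_def flip: power2_eq_square)
  have D: "kdet k \<noteq> 0"
    using k(2) by (simp add: normal_coeffs_def)
  have \<epsilon>: "\<epsilon> * \<epsilon> = 1" "\<epsilon> * W \<ge> 0" "\<epsilon> \<noteq> 0"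
    by (auto simp: \<epsilon>_def)
  have WD: "W * kdet k = k21Y k * k32Y k + c * k21X k * k32X k"
    using D by (simp add: W_def)
  have b3: "r * r * k32X k = kdet k * (c * W * k21X k - c * k21Y k)"
  proof -
    have "kdet k * (c * W * k21X k - c * k21Y k) = c * k21X k * (W * kdet k) - c * k21Y k * kdet k"
      by (simp add: algebra_simps)
    then show ?thesis
      unfolding WD r(2) by (simp add: kdet_def algebra_simps c_sq)
  qed
  have b4: "r * r * k32Y k = kdet k * (c * W * k21Y k + k21X k)"
  proof -
    have "kdet k * (c * W * k21Y k + k21X k) = c * k21Y k * (W * kdet k) + k21X k * kdet k"
      by (simp add: algebra_simps)
    then show ?thesis
      unfolding WD r(2) by (simp add: kdet_def algebra_simps c_sq)
  qed
  have "equivalent c I \<alpha> (alpha_I c I (\<epsilon> * W))"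
  proof (rule coeffs_equivalent[OF k has_coeffs_I normal_coeffs_I, of "k21X k / r" "k21Y k / r" \<epsilon> r "\<epsilon> * r / kdet k"])
    have "(k21X k / r)\<^sup>2 + c * (k21Y k / r)\<^sup>2 = (k21X k * k21X k + c * (k21Y k * k21Y k)) / (r * r)"
      by (simp add: power2_eq_square add_divide_distrib)
    also have "\<dots> = 1"
      unfolding r(2)[symmetric] using r(1) by simp
    finally show "(k21X k / r)\<^sup>2 + c * (k21Y k / r)\<^sup>2 = 1" .
    have "\<epsilon> * r / kdet k * k32X k = \<epsilon> * (r * r * k32X k) / (kdet k * r)"
      "\<epsilon> * r / kdet k * k32Y k = \<epsilon> * (r * r * k32Y k) / (kdet k * r)"
      using r(1) by simp_all
    then show "\<epsilon> * r / kdet k * k32X k = k32X (coeffs_I (\<epsilon> * W)) * (k21X k / r) - c * \<epsilon> * (k21Y k / r) * k32Y (coeffs_I (\<epsilon> * W))"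
      "\<epsilon> * r / kdet k * k32Y k = k32X (coeffs_I (\<epsilon> * W)) * (k21Y k / r) + \<epsilon> * (k21X k / r) * k32Y (coeffs_I (\<epsilon> * W))"
      unfolding b3 b4 using D r(1)
      by (simp_all add: coeffs_I_def diff_divide_distrib add_divide_distrib right_diff_distrib distrib_left ac_simps)
  qed (use r D \<epsilon> in \<open>simp_all add: coeffs_I_def\<close>)
  then show ?thesis
    using \<epsilon>(2) by blast
qed

text \<open>
  The two isometries that move \<open>(b\<^sub>3, b\<^sub>4) / m\<close> to \<open>(0, 1)\<close> differ by a reflection, so one of them, the one whose
  determinant is the sign \<open>\<eta>\<close> with \<open>b\<^sub>2 = \<eta> b\<^sub>1\<close>, moves the isotropic vector \<open>(b\<^sub>1, b\<^sub>2)\<close> to a multiple of \<open>(1, 1)\<close>.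
\<close>

lemma equivalent_alpha_IIa:
  assumes k: "has_coeffs \<alpha> k" "normal_coeffs k" and c: "c = - 1"
    and b: "(k21X k)\<^sup>2 = (k21Y k)\<^sup>2" "(k32X k)\<^sup>2 < (k32Y k)\<^sup>2"
  shows "equivalent c I \<alpha> (alpha_IIa I)"
proof -
  define m where "m = sqrt ((k32Y k)\<^sup>2 - (k32X k)\<^sup>2)"
  have m: "m > 0" "m * m = k32Y k * k32Y k - k32X k * k32X k"
    using b(2) by (simp_all add: m_def flip: power2_eq_square)
  have D: "kdet k \<noteq> 0"
    using k(2) by (simp add: normal_coeffs_def)
  obtain \<eta> :: real where \<eta>: "\<eta> = 1 \<or> \<eta> = - 1" "k21Y k = \<eta> * k21X k"
    using b(1) by (metis power2_eq_iff mult_1 mult_minus1)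
  then have \<eta>\<eta>: "\<eta> * \<eta> = 1" "\<eta> * (\<eta> * s) = s" for s
    by auto
  have nz: "k21X k \<noteq> 0" "\<eta> * k32Y k + k32X k \<noteq> 0"
    using D \<eta> b(2) by (auto simp: kdet_def add_eq_0_iff)
  show ?thesis
  proof (rule coeffs_equivalent[OF k has_coeffs_IIa[OF c] normal_coeffs_IIa[OF c],
        of "\<eta> * k32Y k / m" "\<eta> * k32X k / m" \<eta> "k21X k * m / (\<eta> * k32Y k + k32X k)" "1 / m"])
    have "(\<eta> * k32Y k / m)\<^sup>2 + c * (\<eta> * k32X k / m)\<^sup>2 = (\<eta> * \<eta>) * (k32Y k * k32Y k - k32X k * k32X k) / (m * m)"
      by (simp add: c power2_eq_square diff_divide_distrib right_diff_distrib ac_simps)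
    also have "\<dots> = 1"
      unfolding m(2)[symmetric] \<eta>\<eta> using m(1) by simp
    finally show "(\<eta> * k32Y k / m)\<^sup>2 + c * (\<eta> * k32X k / m)\<^sup>2 = 1" .
  next
    have "\<eta> * k32X k + k32Y k = \<eta> * (\<eta> * k32Y k + k32X k)"
      by (simp add: distrib_left \<eta>\<eta>)
    then show "k21Y k = k21X k * m / (\<eta> * k32Y k + k32X k) * (k21X coeffs_IIa * (\<eta> * k32X k / m) + \<eta> * (\<eta> * k32Y k / m) * k21Y coeffs_IIa)"
      using m(1) nz by (simp add: coeffs_IIa_def \<eta>(2) \<eta>\<eta> flip: add_divide_distrib)
  qed (use m(1) nz in \<open>simp_all add: coeffs_IIa_def c \<eta>\<eta> flip: add_divide_distrib\<close>)
qed

text \<open>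
  Both vectors are isotropic, and they lie on different null lines because \<open>D \<noteq> 0\<close>. So a reflection and scalings suffice.
\<close>

lemma equivalent_alpha_IIb:
  assumes k: "has_coeffs \<alpha> k" "normal_coeffs k" and c: "c = - 1"
    and b: "(k21X k)\<^sup>2 = (k21Y k)\<^sup>2" "(k32X k)\<^sup>2 = (k32Y k)\<^sup>2"
  shows "equivalent c I \<alpha> (alpha_IIb I)"
proof -
  have D: "kdet k \<noteq> 0"
    using k(2) by (simp add: normal_coeffs_def)
  obtain \<eta> :: real where \<eta>: "\<eta> = 1 \<or> \<eta> = - 1" "k21Y k = \<eta> * k21X k"
    using b(1) by (metis power2_eq_iff mult_1 mult_minus1)
  have b4: "k32Y k = - \<eta> * k32X k"
    using D \<eta> b(2) by (auto simp: kdet_def power2_eq_iff)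
  have nz: "k21X k \<noteq> 0" "k32X k \<noteq> 0"
    using D \<eta> b4 by (auto simp: kdet_def)
  show ?thesis
    by (rule coeffs_equivalent[OF k has_coeffs_IIb[OF c] normal_coeffs_IIb[OF c],
        of 1 0 \<eta> "k21X k" "- 1 / k32X k"]) (use nz \<eta> b4 in \<open>auto simp: coeffs_IIb_def c\<close>)
qed

end

lemma signature_formI:
  fixes I :: "real ^ 'n ^ ('n::finite)"
  assumes "signature_matrix p q I" "c = 1 \<or> c = - 1"
  shows "signature_form c (real CARD('n)) I"
  using assms by unfold_locales (auto simp: signature_matrix_def)

theorem theorem5p6:
  fixes I :: "real ^ 'n ^ 'n" and p q :: nat
  assumes "signature_matrix p q I"
  shows
    "(\<forall>c\<in>{1, - 1}. \<forall>t\<ge>0.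
        regular_normal_extension c I (alpha_I c I t) \<and>
        (\<forall>a X Y b Z U.
           curvature (alpha_I c I t) (gmat c I a X Y 0) (gmat c I b Z U 0)
             = curv_I c I t a X Y b Z U)) \<and>
     (\<forall>\<alpha>. regular_normal_extension 1 I \<alpha> \<longrightarrow>
        (\<exists>t\<ge>0. equivalent 1 I \<alpha> (alpha_I 1 I t))) \<and>
     (\<forall>t\<ge>0. \<exists>b1 b2 b3 b4. ext_params (- 1) I (alpha_I (- 1) I t) b1 b2 b3 b4 \<and> b1\<^sup>2 > b2\<^sup>2) \<and>
     (\<forall>\<alpha> b1 b2 b3 b4.
        regular_normal_extension (- 1) I \<alpha> \<and> ext_params (- 1) I \<alpha> b1 b2 b3 b4 \<and> b1\<^sup>2 > b2\<^sup>2 \<longrightarrow>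
        (\<exists>t\<ge>0. equivalent (- 1) I \<alpha> (alpha_I (- 1) I t))) \<and>

     (regular_normal_extension (- 1) I (alpha_IIa I) \<and>
      (\<exists>b1 b2 b3 b4. ext_params (- 1) I (alpha_IIa I) b1 b2 b3 b4 \<and> b1\<^sup>2 = b2\<^sup>2 \<and> b3\<^sup>2 < b4\<^sup>2) \<and>
      (\<forall>a X Y b Z U.
         curvature (alpha_IIa I) (gmat (- 1) I a X Y 0) (gmat (- 1) I b Z U 0)
           = curv_IIa I a X Y b Z U) \<and>
      (\<forall>\<alpha> b1 b2 b3 b4.
         regular_normal_extension (- 1) I \<alpha> \<and> ext_params (- 1) I \<alpha> b1 b2 b3 b4 \<and>
         b1\<^sup>2 = b2\<^sup>2 \<and> b3\<^sup>2 < b4\<^sup>2 \<longrightarrow>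
         equivalent (- 1) I \<alpha> (alpha_IIa I))) \<and>

     (regular_normal_extension (- 1) I (alpha_IIb I) \<and>
      (\<exists>b1 b2 b3 b4. ext_params (- 1) I (alpha_IIb I) b1 b2 b3 b4 \<and> b1\<^sup>2 = b2\<^sup>2 \<and> b3\<^sup>2 = b4\<^sup>2) \<and>
      (\<forall>a X Y b Z U.
         curvature (alpha_IIb I) (gmat (- 1) I a X Y 0) (gmat (- 1) I b Z U 0)
           = curv_IIb I a X Y b Z U) \<and>
      (\<forall>\<alpha> b1 b2 b3 b4.
         regular_normal_extension (- 1) I \<alpha> \<and> ext_params (- 1) I \<alpha> b1 b2 b3 b4 \<and>
         b1\<^sup>2 = b2\<^sup>2 \<and> b3\<^sup>2 = b4\<^sup>2 \<longrightarrow>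
         equivalent (- 1) I \<alpha> (alpha_IIb I)))"
proof -
  interpret P: signature_form 1 "real CARD('n)" I
    using signature_formI[OF assms] by blast
  interpret M: signature_form "- 1" "real CARD('n)" I
    using signature_formI[OF assms] by blast
  have form: "signature_form c (real CARD('n)) I" if "c \<in> {1, - 1}" for c
    using signature_formI[OF assms] that by blast
  have norm_I: "regular_normal_extension c I (alpha_I c I t)"
    and curv_I: "curvature (alpha_I c I t) (gmat c I a X Y 0) (gmat c I b Z U 0) = curv_I c I t a X Y b Z U"
    if "c \<in> {1, - 1}" for c t a X Y b Z U
    using signature_form.regular_normal_extension_iff[OF form[OF that] signature_form.has_coeffs_I[OF form[OF that]]]
      signature_form.normal_coeffs_I[OF form[OF that]] signature_form.curvature_I[OF form[OF that]] by blast+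
  have all_I_plus: "\<exists>t\<ge>0. equivalent 1 I \<alpha> (alpha_I 1 I t)" if rn: "regular_normal_extension 1 I \<alpha>" for \<alpha>
  proof -
    obtain k where k: "P.has_coeffs \<alpha> k" "P.normal_coeffs k"
      using P.regular_normal_extension_coeffs[OF rn] .
    have "k21X k \<noteq> 0 \<or> k21Y k \<noteq> 0"
      using k(2) by (auto simp: P.normal_coeffs_def kdet_def)
    then have "(k21X k)\<^sup>2 + 1 * (k21Y k)\<^sup>2 > 0"
      by (simp add: sum_power2_gt_zero_iff)
    then show ?thesis
      by (rule P.equivalent_alpha_I[OF k])
  qed
  have params_I: "\<exists>b1 b2 b3 b4. ext_params (- 1) I (alpha_I (- 1) I t) b1 b2 b3 b4 \<and> b1\<^sup>2 > b2\<^sup>2" for t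
    using M.ext_params_coeffs[OF M.has_coeffs_I M.normal_coeffs_I, of t] by (auto simp: M.coeffs_I_def)
  have params_IIa: "\<exists>b1 b2 b3 b4. ext_params (- 1) I (alpha_IIa I) b1 b2 b3 b4 \<and> b1\<^sup>2 = b2\<^sup>2 \<and> b3\<^sup>2 < b4\<^sup>2"
    using M.ext_params_coeffs[OF M.has_coeffs_IIa M.normal_coeffs_IIa] by (auto simp: M.coeffs_IIa_def)
  have params_IIb: "\<exists>b1 b2 b3 b4. ext_params (- 1) I (alpha_IIb I) b1 b2 b3 b4 \<and> b1\<^sup>2 = b2\<^sup>2 \<and> b3\<^sup>2 = b4\<^sup>2"
    using M.ext_params_coeffs[OF M.has_coeffs_IIb M.normal_coeffs_IIb] by (auto simp: M.coeffs_IIb_def)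
  have coeffs: "\<exists>k. M.has_coeffs \<alpha> k \<and> M.normal_coeffs k \<and> k21X k = b1 \<and> k21Y k = b2 \<and> k32X k = b3 \<and> k32Y k = b4"
    if "regular_normal_extension (- 1) I \<alpha>" "ext_params (- 1) I \<alpha> b1 b2 b3 b4" for \<alpha> b1 b2 b3 b4
    using M.regular_normal_extension_coeffs[OF that(1)] M.ext_params_coeffs that(2) by metis
  have all_I_minus: "\<exists>t\<ge>0. equivalent (- 1) I \<alpha> (alpha_I (- 1) I t)"
    if "regular_normal_extension (- 1) I \<alpha>" "ext_params (- 1) I \<alpha> b1 b2 b3 b4" "b1\<^sup>2 > b2\<^sup>2" for \<alpha> b1 b2 b3 b4
    using coeffs[OF that(1,2)] M.equivalent_alpha_I that(3) by fastforce
  have all_IIa: "equivalent (- 1) I \<alpha> (alpha_IIa I)"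
    if "regular_normal_extension (- 1) I \<alpha>" "ext_params (- 1) I \<alpha> b1 b2 b3 b4" "b1\<^sup>2 = b2\<^sup>2" "b3\<^sup>2 < b4\<^sup>2" for \<alpha> b1 b2 b3 b4
    using coeffs[OF that(1,2)] M.equivalent_alpha_IIa that(3,4) by blast
  have all_IIb: "equivalent (- 1) I \<alpha> (alpha_IIb I)"
    if "regular_normal_extension (- 1) I \<alpha>" "ext_params (- 1) I \<alpha> b1 b2 b3 b4" "b1\<^sup>2 = b2\<^sup>2" "b3\<^sup>2 = b4\<^sup>2" for \<alpha> b1 b2 b3 b4
    using coeffs[OF that(1,2)] M.equivalent_alpha_IIb that(3,4) by blast
  have norm_II: "regular_normal_extension (- 1) I (alpha_IIa I)" "regular_normal_extension (- 1) I (alpha_IIb I)"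
    using M.regular_normal_extension_iff[OF M.has_coeffs_IIa] M.normal_coeffs_IIa
      M.regular_normal_extension_iff[OF M.has_coeffs_IIb] M.normal_coeffs_IIb by blast+
  show ?thesis
    apply (intro conjI allI ballI impI; (elim conjE)?)
    subgoal by (rule norm_I)
    subgoal by (rule curv_I)
    subgoal by (rule all_I_plus)
    subgoal by (rule params_I)
    subgoal by (rule all_I_minus)
    subgoal by (rule norm_II(1))
    subgoal by (rule params_IIa)
    subgoal by (rule M.curvature_IIa[OF refl])
    subgoal by (rule all_IIa)
    subgoal by (rule norm_II(2))
    subgoal by (rule params_IIb)
    subgoal by (rule M.curvature_IIb[OF refl])
    subgoal by (rule all_IIb)
    done
qed

end
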